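(* Let $C=0.63$. There exists $d>0$ such that, if $G=\mathrm{Sym}(n)$ or $G=\mathrm{Alt}(n)$ and $S$ is a set of generators of $G$ containing an element $g$ with $|\mathrm{supp}(g)|\le Cn$, then $$\mathrm{diam}(\vec{\Gamma}(G,S))\le O(n^{d}).$$
   Context: $\mathrm{Sym}(n)$ and $\mathrm{Alt}(n)$ are the symmetric and alternating groups acting on $\Omega=\{1,\dots,n\}$. For $g\in \mathrm{Sym}(n)$, $\mathrm{supp}(g)=\{\gamma\in\Omega \mid \gamma^g\ne\gamma\}$, where $\gamma^g$ is the image of $\gamma$ under $g$. For a group $G=\langle S\rangle$, $\vec{\Gamma}(G,S)$ is the directed Cayley graph with vertex set $G$ and edge set $\{(g,sg)\mid g\in G, s\in S\}$. Its diameter $\mathrm{diam}(\vec{\Gamma}(G,S))$ is the maximum over $g\in G$ of the length $m$ of a shortest expression $g=s_1\cdots s_m$ with each $s_k\in S$ (inverses are not used). *)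

theory Defs
  imports "HOL-Algebra.Sym_Groups" "HOL-Algebra.Multiplicative_Group" "Graph_Theory.Shortest_Path"
begin

definition supp :: "nat \<Rightarrow> (nat \<Rightarrow> nat) \<Rightarrow> nat set" where
  "supp n g = {\<gamma> \<in> {1..n}. g \<gamma> \<noteq> \<gamma>}"

text \<open>
  In \<^term>\<open>sym_group n\<close> the product is \<open>(\<circ>)\<close>, whereas the right-action notation
  \<open>\<gamma>\<^sup>g\<close> composes from left to right. The two groups are opposite to each other: reversing words
  shows that they have the same word lengths, the same generating sets and the same
  Cayley digraph diameters.
\<close>

definition cayley_digraph :: "('a, 'b) monoid_scheme \<Rightarrow> 'a set \<Rightarrow> ('a, 'a \<times> 'a) pre_digraph" where
  "cayley_digraph G S =
     \<lparr> verts = carrier G, arcs = {(g, s \<otimes>\<^bsub>G\<^esub> g) | g s. g \<in> carrier G \<and> s \<in> S},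
       tail = fst, head = snd \<rparr>"

lemma cayley_digraph_simps:
  "verts (cayley_digraph G S) = carrier G"
  "arcs (cayley_digraph G S) = {(g, s \<otimes>\<^bsub>G\<^esub> g) | g s. g \<in> carrier G \<and> s \<in> S}"
  "tail (cayley_digraph G S) = fst" "head (cayley_digraph G S) = snd"
  by (simp_all add: cayley_digraph_def)

text \<open>
  The library's shortest-path distance with unit arc weights; it is \<open>\<infinity>\<close> if there is no walk.
\<close>

definition digraph_diameter :: "('a, 'b) pre_digraph \<Rightarrow> ereal" where
  "digraph_diameter D = (SUP u\<in>verts D. SUP v\<in>verts D. wf_digraph.\<mu> D (\<lambda>_. 1) u v)"

text \<open>
  The rest of this theory shows that, for a finite group \<open>G\<close> generated by \<open>S\<close>, the diameter of the
  Cayley digraph is the maximum over \<open>g\<close> of the length of a shortest expression of \<open>g\<close> as a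
  product of elements of \<open>S\<close>.
\<close>

definition word_lengths :: "('a, 'b) monoid_scheme \<Rightarrow> 'a set \<Rightarrow> 'a \<Rightarrow> nat set" where
  "word_lengths G S g = {length ss | ss. set ss \<subseteq> S \<and> foldr (\<otimes>\<^bsub>G\<^esub>) ss \<one>\<^bsub>G\<^esub> = g}"

context group
begin

lemma wf_cayley_digraph:
  assumes "S \<subseteq> carrier G"
  shows "wf_digraph (cayley_digraph G S)"
  using assms by unfold_locales (auto simp: cayley_digraph_simps)

lemma foldr_mult_closed:
  assumes "S \<subseteq> carrier G" "set ss \<subseteq> S"
  shows "foldr (\<otimes>) ss \<one> \<in> carrier G"
  using assms by (induction ss) auto

lemma foldr_mult_append:
  assumes "S \<subseteq> carrier G" "set ss \<subseteq> S" "set ts \<subseteq> S"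
  shows "foldr (\<otimes>) (ss @ ts) \<one> = foldr (\<otimes>) ss \<one> \<otimes> foldr (\<otimes>) ts \<one>"
  using assms
proof (induction ss)
  case Nil
  then show ?case using foldr_mult_closed[of S ts] by simp
next
  case (Cons s ss)
  then have "s \<in> carrier G" "foldr (\<otimes>) ss \<one> \<in> carrier G" "foldr (\<otimes>) ts \<one> \<in> carrier G"
    using foldr_mult_closed[of S] by auto
  with Cons show ?case by (simp add: m_assoc)
qed

lemma cayley_awalk_imp_word:
  assumes S: "S \<subseteq> carrier G" and "pre_digraph.awalk (cayley_digraph G S) u p v"
  shows "\<exists>ss. set ss \<subseteq> S \<and> length ss = length p \<and> v = foldr (\<otimes>) ss \<one> \<otimes> u"
  using assms(2)
proof (induction p arbitrary: u)
  interpret D: wf_digraph "cayley_digraph G S" by (rule wf_cayley_digraph[OF S])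
  case Nil
  then show ?case
    unfolding D.awalk_Nil_iff by (auto simp: cayley_digraph_simps)
next
  interpret D: wf_digraph "cayley_digraph G S" by (rule wf_cayley_digraph[OF S])
  case (Cons e p)
  have e: "e \<in> arcs (cayley_digraph G S)" "u = fst e" and w': "D.awalk (snd e) p v"
    using Cons.prems unfolding D.awalk_Cons_iff cayley_digraph_simps(3,4) by simp_all
  obtain s where s: "u \<in> carrier G" "s \<in> S" "e = (u, s \<otimes> u)"
    using e unfolding cayley_digraph_simps(2) by force
  have w: "D.awalk (s \<otimes> u) p v" using w' unfolding s(3) by simp
  from Cons.IH[OF w] obtain ss where ss: "set ss \<subseteq> S" "length ss = length p"
    "v = foldr (\<otimes>) ss \<one> \<otimes> (s \<otimes> u)" by auto
  have "foldr (\<otimes>) (ss @ [s]) \<one> = foldr (\<otimes>) ss \<one> \<otimes> s"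
    using foldr_mult_append[OF S ss(1), of "[s]"] s S by auto
  moreover have "foldr (\<otimes>) ss \<one> \<in> carrier G" "s \<in> carrier G"
    using foldr_mult_closed[OF S ss(1)] s S by auto
  ultimately have "v = foldr (\<otimes>) (ss @ [s]) \<one> \<otimes> u"
    using ss(3) s(1) by (simp add: m_assoc)
  with ss s show ?case by (intro exI[of _ "ss @ [s]"]) auto
qed

lemma word_imp_cayley_awalk:
  assumes S: "S \<subseteq> carrier G" and "u \<in> carrier G" "set ss \<subseteq> S"
  shows "\<exists>p. length p = length ss \<and>
    pre_digraph.awalk (cayley_digraph G S) u p (foldr (\<otimes>) ss \<one> \<otimes> u)"
  using assms(2,3)
proof (induction ss arbitrary: u rule: rev_induct)
  interpret D: wf_digraph "cayley_digraph G S" by (rule wf_cayley_digraph[OF S])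
  case Nil
  then show ?case by (simp add: D.awalk_Nil_iff cayley_digraph_simps)
next
  interpret D: wf_digraph "cayley_digraph G S" by (rule wf_cayley_digraph[OF S])
  case (snoc s ss)
  then have c: "s \<in> carrier G" "s \<in> S" "set ss \<subseteq> S" "foldr (\<otimes>) ss \<one> \<in> carrier G"
    using S foldr_mult_closed[OF S] by auto
  obtain p where p: "length p = length ss"
    "D.awalk (s \<otimes> u) p (foldr (\<otimes>) ss \<one> \<otimes> (s \<otimes> u))"
    using snoc.IH[OF m_closed[OF c(1) snoc.prems(1)] c(3)] by blast
  have "foldr (\<otimes>) (ss @ [s]) \<one> \<otimes> u = foldr (\<otimes>) ss \<one> \<otimes> (s \<otimes> u)"
    using foldr_mult_append[OF S c(3), of "[s]"] c snoc.prems by (simp add: m_assoc)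
  moreover have "D.awalk u ((u, s \<otimes> u) # p) (foldr (\<otimes>) ss \<one> \<otimes> (s \<otimes> u))"
    using p c snoc.prems by (auto simp: D.awalk_Cons_iff cayley_digraph_simps)
  ultimately show ?case using p(1) by (intro exI[of _ "(u, s \<otimes> u) # p"]) simp
qed

lemma cayley_distance:
  assumes S: "S \<subseteq> carrier G" and uv: "u \<in> carrier G" "v \<in> carrier G"
  shows "wf_digraph.\<mu> (cayley_digraph G S) (\<lambda>_. 1) u v
    = (INF m\<in>word_lengths G S (v \<otimes> inv u). ereal (real m))"
proof -
  interpret D: wf_digraph "cayley_digraph G S" by (rule wf_cayley_digraph[OF S])
  have cost: "D.awalk_cost (\<lambda>_. 1) p = real (length p)" for p
    by (induction p) auto
  have *: "length ` {p. D.awalk u p v} = word_lengths G S (v \<otimes> inv u)" (is "?L = ?R")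
  proof
    show "?L \<subseteq> ?R"
    proof
      fix m assume "m \<in> ?L"
      then obtain p where p: "m = length p" "D.awalk u p v" by auto
      obtain ss where ss: "set ss \<subseteq> S" "length ss = length p" "v = foldr (\<otimes>) ss \<one> \<otimes> u"
        using cayley_awalk_imp_word[OF S p(2)] by auto
      have "v \<otimes> inv u = foldr (\<otimes>) ss \<one>"
        unfolding ss(3) using uv(1) foldr_mult_closed[OF S ss(1)] by (simp add: m_assoc)
      with ss(1,2) show "m \<in> ?R"
        unfolding word_lengths_def mem_Collect_eq p(1) by (intro exI[of _ ss]) simp
    qed
    show "?R \<subseteq> ?L"
    proof
      fix m assume "m \<in> ?R"
      then obtain ss where ss: "set ss \<subseteq> S" "length ss = m" "foldr (\<otimes>) ss \<one> = v \<otimes> inv u"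
        unfolding word_lengths_def by auto
      have v: "foldr (\<otimes>) ss \<one> \<otimes> u = v" unfolding ss(3) using uv by (simp add: m_assoc)
      obtain p where "length p = m" "D.awalk u p v"
        using word_imp_cayley_awalk[OF S uv(1) ss(1)] unfolding v ss(2) by (elim exE conjE)
      then show "m \<in> ?L" by (intro image_eqI[of _ _ p]) simp_all
    qed
  qed
  show ?thesis
    unfolding D.\<mu>_def cost using arg_cong[OF *, of "\<lambda>M. INF m\<in>M. ereal (real m)"] by (simp only: image_image)
qed

lemma generate_word:
  assumes fin: "finite (carrier G)" and S: "S \<subseteq> carrier G" and "g \<in> generate G S"
  shows "word_lengths G S g \<noteq> {}"
proof -
  have "\<exists>ss. set ss \<subseteq> S \<and> foldr (\<otimes>) ss \<one> = g"
    using assms(3)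
  proof (induction rule: generate.induct)
    case one
    show ?case by (intro exI[of _ "[]"]) simp
  next
    case (incl h)
    with S show ?case by (intro exI[of _ "[h]"]) auto
  next
    case (inv h)
    then have h: "h \<in> carrier G" using S by auto
    have pow: "foldr (\<otimes>) (replicate k h) \<one> = h [^] k" for k :: nat
    proof (induction k)
      case (Suc k)
      show ?case unfolding nat_pow_Suc2[OF h] replicate_Suc foldr_Cons comp_apply Suc ..
    qed simp
    have "Suc (order G - 1) = order G" using fin order_gt_0_iff_finite by simp
    then have "h [^] (order G - 1) \<otimes> h = \<one>"
      using nat_pow_Suc[of h "order G - 1"] pow_order_eq_1[OF h] by argo
    then have "h [^] (order G - 1) = inv h"
      using inv_equality[OF _ h nat_pow_closed[OF h]] by metis
    with pow[of "order G - 1"] inv show ?case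
      by (intro exI[of _ "replicate (order G - 1) h"]) (simp add: set_replicate_conv_if)
  next
    case (eng h1 h2)
    then obtain ss ts where "set ss \<subseteq> S" "foldr (\<otimes>) ss \<one> = h1"
      "set ts \<subseteq> S" "foldr (\<otimes>) ts \<one> = h2" by blast
    then show ?case using foldr_mult_append[OF S, of ss ts] by (intro exI[of _ "ss @ ts"]) simp
  qed
  then show ?thesis unfolding word_lengths_def by auto
qed

theorem cayley_diameter_eq_Max_word_length:
  assumes fin: "finite (carrier G)" and S: "S \<subseteq> carrier G" and gen: "generate G S = carrier G"
  shows "digraph_diameter (cayley_digraph G S)
    = ereal (real (Max ((\<lambda>g. LEAST m. m \<in> word_lengths G S g) ` carrier G)))"
proof -
  define l where "l g = (LEAST m. m \<in> word_lengths G S g)" for g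
  have l: "(INF m\<in>word_lengths G S g. ereal (real m)) = ereal (real (l g))"
    if "g \<in> carrier G" for g
  proof (rule antisym)
    have "word_lengths G S g \<noteq> {}" using generate_word[OF fin S] gen that by auto
    then have "l g \<in> word_lengths G S g" unfolding l_def by (metis LeastI all_not_in_conv)
    then show "(INF m\<in>word_lengths G S g. ereal (real m)) \<le> ereal (real (l g))"
      by (rule INF_lower)
    show "ereal (real (l g)) \<le> (INF m\<in>word_lengths G S g. ereal (real m))"
      unfolding l_def by (intro INF_greatest) (simp add: Least_le)
  qed
  have dist: "wf_digraph.\<mu> (cayley_digraph G S) (\<lambda>_. 1) u v = ereal (real (l (v \<otimes> inv u)))"
    if "u \<in> carrier G" "v \<in> carrier G" for u v
    using cayley_distance[OF S that] l that by simp
  have verts: "verts (cayley_digraph G S) = carrier G" by (simp add: cayley_digraph_simps)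
  have le: "l g \<le> Max (l ` carrier G)" if "g \<in> carrier G" for g
    using fin that by simp
  have "Max (l ` carrier G) \<in> l ` carrier G" using fin one_closed by (intro Max_in) auto
  then obtain g where g: "Max (l ` carrier G) = l g" "g \<in> carrier G" by (rule imageE)
  have "digraph_diameter (cayley_digraph G S) = ereal (real (Max (l ` carrier G)))"
  proof (rule antisym)
    show "digraph_diameter (cayley_digraph G S) \<le> ereal (real (Max (l ` carrier G)))"
      unfolding digraph_diameter_def verts by (intro SUP_least) (simp add: dist le)
    have "ereal (real (Max (l ` carrier G))) = wf_digraph.\<mu> (cayley_digraph G S) (\<lambda>_. 1) \<one> g"
      unfolding g(1) using dist[of \<one> g] g(2) by simp
    also have "\<dots> \<le> digraph_diameter (cayley_digraph G S)"
      unfolding digraph_diameter_def verts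
      by (rule SUP_upper2[OF one_closed], rule SUP_upper[OF g(2)])
    finally show "ereal (real (Max (l ` carrier G))) \<le> digraph_diameter (cayley_digraph G S)" .
  qed
  then show ?thesis unfolding l_def .
qed

end

end

theory Submission
  imports Defs "HOL-Combinatorics.Permutations" "HOL-Computational_Algebra.Primes"
begin

text \<open>
  Two reductions frame the argument. Inverses come for free: if words of length \<open>D\<close> in the
  generators and their inverses reach every element of a group of order at most \<open>2 ^ J\<close>, then
  words of length \<open>4 * D * J\<close> in the generators alone do so too (\<open>directed_word_length\<close>). And
  one short word for a single three-cycle suffices: short words carry any triple of points to
  any other, so conjugation gives all three-cycles, products of at most \<open>n\<close> of these give all
  even permutations, and an odd generator, if there is one, gives the rest (\<open>all_words\<close>). It
  remains to pass from \<open>g\<close> to a three-cycle by words of polynomial length.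

  The tool is conjugation of \<open>g\<close> by a pseudo-random element \<open>p\<close>. Choose a suitable sequence of
  polynomially many generators, and let \<open>p\<close> be the product of those kept by independent fair
  coins. Then the values of \<open>p\<close> at any 500 points are distributed almost as those of a
  uniformly random permutation (\<open>mixing\<close>), so an averaging argument over uniform permutations
  that inspects only 500 values also finds a \<open>p\<close> that is a short word. In this way the support
  is made smaller and smaller.

  When \<open>g\<close> moves \<open>s \<le> 3/10 * n\<close> points, the commutator of \<open>g\<close> with its conjugate by \<open>p\<close> moves
  about \<open>3 * s\<^sup>2 / n\<close> points, because it can only move points related to the intersection of
  the two supports (\<open>commutator_stage\<close>). This shrinks the support geometrically, and it ends
  with a three-cycle when \<open>s\<^sup>2\<close> drops below \<open>n\<close> (\<open>descend_small\<close>). Each of the \<open>O(log n)\<close>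
  steps multiplies the length of words only by a constant.

  When \<open>g\<close> moves \<open>a * n\<close> points with \<open>3/10 \<le> a \<le> 63/100\<close>, commutators of this kind move too
  many points. Let \<open>h\<close> be the conjugate of \<open>g\<close> by \<open>p\<close>, and \<open>W\<close> the commutator of \<open>h\<inverse> g h\<close> and
  \<open>g\<inverse>\<close>. Points whose orbit under \<open>W\<close> has length at most 5 are fixed by \<open>W ^ 60\<close>, as 60 is the
  least common multiple of \<open>1, \<dots>, 5\<close>. To find their expected proportion, follow the path of a
  point through the letters of \<open>W, W\<^sup>2, \<dots>, W ^ 5\<close> and reveal values of \<open>p\<close> only when the path
  needs them. A newly revealed point is almost independent of the past: it is fixed by \<open>g\<close>
  with probability close to \<open>1 - a\<close> and moved with probability close to \<open>a\<close>. The path is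
  determined by these answers, so returning to the start is an event of a finite decision
  tree, and its probability is bounded below by an explicit polynomial in \<open>a\<close>
  (\<open>outcome_tree_sound\<close>, \<open>grid_bound\<close>). On the interval above this polynomial exceeds \<open>1 - a\<close>,
  the proportion of fixed points of \<open>g\<close>, by at least \<open>1/2000\<close>; the comparison fails soon after
  \<open>a = 0.632\<close>, which is where the constant \<open>0.63\<close> comes from. Hence \<open>W ^ 60\<close> fixes \<open>n / 4000\<close>
  points more than \<open>g\<close> (\<open>lap_stage\<close>), and boundedly many repetitions bring the support down to
  \<open>3/10 * n\<close> (\<open>descend_large\<close>).

  The decision tree must not depend on the cycle type of \<open>g\<close>. Therefore \<open>g\<close> is replaced,
  before each repetition, by a power that either has prime order 2, 3 or 5 or has no
  nontrivial cycle of length less than 7 (\<open>homogeneous_power\<close>). All cycles of the last kind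
  look alike along a path that does not travel far within any of them. Finally, the new
  element must not be the identity. This is arranged by prescribing boundedly many values of
  \<open>p\<close> beforehand, which changes the above probabilities only by \<open>O(1/n)\<close>.
\<close>

section \<open>Removing inverses from words\<close>

context group
begin

text \<open>
  The number of points that translation by \<open>x\<close> throws out of \<open>A\<close>. It is subadditive in \<open>x\<close> and
  invariant under inversion, so that a word in which inverses occur cannot push more out of
  \<open>A\<close> than its letters, taken without their exponents, do together.
\<close>
definition escape :: "'a \<Rightarrow> 'a set \<Rightarrow> nat" where
  "escape x A = card ((\<lambda>a. x \<otimes> a) ` A - A)"

lemma inj_translate: "x \<in> carrier G \<Longrightarrow> A \<subseteq> carrier G \<Longrightarrow> inj_on (\<lambda>a. x \<otimes> a) A"
  by (rule inj_on_subset[OF inj_on_cmult])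

lemma escape_mult:
  assumes "finite A" "A \<subseteq> carrier G" "x \<in> carrier G" "y \<in> carrier G"
  shows "escape (x \<otimes> y) A \<le> escape x A + escape y A"
proof -
  let ?yA = "(\<lambda>a. y \<otimes> a) ` A"
  have "(\<lambda>a. x \<otimes> y \<otimes> a) ` A = (\<lambda>a. x \<otimes> a) ` ?yA"
    using assms by (auto simp: image_image m_assoc subset_iff intro!: image_cong)
  then have "(\<lambda>a. x \<otimes> y \<otimes> a) ` A - A \<subseteq> ((\<lambda>a. x \<otimes> a) ` A - A) \<union> (\<lambda>a. x \<otimes> a) ` (?yA - A)" by blast
  then have "escape (x \<otimes> y) A \<le> card (((\<lambda>a. x \<otimes> a) ` A - A) \<union> (\<lambda>a. x \<otimes> a) ` (?yA - A))"
    unfolding escape_def using assms(1) by (intro card_mono) auto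
  also have "\<dots> \<le> escape x A + card ((\<lambda>a. x \<otimes> a) ` (?yA - A))"
    unfolding escape_def by (rule card_Un_le)
  also have "\<dots> \<le> escape x A + escape y A"
    unfolding escape_def using assms(1) by (intro add_left_mono card_image_le) auto
  finally show ?thesis .
qed

lemma escape_inv:
  assumes "finite A" "A \<subseteq> carrier G" "x \<in> carrier G"
  shows "escape (inv x) A = escape x A"
proof -
  let ?xA = "(\<lambda>a. x \<otimes> a) ` A"
  have "(\<lambda>a. inv x \<otimes> a) ` A - A = (\<lambda>a. inv x \<otimes> a) ` (A - ?xA)"
  proof (intro equalityI subsetI)
    fix z assume "z \<in> (\<lambda>a. inv x \<otimes> a) ` A - A"
    then obtain a where a: "a \<in> A" "z = inv x \<otimes> a" "z \<notin> A" by auto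
    have "a \<notin> ?xA"
    proof
      assume "a \<in> ?xA"
      then obtain b where "b \<in> A" "a = x \<otimes> b" by auto
      then have "z = b" using a assms by (auto simp: m_assoc[symmetric] subset_iff)
      then show False using a \<open>b \<in> A\<close> by simp
    qed
    then show "z \<in> (\<lambda>a. inv x \<otimes> a) ` (A - ?xA)" using a by auto
  next
    fix z assume "z \<in> (\<lambda>a. inv x \<otimes> a) ` (A - ?xA)"
    then obtain a where a: "a \<in> A" "a \<notin> ?xA" "z = inv x \<otimes> a" by auto
    have "x \<otimes> z = a" using a assms by (auto simp: m_assoc[symmetric] subset_iff)
    then have "z \<notin> A" using a(2) by (metis imageI)
    then show "z \<in> (\<lambda>a. inv x \<otimes> a) ` A - A" using a by auto
  qed
  then have "escape (inv x) A = card (A - ?xA)"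
    unfolding escape_def using assms
    by (simp only:) (intro card_image inj_translate, auto)
  moreover have "card ?xA = card A" using assms by (intro card_image inj_translate)
  moreover have "card (A - ?xA) = card A - card (A \<inter> ?xA)" "card (?xA - A) = card ?xA - card (A \<inter> ?xA)"
    using assms(1) by (auto simp: card_Diff_subset_Int Int_commute)
  ultimately show ?thesis unfolding escape_def by simp
qed

text \<open>
  Averaged over all \<open>x\<close>, a translate of \<open>A\<close> meets \<open>A\<close> in \<open>card A * card A / order G\<close> points,
  which is at most half of \<open>A\<close>.
\<close>
lemma escape_average:
  assumes fin: "finite (carrier G)" and A: "A \<subseteq> carrier G" "2 * card A \<le> order G"
  shows "\<exists>x\<in>carrier G. card A \<le> 2 * escape x A"
proof (rule ccontr)
  assume none: "\<not> ?thesis"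
  have finA: "finite A" using A(1) fin finite_subset by blast
  have count: "card {x \<in> carrier G. x \<otimes> a \<in> A} = card A" if "a \<in> A" for a
  proof -
    have "bij_betw (\<lambda>x. x \<otimes> a) {x \<in> carrier G. x \<otimes> a \<in> A} A"
      by (rule bij_betw_byWitness[where f' = "\<lambda>b. b \<otimes> inv a"])
        (use that A(1) in \<open>auto simp: m_assoc subset_iff\<close>)
    then show ?thesis by (rule bij_betw_same_card)
  qed
  have inter: "card (((\<lambda>a. x \<otimes> a) ` A) \<inter> A) = (\<Sum>a\<in>A. if x \<otimes> a \<in> A then 1 else 0)" if "x \<in> carrier G" for x
  proof -
    have "((\<lambda>a. x \<otimes> a) ` A) \<inter> A = (\<lambda>a. x \<otimes> a) ` {a \<in> A. x \<otimes> a \<in> A}" by auto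
    moreover have "inj_on (\<lambda>a. x \<otimes> a) {a \<in> A. x \<otimes> a \<in> A}" using that A(1) by (intro inj_translate) auto
    ultimately show ?thesis using finA by (simp add: card_image sum.If_cases Int_def)
  qed
  have "(\<Sum>x\<in>carrier G. card (((\<lambda>a. x \<otimes> a) ` A) \<inter> A)) = (\<Sum>x\<in>carrier G. \<Sum>a\<in>A. if x \<otimes> a \<in> A then 1 else 0)"
    using inter by (intro sum.cong) auto
  also have "\<dots> = (\<Sum>a\<in>A. \<Sum>x\<in>carrier G. if x \<otimes> a \<in> A then 1 else 0)" by (rule sum.swap)
  also have "\<dots> = (\<Sum>a\<in>A. card A)"
    using count fin by (intro sum.cong) (simp_all add: sum.If_cases Int_def)
  finally have total: "(\<Sum>x\<in>carrier G. card (((\<lambda>a. x \<otimes> a) ` A) \<inter> A)) = card A * card A" by simp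
  have split: "card A = escape x A + card (((\<lambda>a. x \<otimes> a) ` A) \<inter> A)" if "x \<in> carrier G" for x
  proof -
    have "card ((\<lambda>a. x \<otimes> a) ` A) = card A" using that A(1) by (intro card_image inj_translate)
    moreover have "card ((\<lambda>a. x \<otimes> a) ` A) = card ((\<lambda>a. x \<otimes> a) ` A - A) + card ((\<lambda>a. x \<otimes> a) ` A \<inter> A)"
      using finA by (subst card_Un_disjoint[symmetric]) (auto intro: arg_cong[of _ _ card])
    ultimately show ?thesis unfolding escape_def by simp
  qed
  have "card A < 2 * card (((\<lambda>a. x \<otimes> a) ` A) \<inter> A)" if "x \<in> carrier G" for x
  proof -
    have "\<not> card A \<le> 2 * escape x A" using none that by blast
    then show ?thesis using split[OF that] by linarith
  qed
  then have "(\<Sum>x\<in>carrier G. card A) < (\<Sum>x\<in>carrier G. 2 * card (((\<lambda>a. x \<otimes> a) ` A) \<inter> A))"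
    using fin one_closed by (intro sum_strict_mono) auto
  also have "\<dots> = 2 * (card A * card A)" using total by (simp flip: sum_distrib_left)
  finally have "order G * card A < 2 * card A * card A" unfolding order_def by simp
  then show False using A(2) by (metis mult_le_mono1 not_le)
qed

definition ball_of :: "'a set \<Rightarrow> nat \<Rightarrow> 'a set" where
  "ball_of S k = {foldr (\<otimes>) ss \<one> | ss. set ss \<subseteq> S \<and> length ss \<le> k}"

lemma ball_of_Suc: "ball_of S k \<subseteq> ball_of S (Suc k)"
  unfolding ball_of_def by (auto intro: le_SucI)

text \<open>
  Some translation throws half of the ball out of itself, and it is a word of length at most
  \<open>D\<close> in generators and inverses. One letter therefore throws out a fraction \<open>1 / (2 * D)\<close>,
  and by invariance under inversion this letter may be taken to be a generator.
\<close>
lemma ball_grows: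
  assumes fin: "finite (carrier G)" and S: "S \<subseteq> carrier G"
    and words: "\<And>g. g \<in> carrier G \<Longrightarrow> \<exists>ss. set ss \<subseteq> S \<union> m_inv G ` S \<and> length ss \<le> D \<and> foldr (\<otimes>) ss \<one> = g"
    and small: "2 * card (ball_of S k) \<le> order G"
  shows "(2 * D + 1) * card (ball_of S k) \<le> 2 * D * card (ball_of S (Suc k))"
proof -
  let ?B = "ball_of S k"
  have B: "?B \<subseteq> carrier G" unfolding ball_of_def using foldr_mult_closed[OF S] by auto
  have finB: "finite (ball_of S j)" for j
    using fin foldr_mult_closed[OF S] unfolding ball_of_def by (elim finite_subset[rotated]) auto
  have one: "escape \<one> ?B = 0" using B unfolding escape_def by (auto simp: subset_iff image_iff)
  have "\<exists>s\<in>S. card ?B \<le> 2 * D * escape s ?B"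
  proof (rule ccontr)
    assume none: "\<not> ?thesis"
    have gen: "2 * D * escape s ?B < card ?B" if "s \<in> S \<union> m_inv G ` S" for s
      using that none S escape_inv[OF finB B] by (auto simp: not_le subset_iff)
    have "2 * D * escape (foldr (\<otimes>) ss \<one>) ?B \<le> length ss * (card ?B - 1)"
      if "set ss \<subseteq> S \<union> m_inv G ` S" for ss
      using that
    proof (induction ss)
      case Nil then show ?case using one by simp
    next
      case (Cons s ss)
      have c: "s \<in> carrier G" "foldr (\<otimes>) ss \<one> \<in> carrier G"
        using Cons.prems S foldr_mult_closed[of "S \<union> m_inv G ` S" ss] by auto
      have "2 * D * escape (foldr (\<otimes>) (s # ss) \<one>) ?B \<le> 2 * D * (escape s ?B + escape (foldr (\<otimes>) ss \<one>) ?B)"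
        using escape_mult[OF finB B c] by (intro mult_le_mono2) simp
      also have "\<dots> = 2 * D * escape s ?B + 2 * D * escape (foldr (\<otimes>) ss \<one>) ?B" by (rule distrib_left)
      also have "\<dots> \<le> (card ?B - 1) + length ss * (card ?B - 1)"
        using gen[of s] Cons by (intro add_mono) auto
      finally show ?case by simp
    qed
    note bound = this
    obtain x where x: "x \<in> carrier G" "card ?B \<le> 2 * escape x ?B" using escape_average[OF fin B small] by blast
    obtain ss where ss: "set ss \<subseteq> S \<union> m_inv G ` S" "length ss \<le> D" "foldr (\<otimes>) ss \<one> = x" using words[OF x(1)] by blast
    have "\<one> \<in> ?B" unfolding ball_of_def by (intro CollectI exI[of _ "[]"]) simp
    then have pos: "0 < card ?B" using finB card_gt_0_iff by blast
    have "D * card ?B \<le> 2 * D * escape x ?B" using x(2) by (metis mult.left_commute mult.assoc mult_le_mono2)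
    also have "\<dots> \<le> D * (card ?B - 1)" using bound[OF ss(1)] ss by (meson le_trans mult_le_mono1)
    finally have "D = 0 \<or> card ?B \<le> card ?B - 1" unfolding mult_le_cancel1 by blast
    then have "D = 0" using pos by linarith
    then show False using ss x pos one by auto
  qed
  then obtain s where s: "s \<in> S" "card ?B \<le> 2 * D * escape s ?B" by blast
  note ball_of_Suc[of S k]
  moreover have "(\<lambda>a. s \<otimes> a) ` ?B \<subseteq> ball_of S (Suc k)"
  proof
    fix z assume "z \<in> (\<lambda>a. s \<otimes> a) ` ?B"
    then obtain ss where "set ss \<subseteq> S" "length ss \<le> k" "z = s \<otimes> foldr (\<otimes>) ss \<one>"
      unfolding ball_of_def by auto
    then show "z \<in> ball_of S (Suc k)" unfolding ball_of_def using s(1) by (intro CollectI exI[of _ "s # ss"]) auto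
  qed
  ultimately have "card (?B \<union> ((\<lambda>a. s \<otimes> a) ` ?B - ?B)) \<le> card (ball_of S (Suc k))"
    using finB by (intro card_mono) auto
  then have "card ?B + escape s ?B \<le> card (ball_of S (Suc k))"
    using finB unfolding escape_def by (subst (asm) card_Un_disjoint) auto
  then have "2 * D * (card ?B + escape s ?B) \<le> 2 * D * card (ball_of S (Suc k))" by (rule mult_le_mono2)
  then show ?thesis using s(2) by (simp add: distrib_left)
qed

text \<open>
  By exponential growth the ball of radius \<open>2 * D * J\<close> contains more than half of the group.
  Then every element is a product of two of its members.
\<close>
theorem directed_word_length:
  assumes fin: "finite (carrier G)" and S: "S \<subseteq> carrier G" and D: "0 < D"
    and words: "\<And>g. g \<in> carrier G \<Longrightarrow> \<exists>ss. set ss \<subseteq> S \<union> m_inv G ` S \<and> length ss \<le> D \<and> foldr (\<otimes>) ss \<one> = g"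
    and J: "order G \<le> 2 ^ J" and g: "g \<in> carrier G"
  shows "\<exists>m\<le>4 * D * J. m \<in> word_lengths G S g"
proof -
  have finB: "finite (ball_of S j)" for j
    using fin foldr_mult_closed[OF S] unfolding ball_of_def by (elim finite_subset[rotated]) auto
  have one: "\<one> \<in> ball_of S k" for k unfolding ball_of_def by (intro CollectI exI[of _ "[]"]) simp
  then have pos: "1 \<le> card (ball_of S k)" for k using finB[of k] by (metis One_nat_def Suc_leI card_gt_0_iff empty_iff)
  have mono: "card (ball_of S k) \<le> card (ball_of S (Suc k))" for k
    using finB ball_of_Suc by (intro card_mono)
  have grow: "(1 + 1 / (2 * D)) ^ k \<le> real (card (ball_of S k)) \<or> order G < 2 * card (ball_of S k)" for k
  proof (induction k)
    case 0 then show ?case using pos[of 0] by simp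
  next
    case (Suc k)
    show ?case
    proof (cases "order G < 2 * card (ball_of S k)")
      case True then show ?thesis using mono[of k] by linarith
    next
      case False
      then have IH: "(1 + 1 / (2 * D)) ^ k \<le> real (card (ball_of S k))" using Suc by blast
      have "real ((2 * D + 1) * card (ball_of S k)) \<le> real (2 * D * card (ball_of S (Suc k)))"
        using ball_grows[OF fin S words, of k] False by (simp only: of_nat_le_iff not_less)
      then have "(1 + 1 / (2 * D)) * card (ball_of S k) \<le> card (ball_of S (Suc k))"
        using D by (simp add: field_simps)
      moreover have "(1 + 1 / (2 * D)) * (1 + 1 / (2 * D)) ^ k \<le> (1 + 1 / (2 * D)) * card (ball_of S k)"
        using IH by (intro mult_left_mono) auto
      ultimately show ?thesis by simp
    qed
  qed
  let ?B = "ball_of S (2 * D * J)"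
  have "2 \<le> (1 + 1 / (2 * D)) ^ (2 * D)"
  proof -
    have "- 1 \<le> 1 / (2 * real D)" by (rule order_trans[of _ 0]) auto
    then show ?thesis using Bernoulli_inequality[of "1 / (2 * D)" "2 * D"] D by simp
  qed
  then have "2 ^ J \<le> ((1 + 1 / (2 * D)) ^ (2 * D)) ^ J" by (intro power_mono) auto
  also have "\<dots> = (1 + 1 / (2 * D)) ^ (2 * D * J)" by (simp add: power_mult)
  finally have "2 ^ J \<le> (1 + 1 / (2 * D)) ^ (2 * D * J)" .
  then have "real (order G) \<le> (1 + 1 / (2 * D)) ^ (2 * D * J)"
    using J by (metis of_nat_le_iff of_nat_numeral of_nat_power order_trans)
  then have big: "order G < 2 * card ?B" using grow[of "2 * D * J"] pos[of "2 * D * J"] by linarith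
  have B: "?B \<subseteq> carrier G" unfolding ball_of_def using foldr_mult_closed[OF S] by auto
  have "?B \<inter> (\<lambda>b. g \<otimes> inv b) ` ?B \<noteq> {}"
  proof
    assume disj: "?B \<inter> (\<lambda>b. g \<otimes> inv b) ` ?B = {}"
    have "inj_on (\<lambda>b. g \<otimes> inv b) ?B" using B g by (auto simp: inj_on_def subset_iff)
    then have "card (?B \<union> (\<lambda>b. g \<otimes> inv b) ` ?B) = card ?B + card ?B"
      using disj finB by (subst card_Un_disjoint) (auto simp: card_image)
    moreover have "card (?B \<union> (\<lambda>b. g \<otimes> inv b) ` ?B) \<le> order G"
      unfolding order_def using B g fin by (intro card_mono) auto
    ultimately show False using big by simp
  qed
  then obtain a b where ab: "a \<in> ?B" "b \<in> ?B" "a = g \<otimes> inv b" by auto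
  then have "g = a \<otimes> b" using B g by (auto simp: m_assoc subset_iff)
  moreover obtain ss where ss: "set ss \<subseteq> S" "length ss \<le> 2 * D * J" "foldr (\<otimes>) ss \<one> = a"
    using ab(1) unfolding ball_of_def by auto
  moreover obtain ts where ts: "set ts \<subseteq> S" "length ts \<le> 2 * D * J" "foldr (\<otimes>) ts \<one> = b"
    using ab(2) unfolding ball_of_def by auto
  ultimately have "foldr (\<otimes>) (ss @ ts) \<one> = g" using foldr_mult_append[OF S ss(1) ts(1)] by simp
  then have "length (ss @ ts) \<in> word_lengths G S g"
    unfolding word_lengths_def mem_Collect_eq using ss(1) ts(1) by (intro exI[of _ "ss @ ts"]) simp
  moreover have "length (ss @ ts) \<le> 4 * D * J" using ss(2) ts(2) by simp
  ultimately show ?thesis by blast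
qed

end

section \<open>Masses of partial permutations\<close>

abbreviation moved :: "nat \<Rightarrow> (nat \<Rightarrow> nat) \<Rightarrow> nat set" where
  "moved n g \<equiv> {x \<in> {1..n}. g x \<noteq> x}"

text \<open>
  The weights \<open>w\<close> play the part of a probability distribution on permutations, and
  \<open>mass n w P\<close> that of the probability of \<open>P\<close>.
\<close>
definition mass :: "nat \<Rightarrow> ((nat \<Rightarrow> nat) \<Rightarrow> real) \<Rightarrow> ((nat \<Rightarrow> nat) \<Rightarrow> bool) \<Rightarrow> real" where
  "mass n w P = (\<Sum>p | p permutes {1..n} \<and> P p. w p)"

text \<open>
  A partial permutation is represented by its graph; it records the values of a random
  permutation that have been revealed so far.
\<close>
definition agrees :: "(nat \<times> nat) set \<Rightarrow> (nat \<Rightarrow> nat) \<Rightarrow> bool" where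
  "agrees c p \<longleftrightarrow> (\<forall>(x, y)\<in>c. p x = y)"

definition partial_perm :: "nat \<Rightarrow> (nat \<times> nat) set \<Rightarrow> bool" where
  "partial_perm n c \<longleftrightarrow> c \<subseteq> {1..n} \<times> {1..n} \<and> inj_on fst c \<and> inj_on snd c"

definition falling :: "nat \<Rightarrow> nat \<Rightarrow> real" where
  "falling n r = (\<Prod>i<r. real n - real i)"

text \<open>
  A uniformly random permutation extends a partial one of size \<open>r\<close> with probability
  \<open>1 / falling n r\<close>. A small relative error is demanded, so that conditional probabilities are
  correct as well.
\<close>
definition near_uniform :: "nat \<Rightarrow> nat \<Rightarrow> real \<Rightarrow> ((nat \<Rightarrow> nat) \<Rightarrow> real) \<Rightarrow> bool" where
  "near_uniform n t \<epsilon> w \<longleftrightarrow> (\<forall>p. 0 \<le> w p) \<and> (\<forall>c. partial_perm n c \<and> card c \<le> t \<longrightarrow>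
     (1 - \<epsilon>) / falling n (card c) \<le> mass n w (agrees c) \<and>
     mass n w (agrees c) \<le> (1 + \<epsilon>) / falling n (card c))"

lemma permutes_funpow: "p permutes A \<Longrightarrow> (p ^^ k) permutes A"
  by (induction k) (auto intro: permutes_id permutes_compose simp: permutes_id[unfolded id_def])

lemma finite_perms: "finite {p. p permutes {1..n::nat} \<and> P p}"
  using finite_permutations[of "{1..n}"] by (rule rev_finite_subset) auto

lemma mass_nonneg: "(\<And>p. 0 \<le> w p) \<Longrightarrow> 0 \<le> mass n w P"
  unfolding mass_def by (intro sum_nonneg) auto

lemma mass_mono:
  assumes "\<And>p. 0 \<le> w p" "\<And>p. p permutes {1..n} \<Longrightarrow> P p \<Longrightarrow> Q p"
  shows "mass n w P \<le> mass n w Q"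
  unfolding mass_def using assms by (intro sum_mono2 finite_perms) auto

lemma mass_disjoint_sum:
  assumes "finite V" "\<And>p. 0 \<le> w p"
    "\<And>v p. v \<in> V \<Longrightarrow> p permutes {1..n} \<Longrightarrow> Q v p \<Longrightarrow> P p \<and> f p = v"
  shows "(\<Sum>v\<in>V. mass n w (Q v)) \<le> mass n w P"
proof -
  have "(\<Sum>v\<in>V. mass n w (Q v)) = sum w (\<Union>v\<in>V. {p. p permutes {1..n} \<and> Q v p})"
    unfolding mass_def
  proof (rule sum.UNION_disjoint[symmetric])
    show "\<forall>v\<in>V. finite {p. p permutes {1..n} \<and> Q v p}" using finite_perms by blast
    show "\<forall>v\<in>V. \<forall>v'\<in>V. v \<noteq> v' \<longrightarrow>
        {p. p permutes {1..n} \<and> Q v p} \<inter> {p. p permutes {1..n} \<and> Q v' p} = {}"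
      using assms(3) by blast
  qed (rule assms(1))
  also have "\<dots> \<le> mass n w P"
    unfolding mass_def using assms by (intro sum_mono2 finite_perms) auto
  finally show ?thesis .
qed

lemma falling_Suc: "falling n (Suc r) = falling n r * (real n - real r)"
  unfolding falling_def by simp

lemma falling_pos: "r \<le> n \<Longrightarrow> 0 < falling n r"
  unfolding falling_def by (intro prod_pos) auto

lemma partial_perm_finite: "partial_perm n c \<Longrightarrow> finite c"
  unfolding partial_perm_def by (meson finite_SigmaI finite_atLeastAtMost finite_subset)

lemma partial_perm_insert:
  assumes "partial_perm n c" "x \<in> {1..n}" "y \<in> {1..n}" "x \<notin> fst ` c" "y \<notin> snd ` c"
  shows "partial_perm n (insert (x, y) c)" "card (insert (x, y) c) = Suc (card c)"
proof -
  show "partial_perm n (insert (x, y) c)"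
    using assms unfolding partial_perm_def inj_on_insert by auto
  have "(x, y) \<notin> c" using assms(4) by force
  then show "card (insert (x, y) c) = Suc (card c)"
    using partial_perm_finite[OF assms(1)] by simp
qed

lemma partial_perm_card: assumes "partial_perm n c" shows "card c \<le> n"
proof -
  have "card c = card (fst ` c)" using assms unfolding partial_perm_def by (simp add: card_image)
  also have "\<dots> \<le> card {1..n}" using assms unfolding partial_perm_def by (intro card_mono) auto
  finally show ?thesis by simp
qed

section \<open>Random subproducts mix on tuples\<close>

text \<open>
  Nearly uniform behaviour on at most \<open>t\<close> points concerns the action on \<open>t\<close>-tuples of distinct
  points. There are only polynomially many of these, which is why polynomially many generators
  suffice for mixing.
\<close>
definition tuples :: "nat \<Rightarrow> nat \<Rightarrow> nat list set" where
  "tuples n t = {xs. length xs = t \<and> distinct xs \<and> set xs \<subseteq> {1..n}}"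

definition composite :: "(nat \<Rightarrow> nat) list \<Rightarrow> nat \<Rightarrow> nat" where
  "composite ss = foldr (\<circ>) ss id"

lemma composite_simps [simp]: "composite [] = id" "composite (s # ss) = s \<circ> composite ss"
  by (simp_all only: composite_def foldr.simps comp_apply id_apply)

definition word_of :: "(nat \<Rightarrow> nat) set \<Rightarrow> nat \<Rightarrow> (nat \<Rightarrow> nat) \<Rightarrow> bool" where
  "word_of S k p \<longleftrightarrow> (\<exists>ss. set ss \<subseteq> S \<and> length ss \<le> k \<and> composite ss = p)"

lemma word_of_mono: "word_of S k p \<Longrightarrow> k \<le> l \<Longrightarrow> word_of S l p"
  unfolding word_of_def by force

definition deviation :: "nat \<Rightarrow> nat \<Rightarrow> ((nat \<Rightarrow> nat) \<Rightarrow> real) \<Rightarrow> nat list \<Rightarrow> nat list \<Rightarrow> real" where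
  "deviation n t w xs ys = mass n w (\<lambda>p. map p xs = ys) - 1 / card (tuples n t)"

definition energy :: "nat \<Rightarrow> nat \<Rightarrow> ((nat \<Rightarrow> nat) \<Rightarrow> real) \<Rightarrow> real" where
  "energy n t w = (\<Sum>xs\<in>tuples n t. \<Sum>ys\<in>tuples n t. (deviation n t w xs ys)\<^sup>2)"

text \<open>
  The distribution of the product of \<open>s\<close>, taken or omitted according to a fair coin, with a
  random permutation of distribution \<open>w\<close>.
\<close>
definition lazy :: "(nat \<Rightarrow> nat) \<Rightarrow> ((nat \<Rightarrow> nat) \<Rightarrow> real) \<Rightarrow> (nat \<Rightarrow> nat) \<Rightarrow> real" where
  "lazy s w p = (w p + w (inv' s \<circ> p)) / 2"

lemma finite_tuples: "finite (tuples n t)"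
  unfolding tuples_def
  by (rule finite_subset[OF _ finite_lists_length_eq[of "{1..n}" t]]) auto

lemma map_tuples: "p permutes {1..n} \<Longrightarrow> xs \<in> tuples n t \<Longrightarrow> map p xs \<in> tuples n t"
  unfolding tuples_def
  using permutes_in_image[of p "{1..n}"] by (auto simp: distinct_map permutes_inj_on)

lemma map_inv: assumes "p permutes {1..n}" shows "map p (map (inv' p) xs) = xs" "map (inv' p) (map p xs) = xs"
  using permutes_inverses[OF assms] by (simp_all add: comp_def)

lemma bij_map_tuples:
  assumes "p permutes {1..n}" shows "bij_betw (map p) (tuples n t) (tuples n t)"
  by (rule bij_betw_byWitness[where f' = "map (inv' p)"])
    (use map_inv[OF assms] map_tuples[OF assms] map_tuples[OF permutes_inv[OF assms]] in auto)

lemma sum_mass_tuples: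
  assumes "xs \<in> tuples n t"
  shows "(\<Sum>ys\<in>tuples n t. mass n w (\<lambda>p. map p xs = ys)) = mass n w (\<lambda>p. True)"
proof -
  have "mass n w (\<lambda>p. True) = sum w (\<Union>ys\<in>tuples n t. {p. p permutes {1..n} \<and> map p xs = ys})"
    unfolding mass_def using map_tuples assms by (intro sum.cong) auto
  also have "\<dots> = (\<Sum>ys\<in>tuples n t. mass n w (\<lambda>p. map p xs = ys))"
    unfolding mass_def
  proof (rule sum.UNION_disjoint[OF finite_tuples])
    show "\<forall>ys\<in>tuples n t. finite {p. p permutes {1..n} \<and> map p xs = ys}" by (intro ballI finite_perms)
  qed auto
  finally show ?thesis by simp
qed

lemma mass_lazy:
  assumes s: "s permutes {1..n}"
  shows "mass n (lazy s w) (\<lambda>p. map p xs = ys) =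
    (mass n w (\<lambda>p. map p xs = ys) + mass n w (\<lambda>p. map p xs = map (inv' s) ys)) / 2"
proof -
  have "(\<Sum>p | p permutes {1..n} \<and> map p xs = ys. w (inv' s \<circ> p)) =
      (\<Sum>p | p permutes {1..n} \<and> map p xs = map (inv' s) ys. w p)"
  proof (rule sum.reindex_bij_witness[where j = "\<lambda>p. inv' s \<circ> p" and i = "\<lambda>p. s \<circ> p"])
    fix p assume "p \<in> {p. p permutes {1..n} \<and> map p xs = ys}"
    then show "s \<circ> (inv' s \<circ> p) = p" "inv' s \<circ> p \<in> {p. p permutes {1..n} \<and> map p xs = map (inv' s) ys}"
      using permutes_inv_o(1)[OF s] permutes_compose[OF _ permutes_inv[OF s]]
      by (auto simp: o_assoc)
  next
    fix p assume p: "p \<in> {p. p permutes {1..n} \<and> map p xs = map (inv' s) ys}"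
    then show "inv' s \<circ> (s \<circ> p) = p" using permutes_inv_o(2)[OF s] by (simp add: o_assoc)
    have "map (s \<circ> p) xs = map s (map (inv' s) ys)" using p by (simp flip: map_map)
    then show "s \<circ> p \<in> {p. p permutes {1..n} \<and> map p xs = ys}"
      using p permutes_compose[OF _ s] map_inv(1)[OF s] by auto
  qed auto
  then show ?thesis unfolding mass_def lazy_def
    by (simp add: add_divide_distrib sum.distrib flip: sum_divide_distrib)
qed

text \<open>
  The parallelogram law: averaging a function with a translate of it reduces the square norm
  by a quarter of the square of their distance.
\<close>
lemma energy_lazy:
  assumes s: "s permutes {1..n}"
  shows "energy n t (lazy s w) = energy n t w -
    (\<Sum>xs\<in>tuples n t. \<Sum>ys\<in>tuples n t. (deviation n t w xs (map s ys) - deviation n t w xs ys)\<^sup>2) / 4"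
proof -
  let ?X = "tuples n t" and ?D = "deviation n t w"
  have reindex: "(\<Sum>ys\<in>?X. f (map s ys)) = (\<Sum>ys\<in>?X. f ys)" for f :: "nat list \<Rightarrow> real"
    using sum.reindex_bij_betw[OF bij_map_tuples[OF s]] .
  have dev: "deviation n t (lazy s w) xs (map s ys) = (?D xs (map s ys) + ?D xs ys) / 2" for xs ys
    unfolding deviation_def mass_lazy[OF s] map_inv(2)[OF s] by (simp add: field_simps)
  have "(\<Sum>ys\<in>?X. (deviation n t (lazy s w) xs ys)\<^sup>2) = (\<Sum>ys\<in>?X. (?D xs ys)\<^sup>2)
      - (\<Sum>ys\<in>?X. (?D xs (map s ys) - ?D xs ys)\<^sup>2) / 4" for xs
  proof -
    have "(\<Sum>ys\<in>?X. (deviation n t (lazy s w) xs ys)\<^sup>2) =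
        (\<Sum>ys\<in>?X. ((?D xs (map s ys))\<^sup>2 + (?D xs ys)\<^sup>2) / 2 - (?D xs (map s ys) - ?D xs ys)\<^sup>2 / 4)"
      unfolding reindex[of "\<lambda>ys. (deviation n t (lazy s w) xs ys)\<^sup>2", symmetric] dev
      by (intro sum.cong refl) (simp add: power2_eq_square field_simps)
    also have "\<dots> = ((\<Sum>ys\<in>?X. (?D xs (map s ys))\<^sup>2) + (\<Sum>ys\<in>?X. (?D xs ys)\<^sup>2)) / 2
        - (\<Sum>ys\<in>?X. (?D xs (map s ys) - ?D xs ys)\<^sup>2) / 4"
      by (simp add: sum_subtractf sum.distrib flip: sum_divide_distrib)
    finally show ?thesis unfolding reindex[of "\<lambda>ys. (?D xs ys)\<^sup>2"] by simp
  qed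
  then show ?thesis unfolding energy_def by (simp add: sum_subtractf flip: sum_divide_distrib)
qed

lemma relpow_Lipschitz:
  fixes h :: "'a \<Rightarrow> real"
  assumes edge: "\<And>y z. (y, z) \<in> r \<Longrightarrow> \<bar>h z - h y\<bar> \<le> \<delta>"
  shows "(y, z) \<in> r ^^ k \<Longrightarrow> \<bar>h z - h y\<bar> \<le> k * \<delta>"
proof (induction k arbitrary: z)
  case (Suc k)
  then obtain z' where "(y, z') \<in> r ^^ k" "(z', z) \<in> r" by auto
  then have "\<bar>h z' - h y\<bar> \<le> k * \<delta>" "\<bar>h z - h z'\<bar> \<le> \<delta>" using Suc.IH edge by auto
  then show ?case by (simp add: algebra_simps)
qed simp

locale transitive_on_tuples =
  fixes n t :: nat and S :: "(nat \<Rightarrow> nat) set"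
  assumes S: "\<And>s. s \<in> S \<Longrightarrow> s permutes {1..n}"
    and transitive: "\<And>xs ys. xs \<in> tuples n t \<Longrightarrow> ys \<in> tuples n t \<Longrightarrow>
      \<exists>ss. set ss \<subseteq> S \<and> map (composite ss) xs = ys"
    and nonempty: "tuples n t \<noteq> {}" "S \<noteq> {}"
begin

abbreviation "N \<equiv> card (tuples n t)"

definition step :: "(nat list \<times> nat list) set" where
  "step = {(ys, map s ys) | ys s. ys \<in> tuples n t \<and> s \<in> S}"

lemma N_pos: "0 < N" using nonempty(1) finite_tuples card_gt_0_iff by blast

lemma step_subset: "step \<subseteq> tuples n t \<times> tuples n t"
  unfolding step_def using S map_tuples by auto

lemma word_step: "set ss \<subseteq> S \<Longrightarrow> xs \<in> tuples n t \<Longrightarrow>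
    map (composite ss) xs \<in> tuples n t \<and> (xs, map (composite ss) xs) \<in> step\<^sup>*"
proof (induction ss)
  case (Cons s ss)
  then have IH: "map (composite ss) xs \<in> tuples n t" "(xs, map (composite ss) xs) \<in> step\<^sup>*"
    and s: "s \<in> S" by auto
  have "(map (composite ss) xs, map s (map (composite ss) xs)) \<in> step"
    unfolding step_def using IH(1) s by blast
  then have "(xs, map s (map (composite ss) xs)) \<in> step\<^sup>*" using IH(2) by (rule rtrancl_into_rtrancl[rotated])
  moreover have "map s (map (composite ss) xs) = map (composite (s # ss)) xs" by simp
  ultimately show ?case using map_tuples[OF S[OF s] IH(1)] by metis
qed auto

lemma short_path:
  assumes "xs \<in> tuples n t" "ys \<in> tuples n t"
  shows "\<exists>k\<le>N\<^sup>2. (xs, ys) \<in> step ^^ k"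
proof -
  have fin: "finite step" using step_subset finite_tuples by (meson finite_SigmaI finite_subset)
  have "card step \<le> card (tuples n t \<times> tuples n t)"
    using step_subset finite_tuples by (intro card_mono) auto
  also have "\<dots> = N\<^sup>2" by (simp add: card_cartesian_product power2_eq_square)
  finally have "card step \<le> N\<^sup>2" .
  moreover have "(xs, ys) \<in> step\<^sup>*" using transitive[OF assms] word_step assms(1) by blast
  then have "\<exists>k\<le>card step. (xs, ys) \<in> step ^^ k" using rtrancl_finite_eq_relpow[OF fin] by auto
  ultimately show ?thesis by (meson le_trans)
qed

lemma short_word:
  assumes "xs \<in> tuples n t" "ys \<in> tuples n t"
  shows "\<exists>p. word_of S (N\<^sup>2) p \<and> map p xs = ys"
proof -
  obtain k where k: "k \<le> N\<^sup>2" "(xs, ys) \<in> step ^^ k" using short_path[OF assms] by blast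
  have "(xs, ys) \<in> step ^^ k \<Longrightarrow> \<exists>ss. set ss \<subseteq> S \<and> length ss = k \<and> map (composite ss) xs = ys" for k ys
  proof (induction k arbitrary: ys)
    case (Suc k)
    then obtain zs where "(xs, zs) \<in> step ^^ k" "(zs, ys) \<in> step" by auto
    then obtain ss s where "set ss \<subseteq> S" "length ss = k" "map (composite ss) xs = zs" "s \<in> S" "ys = map s zs"
      using Suc.IH unfolding step_def by blast
    then show ?case by (intro exI[of _ "s # ss"]) auto
  qed auto
  then show ?thesis using k unfolding word_of_def by blast
qed

text \<open>
  Let the greatest absolute deviation \<open>M\<close> occur in the row of \<open>xs\<close>. The entries of a row sum
  to zero, so this row also has an entry differing from the extreme one by at least \<open>M\<close>. A
  path of at most \<open>N\<^sup>2\<close> steps joins the two tuples, and on one of its steps the deviation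
  changes by at least \<open>M / (2 * N\<^sup>2)\<close>. The generator of that step reduces the energy, which is
  at most \<open>N\<^sup>2 * M\<^sup>2\<close>, by a fraction of order \<open>1 / N ^ 6\<close>.
\<close>
lemma energy_decrease:
  assumes w: "mass n w (\<lambda>p. True) = 1"
  shows "\<exists>s\<in>S. energy n t (lazy s w) \<le> (1 - 1 / (16 * real N ^ 6)) * energy n t w"
proof -
  let ?X = "tuples n t" and ?D = "deviation n t w"
  define M where "M = Max ((\<lambda>(xs, ys). \<bar>?D xs ys\<bar>) ` (?X \<times> ?X))"
  have fin: "finite ((\<lambda>(xs, ys). \<bar>?D xs ys\<bar>) ` (?X \<times> ?X))" "(\<lambda>(xs, ys). \<bar>?D xs ys\<bar>) ` (?X \<times> ?X) \<noteq> {}"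
    using finite_tuples nonempty by auto
  have le: "\<bar>?D xs ys\<bar> \<le> M" if "xs \<in> ?X" "ys \<in> ?X" for xs ys
    unfolding M_def using that fin by (intro Max_ge) auto
  obtain xs ys where xy: "xs \<in> ?X" "ys \<in> ?X" "\<bar>?D xs ys\<bar> = M"
    using Max_in[OF fin] unfolding M_def by auto
  have M0: "0 \<le> M" using xy by auto
  have N0: "0 < real N" using N_pos by simp
  have "energy n t w \<le> (\<Sum>xs\<in>?X. \<Sum>ys\<in>?X. M\<^sup>2)"
    unfolding energy_def using le M0 by (intro sum_mono) (metis abs_le_square_iff abs_of_nonneg)
  also have "\<dots> = N\<^sup>2 * M\<^sup>2" by (simp add: power2_eq_square)
  finally have E: "energy n t w \<le> N\<^sup>2 * M\<^sup>2" .
  have "\<exists>zs\<in>?X. M \<le> \<bar>?D xs ys - ?D xs zs\<bar>"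
  proof (rule ccontr)
    assume none: "\<not> ?thesis"
    have sum0: "(\<Sum>zs\<in>?X. ?D xs zs) = 0"
      unfolding deviation_def sum_subtractf sum_mass_tuples[OF xy(1)] w using N0 by simp
    show False
    proof (cases "0 \<le> ?D xs ys")
      case True
      then have "\<forall>zs\<in>?X. 0 < ?D xs zs" using none xy(3) by (auto simp: not_le)
      then have "0 < (\<Sum>zs\<in>?X. ?D xs zs)" using finite_tuples nonempty by (intro sum_pos) auto
      then show False using sum0 by simp
    next
      case False
      then have "\<forall>zs\<in>?X. 0 < - ?D xs zs" using none xy(3) by (auto simp: not_le)
      then have "0 < (\<Sum>zs\<in>?X. - ?D xs zs)" using finite_tuples nonempty by (intro sum_pos) auto
      then show False using sum0 by (simp add: sum_negf)
    qed
  qed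
  then obtain zs where zs: "zs \<in> ?X" "M \<le> \<bar>?D xs ys - ?D xs zs\<bar>" by blast
  obtain k where k: "k \<le> N\<^sup>2" "(zs, ys) \<in> step ^^ k" using short_path[OF zs(1) xy(2)] by blast
  define \<delta> where "\<delta> = M / (2 * N\<^sup>2)"
  have "\<exists>us s. us \<in> ?X \<and> s \<in> S \<and> \<delta> \<le> \<bar>?D xs (map s us) - ?D xs us\<bar>"
  proof (cases "M = 0")
    case True
    then show ?thesis using zs(1) nonempty(2) unfolding \<delta>_def by auto
  next
    case False
    show ?thesis
    proof (rule ccontr)
      assume none: "\<not> ?thesis"
      have "\<bar>?D xs v - ?D xs u\<bar> \<le> \<delta>" if "(u, v) \<in> step" for u v
        using that none unfolding step_def by (auto simp: not_le intro: less_imp_le)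
      then have "\<bar>?D xs ys - ?D xs zs\<bar> \<le> k * \<delta>" using relpow_Lipschitz[OF _ k(2)] by blast
      also have "\<dots> \<le> N\<^sup>2 * \<delta>"
        using k(1) M0 unfolding \<delta>_def by (intro mult_right_mono) (auto simp flip: of_nat_power)
      also have "\<dots> = M / 2" using N0 unfolding \<delta>_def by simp
      finally show False using zs(2) M0 False by simp
    qed
  qed
  then obtain us s where us: "us \<in> ?X" "s \<in> S" "\<delta> \<le> \<bar>?D xs (map s us) - ?D xs us\<bar>" by blast
  have \<delta>0: "0 \<le> \<delta>" using M0 unfolding \<delta>_def by simp
  let ?Q = "\<lambda>xs ys. (?D xs (map s ys) - ?D xs ys)\<^sup>2"
  have "\<delta>\<^sup>2 \<le> ?Q xs us" using us(3) \<delta>0 by (metis abs_le_square_iff abs_of_nonneg)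
  also have "\<dots> \<le> (\<Sum>ys\<in>?X. ?Q xs ys)" using us(1) finite_tuples by (intro member_le_sum) auto
  also have "\<dots> \<le> (\<Sum>xs\<in>?X. \<Sum>ys\<in>?X. ?Q xs ys)"
    using xy(1) finite_tuples by (intro member_le_sum) (auto intro: sum_nonneg)
  finally have drop: "\<delta>\<^sup>2 \<le> (\<Sum>xs\<in>?X. \<Sum>ys\<in>?X. ?Q xs ys)" .
  have "energy n t w / (4 * real N ^ 6) \<le> N\<^sup>2 * M\<^sup>2 / (4 * real N ^ 6)"
    using E by (intro divide_right_mono) auto
  also have "\<dots> = \<delta>\<^sup>2" using N0 unfolding \<delta>_def by (simp add: power_divide power_mult_distrib field_simps)
  finally have "energy n t w / (4 * real N ^ 6) / 4 \<le> (\<Sum>xs\<in>?X. \<Sum>ys\<in>?X. ?Q xs ys) / 4"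
    using drop by (intro divide_right_mono) (rule order_trans, auto)
  then have "energy n t (lazy s w) \<le> energy n t w - energy n t w / (16 * real N ^ 6)"
    unfolding energy_lazy[OF S[OF us(2)]] by simp
  then show ?thesis using us(2) by (intro bexI[of _ s]) (simp_all add: algebra_simps)
qed

lemma energy_iterate:
  "\<exists>w. (\<forall>p. 0 \<le> w p) \<and> mass n w (\<lambda>p. True) = 1 \<and>
    (\<forall>p. w p \<noteq> 0 \<longrightarrow> word_of S k p) \<and>
    energy n t w \<le> (1 - 1 / (16 * real N ^ 6)) ^ k * (real N)\<^sup>2"
proof (induction k)
  case 0
  define w where "w p = (if p = id then 1 else 0 :: real)" for p :: "nat \<Rightarrow> nat"
  have sum1: "sum w A = (if id \<in> A then 1 else 0)" if "finite A" for A
    unfolding w_def using that by (simp add: sum.delta)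
  have mass1: "mass n w P = (if P id then 1 else 0)" for P
    unfolding mass_def by (subst sum1[OF finite_perms]) (simp add: permutes_id)
  define q where "q = 1 / real N"
  have "0 \<le> q" "q \<le> 1" using N_pos unfolding q_def by auto
  then have "(deviation n t w xs ys)\<^sup>2 \<le> 1" for xs ys
    unfolding deviation_def mass1 q_def[symmetric] abs_square_le_1 by (simp add: abs_le_iff)
  then have "energy n t w \<le> (\<Sum>xs\<in>tuples n t. \<Sum>ys\<in>tuples n t. 1)"
    unfolding energy_def by (intro sum_mono)
  moreover have "word_of S 0 p" if "w p \<noteq> 0" for p
    using that unfolding w_def word_of_def by (intro exI[of _ "[]"]) (auto split: if_splits)
  moreover have "0 \<le> w p" for p unfolding w_def by simp
  ultimately show ?case using mass1 by (intro exI[of _ w]) (simp add: power2_eq_square)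
next
  case (Suc k)
  then obtain w where w: "\<And>p. 0 \<le> w p" "mass n w (\<lambda>p. True) = 1" "\<And>p. w p \<noteq> 0 \<Longrightarrow> word_of S k p"
    "energy n t w \<le> (1 - 1 / (16 * real N ^ 6)) ^ k * (real N)\<^sup>2" by blast
  obtain s where s: "s \<in> S" "energy n t (lazy s w) \<le> (1 - 1 / (16 * real N ^ 6)) * energy n t w"
    using energy_decrease[OF w(2)] by blast
  have "1 \<le> real N ^ 6" using N_pos by (intro one_le_power) simp
  then have "1 \<le> 16 * real N ^ 6" by linarith
  then have c0: "0 \<le> 1 - 1 / (16 * real N ^ 6)" by (subst le_diff_eq, subst add_0, subst divide_le_eq_1) linarith
  have "(1 - 1 / (16 * real N ^ 6)) * energy n t w
      \<le> (1 - 1 / (16 * real N ^ 6)) * ((1 - 1 / (16 * real N ^ 6)) ^ k * (real N)\<^sup>2)"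
    using w(4) c0 by (rule mult_left_mono)
  then have E: "energy n t (lazy s w) \<le> (1 - 1 / (16 * real N ^ 6)) ^ Suc k * (real N)\<^sup>2"
    using s(2) by (simp add: mult.assoc)
  have "mass n (lazy s w) (\<lambda>p. True) = 1"
    using mass_lazy[OF S[OF s(1)], of w "[]" "[]"] w(2) by simp
  moreover have "0 \<le> lazy s w p" for p using w(1) unfolding lazy_def by simp
  moreover have "word_of S (Suc k) p" if "lazy s w p \<noteq> 0" for p
  proof -
    consider "w p \<noteq> 0" | "w (inv' s \<circ> p) \<noteq> 0" using \<open>lazy s w p \<noteq> 0\<close> unfolding lazy_def by force
    then show ?thesis
    proof cases
      case 1 then show ?thesis using word_of_mono[OF w(3)] by simp
    next
      case 2
      then obtain ss where ss: "set ss \<subseteq> S" "length ss \<le> k" "composite ss = inv' s \<circ> p"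
        using w(3) unfolding word_of_def by blast
      have "composite (s # ss) = p"
        using ss(3) permutes_inv_o(1)[OF S[OF s(1)]] by (simp add: o_assoc)
      then show ?thesis using ss s(1) unfolding word_of_def by (intro exI[of _ "s # ss"]) auto
    qed
  qed
  ultimately show ?case using E by blast
qed

lemma uniform_on_tuples:
  "\<exists>w. (\<forall>p. 0 \<le> w p) \<and> mass n w (\<lambda>p. True) = 1 \<and>
    (\<forall>p. w p \<noteq> 0 \<longrightarrow> word_of S (608 * N ^ 7) p) \<and>
    (\<forall>xs\<in>tuples n t. \<forall>ys\<in>tuples n t. \<bar>deviation n t w xs ys\<bar> \<le> 1 / (10 ^ 5 * real N))"
proof -
  \<comment> \<open>\<open>m\<close> steps halve the energy, and \<open>2 ^ J\<close> is at least \<open>10 ^ 10 * N ^ 4\<close>.\<close>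
  define J where "J = 4 * N + 34"
  define m where "m = 16 * N ^ 6"
  have N1: "1 \<le> N" using N_pos by simp
  then have N7: "m * J \<le> 608 * N ^ 7"
  proof -
    have "m * J \<le> 16 * N ^ 6 * (38 * N)" using N1 unfolding m_def J_def by (intro mult_le_mono) auto
    also have "\<dots> = 608 * N ^ 7" using power_add[of N 6 1] by simp
    finally show ?thesis .
  qed
  have m0: "0 < real m" using N_pos unfolding m_def by simp
  have "(1 - 1 / real m) ^ (m * J) \<le> exp (- (1 / real m)) ^ (m * J)"
  proof (rule power_mono)
    show "1 - 1 / real m \<le> exp (- (1 / real m))" using exp_ge_add_one_self[of "- (1 / real m)"] by simp
    show "0 \<le> 1 - 1 / real m" using m0 by (simp add: field_simps)
  qed
  also have "\<dots> = exp (- 1) ^ J" using m0 by (simp flip: exp_of_nat_mult)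
  also have "\<dots> \<le> (1 / 2) ^ J"
    using exp_ge_add_one_self[of 1] by (intro power_mono) (auto simp: exp_minus field_simps)
  finally have decay: "(1 - 1 / real m) ^ (m * J) \<le> (1 / 2) ^ J" .
  have "real N \<le> 2 ^ N" by (simp add: less_imp_le of_nat_less_two_power)
  then have "real N ^ 4 * 10 ^ 10 \<le> (2 ^ N) ^ 4 * 2 ^ 34" by (intro mult_mono power_mono) auto
  also have "\<dots> = 2 ^ J" unfolding J_def power_add power_mult[symmetric] by (simp add: mult.commute)
  finally have "real N ^ 4 * 10 ^ 10 \<le> 2 ^ J" .
  then have "(1 / 2) ^ J \<le> 1 / (real N ^ 4 * 10 ^ 10)"
    using N_pos by (simp add: power_one_over frac_le)
  with decay have "(1 - 1 / real m) ^ (m * J) * (real N)\<^sup>2 \<le> 1 / (real N ^ 4 * 10 ^ 10) * (real N)\<^sup>2"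
    by (intro mult_right_mono) auto
  also have "\<dots> = (1 / (10 ^ 5 * real N))\<^sup>2"
    using N_pos by (simp add: power_divide power_mult_distrib eval_nat_numeral)
  finally have small: "(1 - 1 / real m) ^ (m * J) * (real N)\<^sup>2 \<le> (1 / (10 ^ 5 * real N))\<^sup>2" .
  obtain w where w: "\<And>p. 0 \<le> w p" "mass n w (\<lambda>p. True) = 1" "\<And>p. w p \<noteq> 0 \<Longrightarrow> word_of S (m * J) p"
    "energy n t w \<le> (1 - 1 / real m) ^ (m * J) * (real N)\<^sup>2"
    using energy_iterate[of "m * J"] unfolding m_def by auto
  have "\<bar>deviation n t w xs ys\<bar> \<le> 1 / (10 ^ 5 * real N)" if "xs \<in> tuples n t" "ys \<in> tuples n t" for xs ys
  proof -
    have "(deviation n t w xs ys)\<^sup>2 \<le> (\<Sum>ys\<in>tuples n t. (deviation n t w xs ys)\<^sup>2)"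
      using that finite_tuples by (intro member_le_sum) auto
    also have "\<dots> \<le> energy n t w"
      unfolding energy_def using that finite_tuples by (intro member_le_sum) (auto intro: sum_nonneg)
    also have "\<dots> \<le> (1 / (10 ^ 5 * real N))\<^sup>2" using w(4) small by linarith
    finally show ?thesis by (simp add: abs_le_square_iff[symmetric] abs_of_nonneg)
  qed
  moreover have "word_of S (608 * N ^ 7) p" if "w p \<noteq> 0" for p
    using word_of_mono[OF w(3)[OF that] N7] .
  ultimately show ?thesis using w(1,2) by blast
qed

end

lemma card_tuples: "t \<le> n \<Longrightarrow> real (card (tuples n t)) = falling n t"
proof (induction t)
  case 0
  have "tuples n 0 = {[]}" unfolding tuples_def by auto
  then show ?case unfolding falling_def by simp
next
  case (Suc t)
  have card: "card (tuples n k) = \<Prod>{n - k + 1..n}" if "k \<le> n" for k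
    using card_lists_distinct_length_eq[of "{1..n}" k] that unfolding tuples_def by simp
  have "{n - Suc t + 1..n} = insert (n - t) {n - t + 1..n}" using Suc.prems by auto
  then have "card (tuples n (Suc t)) = (n - t) * card (tuples n t)"
    using card[of "Suc t"] card[of t] Suc.prems by simp
  then show ?case using Suc by (simp add: falling_Suc of_nat_diff)
qed

text \<open>
  Every permutation takes some value at \<open>u\<close>, which is one of those that \<open>c\<close> leaves free.
\<close>
lemma mass_agrees_split:
  assumes c: "partial_perm n c" and u: "u \<in> {1..n}" "u \<notin> fst ` c"
  shows "mass n w (agrees c) = (\<Sum>v\<in>{1..n} - snd ` c. mass n w (agrees (insert (u, v) c)))"
proof -
  let ?V = "{1..n} - snd ` c"
  have "{p. p permutes {1..n} \<and> agrees c p} = (\<Union>v\<in>?V. {p. p permutes {1..n} \<and> agrees (insert (u, v) c) p})"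
  proof (intro Set.set_eqI iffI)
    fix p assume p: "p \<in> {p. p permutes {1..n} \<and> agrees c p}"
    have "p u \<notin> snd ` c"
    proof
      assume "p u \<in> snd ` c"
      then obtain x where "(x, p u) \<in> c" by auto
      then have "p x = p u" using p unfolding agrees_def by auto
      then have "x = u" using p permutes_inj by (metis injD mem_Collect_eq)
      then show False using u(2) \<open>(x, p u) \<in> c\<close> by force
    qed
    then have "p u \<in> ?V" using p u(1) permutes_in_image by fastforce
    then show "p \<in> (\<Union>v\<in>?V. {p. p permutes {1..n} \<and> agrees (insert (u, v) c) p})"
      using p unfolding agrees_def by auto
  qed (auto simp: agrees_def)
  then have "mass n w (agrees c) = sum w (\<Union>v\<in>?V. {p. p permutes {1..n} \<and> agrees (insert (u, v) c) p})"
    unfolding mass_def by simp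
  also have "\<dots> = (\<Sum>v\<in>?V. mass n w (agrees (insert (u, v) c)))"
    unfolding mass_def
  proof (rule sum.UNION_disjoint)
    show "\<forall>v\<in>?V. finite {p. p permutes {1..n} \<and> agrees (insert (u, v) c) p}"
      by (intro ballI finite_perms)
  qed (auto simp: agrees_def)
  finally show ?thesis .
qed

text \<open>
  Partial permutations of size \<open>t\<close> are pairs of tuples. Smaller ones follow by downward
  induction, since both the mass and the uniform probability are sums over the possible values
  at one further point.
\<close>
lemma near_uniform_from_tuples:
  assumes t: "t \<le> n" and w: "\<And>p. 0 \<le> w p"
    and dev: "\<And>xs ys. xs \<in> tuples n t \<Longrightarrow> ys \<in> tuples n t \<Longrightarrow>
      \<bar>deviation n t w xs ys\<bar> \<le> \<epsilon> / card (tuples n t)"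
  shows "near_uniform n t \<epsilon> w"
proof -
  have top: "(1 - \<epsilon>) / falling n t \<le> mass n w (agrees c) \<and> mass n w (agrees c) \<le> (1 + \<epsilon>) / falling n t"
    if c: "partial_perm n c" "card c = t" for c
  proof -
    obtain cs where cs: "set cs = c" "distinct cs" using finite_distinct_list[OF partial_perm_finite[OF c(1)]] by blast
    let ?xs = "map fst cs" and ?ys = "map snd cs"
    have "length cs = t" using cs c(2) distinct_card by force
    then have "?xs \<in> tuples n t" "?ys \<in> tuples n t"
      using cs c(1) unfolding tuples_def partial_perm_def by (auto simp: distinct_map)
    moreover have "agrees c = (\<lambda>p. map p ?xs = ?ys)"
      unfolding agrees_def cs(1)[symmetric] by (auto simp: fun_eq_iff)
    ultimately have "\<bar>mass n w (agrees c) - 1 / falling n t\<bar> \<le> \<epsilon> / falling n t"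
      using dev[of ?xs ?ys] unfolding deviation_def card_tuples[OF t] by simp
    then show ?thesis by (auto simp: abs_le_iff add_divide_distrib diff_divide_distrib)
  qed
  have "\<forall>c. partial_perm n c \<and> card c = r \<longrightarrow>
    (1 - \<epsilon>) / falling n r \<le> mass n w (agrees c) \<and> mass n w (agrees c) \<le> (1 + \<epsilon>) / falling n r"
    if "r \<le> t" for r
    using that
  proof (induction r rule: inc_induct)
    case base
    then show ?case using top by blast
  next
    case (step r)
    show ?case
    proof (intro allI impI)
      fix c assume c: "partial_perm n c \<and> card c = r"
      have card_img: "card (fst ` c) = r" "card (snd ` c) = r" "snd ` c \<subseteq> {1..n}"
        using c unfolding partial_perm_def by (auto simp: card_image)
      have rn: "r < n" using step t by simp
      then have "\<not> {1..n} \<subseteq> fst ` c"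
        using card_img(1) card_mono[of "fst ` c" "{1..n}"] partial_perm_finite[of n c] c by auto
      then obtain u where u: "u \<in> {1..n}" "u \<notin> fst ` c" by blast
      let ?V = "{1..n} - snd ` c"
      have cardV: "real (card ?V) = real n - real r"
        using card_img rn by (simp add: card_Diff_subset finite_subset[OF card_img(3)] of_nat_diff)
      have IH: "(1 - \<epsilon>) / falling n (Suc r) \<le> mass n w (agrees (insert (u, v) c)) \<and>
          mass n w (agrees (insert (u, v) c)) \<le> (1 + \<epsilon>) / falling n (Suc r)" if "v \<in> ?V" for v
        using step.IH partial_perm_insert[of n c u v] c u that by auto
      have "real (card ?V) * ((1 - \<epsilon>) / falling n (Suc r)) \<le> mass n w (agrees c)"
        unfolding mass_agrees_split[OF conjunct1[OF c] u] using IH by (intro sum_bounded_below) auto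
      moreover have "mass n w (agrees c) \<le> real (card ?V) * ((1 + \<epsilon>) / falling n (Suc r))"
        unfolding mass_agrees_split[OF conjunct1[OF c] u] using IH by (intro sum_bounded_above) auto
      ultimately show "(1 - \<epsilon>) / falling n r \<le> mass n w (agrees c) \<and> mass n w (agrees c) \<le> (1 + \<epsilon>) / falling n r"
        using rn unfolding cardV falling_Suc by simp
    qed
  qed
  then show ?thesis using w unfolding near_uniform_def by blast
qed

lemma (in transitive_on_tuples) mixing:
  assumes t: "t \<le> n"
  shows "\<exists>w. near_uniform n t (1 / 10 ^ 5) w \<and> (\<forall>p. w p \<noteq> 0 \<longrightarrow> word_of S (608 * N ^ 7) p)"
proof -
  obtain w where w: "\<And>p. 0 \<le> w p" "\<And>p. w p \<noteq> 0 \<Longrightarrow> word_of S (608 * N ^ 7) p"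
    "\<And>xs ys. xs \<in> tuples n t \<Longrightarrow> ys \<in> tuples n t \<Longrightarrow> \<bar>deviation n t w xs ys\<bar> \<le> 1 / (10 ^ 5 * real N)"
    using uniform_on_tuples by blast
  have "near_uniform n t (1 / 10 ^ 5) w" using w(1,3) by (intro near_uniform_from_tuples[OF t]) auto
  then show ?thesis using w(2) by blast
qed

section \<open>Revealing a random permutation along a walk\<close>

text \<open>
  The course of a walk depends on a sequence of binary answers: whether the point revealed
  next is fixed by \<open>g\<close> (first subtree) or moved (second subtree). A leaf tells whether the
  walk has come back to its start; \<open>Lost\<close> also covers walks that are not followed any further.
\<close>
datatype tree = Lost | Back | Reveal tree tree

text \<open>
  The probability of reaching a leaf \<open>Back\<close> when the answers are independent, with probability
  \<open>\<beta>\<close> for a fixed point and \<open>\<mu>\<close> for a moved one. Only lower bounds are needed, so \<open>\<beta> + \<mu>\<close> may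
  be less than 1.
\<close>
fun return_weight :: "real \<Rightarrow> real \<Rightarrow> tree \<Rightarrow> real" where
  "return_weight \<beta> \<mu> Lost = 0"
| "return_weight \<beta> \<mu> Back = 1"
| "return_weight \<beta> \<mu> (Reveal f g) = \<beta> * return_weight \<beta> \<mu> f + \<mu> * return_weight \<beta> \<mu> g"

text \<open>
  Two copies of \<open>{1..n}\<close> are joined by \<open>p\<close>, and \<open>g\<close> acts on both. A step of a walk applies \<open>g\<close>
  or its inverse within a copy and then crosses over to the other copy by \<open>p\<close> or its inverse;
  two steps thus apply a power of \<open>g\<close> followed by one of the conjugate of \<open>g\<close>. A point visited
  by the walk is described symbolically: the number of the \<open>g\<close>-cycle in order of discovery,
  whether this cycle is nontrivial, and an offset along it. If \<open>cyc\<close> holds, nontrivial cycles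
  have exactly \<open>m\<close> points; otherwise they have at least \<open>m\<close> points, and only \<open>m\<close> consecutive
  ones are within the window that the walk may use, so \<open>turn\<close> fails at its ends.
\<close>
type_synonym site = "nat \<times> bool \<times> nat"

fun turn :: "nat \<Rightarrow> bool \<Rightarrow> bool \<Rightarrow> nat \<Rightarrow> nat option" where
  "turn m cyc True k = (if Suc k < m then Some (Suc k) else if cyc then Some 0 else None)"
| "turn m cyc False (Suc k) = Some k"
| "turn m cyc False 0 = (if cyc then Some (m - 1) else None)"

fun advance :: "nat \<Rightarrow> bool \<Rightarrow> bool \<Rightarrow> site \<Rightarrow> site option" where
  "advance m cyc s (l, False, k) = Some (l, False, k)"
| "advance m cyc s (l, True, k) =
    (case turn m cyc s k of None \<Rightarrow> None | Some k' \<Rightarrow> Some (l, True, k'))"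

text \<open>
  The list contains the pairs of sites already known to correspond under \<open>p\<close>.
\<close>
fun partner :: "(site \<times> site) list \<Rightarrow> nat \<Rightarrow> nat \<Rightarrow> site option" where
  "partner [] l k = None"
| "partner (((l1, b1, k1), (l2, b2, k2)) # xs) l k =
    (if l1 = l \<and> k1 = k then Some (l2, b2, k2)
     else if l2 = l \<and> k2 = k then Some (l1, b1, k1) else partner xs l k)"

text \<open>
  The decision tree of a walk along a list of steps. The first entry of a step says whether
  \<open>g\<close> or its inverse is applied, the second whether returning to \<open>home\<close> after this step
  counts. If the image under \<open>p\<close> of the current point is not yet known, it lies on a new
  cycle, numbered \<open>q\<close>, and its offset is declared to be \<open>e\<close>. The budgets \<open>f\<close> and \<open>d\<close> limit how
  many of the revealed points may be fixed and moved, respectively; they keep the tree small.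
\<close>
fun explore :: "nat \<Rightarrow> bool \<Rightarrow> nat \<Rightarrow> site \<Rightarrow> nat \<Rightarrow> nat \<Rightarrow> (bool \<times> bool) list \<Rightarrow> nat \<Rightarrow>
    (site \<times> site) list \<Rightarrow> site \<Rightarrow> tree" where
  "explore m cyc e home f d [] q xs a = Lost"
| "explore m cyc e home f d ((s, chk) # es) q xs a =
    (case advance m cyc s a of
       None \<Rightarrow> Lost
     | Some a' \<Rightarrow> (case partner xs (fst a') (snd (snd a')) of
          Some b \<Rightarrow> if chk \<and> b = home then Back else explore m cyc e home f d es q xs b
        | None \<Rightarrow> Reveal
            (case f of 0 \<Rightarrow> Lost | Suc f' \<Rightarrow>
               explore m cyc e home f' d es (Suc q) ((a', (q, False, e)) # xs) (q, False, e))
            (case d of 0 \<Rightarrow> Lost | Suc d' \<Rightarrow>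
               explore m cyc e home f d' es (Suc q) ((a', (q, True, e)) # xs) (q, True, e))))"

text \<open>
  The nature of the starting point is itself the first answer.
\<close>
definition outcome_tree :: "nat \<Rightarrow> bool \<Rightarrow> nat \<Rightarrow> nat \<Rightarrow> nat \<Rightarrow> (bool \<times> bool) list \<Rightarrow> tree" where
  "outcome_tree m cyc e f d es = Reveal (explore m cyc e (0, False, e) (f - 1) d es 1 [] (0, False, e))
                                (explore m cyc e (0, True, e) f (d - 1) es 1 [] (0, True, e))"

type_synonym point = "nat \<times> bool"

text \<open>
  The second component of a point is the copy it lies in: \<open>p\<close> leads from \<open>False\<close> to \<open>True\<close>.
\<close>
definition cross :: "(nat \<Rightarrow> nat) \<Rightarrow> point \<Rightarrow> point" where
  "cross p u = ((if snd u then inv' p (fst u) else p (fst u)), \<not> snd u)"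

definition push :: "(nat \<Rightarrow> nat) \<Rightarrow> bool \<Rightarrow> point \<Rightarrow> point" where
  "push g s u = ((if s then g (fst u) else inv' g (fst u)), snd u)"

fun returns :: "(nat \<Rightarrow> nat) \<Rightarrow> (nat \<Rightarrow> nat) \<Rightarrow> point \<Rightarrow> (bool \<times> bool) list \<Rightarrow> point \<Rightarrow> bool" where
  "returns g p h [] u = False"
| "returns g p h ((s, chk) # es) u =
    ((chk \<and> cross p (push g s u) = h) \<or> returns g p h es (cross p (push g s u)))"

text \<open>
  The points of the two copies at which a partial permutation is already revealed.
\<close>
definition ends :: "(nat \<times> nat) set \<Rightarrow> point set" where
  "ends c = (\<lambda>x. (x, False)) ` fst ` c \<union> (\<lambda>y. (y, True)) ` snd ` c"

definition joined :: "(nat \<times> nat) set \<Rightarrow> point \<Rightarrow> point \<Rightarrow> bool" where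
  "joined c u v \<longleftrightarrow> (fst u, fst v) \<in> c \<and> \<not> snd u \<and> snd v \<or> (fst v, fst u) \<in> c \<and> snd u \<and> \<not> snd v"

definition link :: "point \<Rightarrow> nat \<Rightarrow> nat \<times> nat" where
  "link u v = (if snd u then (v, fst u) else (fst u, v))"

lemma joined_cross:
  assumes "joined c u v" "agrees c p" "p permutes {1..n}"
  shows "cross p u = v"
  using assms permutes_inverses[OF assms(3)] unfolding joined_def agrees_def cross_def
  by (cases u; cases v) auto

lemma joined_sym: "joined c u v \<longleftrightarrow> joined c v u"
  unfolding joined_def by auto

lemma joined_mono: "joined c u v \<Longrightarrow> c \<subseteq> c' \<Longrightarrow> joined c' u v"
  unfolding joined_def by auto

lemma joined_link: "joined (insert (link u v) c) u (v, \<not> snd u)"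
  unfolding joined_def link_def by auto

lemma ends_insert_link: "ends (insert (link u v) c) = insert u (insert (v, \<not> snd u) (ends c))"
  unfolding ends_def link_def by (cases u) auto

text \<open>
  The hypothesis that makes all nontrivial cycles of \<open>g\<close> look alike to the walk: either all
  have length \<open>m\<close>, or \<open>m\<close> consecutive points of each are distinct and the rest is avoided. The
  entry offset \<open>e\<close> is the position within the window at which the walk enters a newly found
  cycle.
\<close>
locale rotation =
  fixes n :: nat and g :: "nat \<Rightarrow> nat" and m :: nat and cyc :: bool and e :: nat
  assumes g: "g permutes {1..n}"
    and e: "e < m"
    and cyc: "cyc \<Longrightarrow> g ^^ m = id"
    and inj_cycle: "\<And>x. g x \<noteq> x \<Longrightarrow> inj_on (\<lambda>k. (g ^^ k) x) {..<m}"
begin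

text \<open>
  The meaning of a site: \<open>b l\<close> is the point of offset 0 on cycle number \<open>l\<close>.
\<close>
definition spot :: "(nat \<Rightarrow> point) \<Rightarrow> site \<Rightarrow> point" where
  "spot b a = ((g ^^ snd (snd a)) (fst (b (fst a))), snd (b (fst a)))"

definition sites :: "nat \<Rightarrow> (nat \<Rightarrow> bool) \<Rightarrow> site set" where
  "sites q ty = {(l, t, k). l < q \<and> t = ty l \<and> (if t then k < m else k = e)}"

text \<open>
  The invariant that ties the symbolic walk to the actual one: distinct sites denote distinct
  points, the pairs in \<open>xs\<close> are values of the partial permutation \<open>c\<close>, and no other site has
  its image revealed by \<open>c\<close>. The set \<open>U\<close> collects the points that a new cycle has to avoid. It
  may be larger than the part of the cycles seen so far, since \<open>c\<close> can contain values
  prescribed in advance.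
\<close>
definition coded :: "nat \<Rightarrow> (site \<times> site) list \<Rightarrow> (nat \<Rightarrow> point) \<Rightarrow> (nat \<Rightarrow> bool) \<Rightarrow>
    (nat \<times> nat) set \<Rightarrow> point set \<Rightarrow> bool" where
  "coded q xs b ty c U \<longleftrightarrow> partial_perm n c \<and> finite U \<and> ends c \<subseteq> U \<and>
     (\<forall>l<q. fst (b l) \<in> {1..n} \<and> (ty l \<longleftrightarrow> g (fst (b l)) \<noteq> fst (b l))) \<and>
     inj_on (spot b) (sites q ty) \<and> spot b ` sites q ty \<subseteq> U \<and>
     (\<forall>(a, a')\<in>set xs. a \<in> sites q ty \<and> a' \<in> sites q ty \<and> joined c (spot b a) (spot b a')) \<and>
     (\<forall>a\<in>sites q ty. spot b a \<in> ends c \<longrightarrow> a \<in> fst ` set xs \<union> snd ` set xs)"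

lemma pow_fixed: "g x = x \<Longrightarrow> (g ^^ k) x = x"
  by (induction k) auto

lemma pow_in: "x \<in> {1..n} \<Longrightarrow> (g ^^ k) x \<in> {1..n}"
  using permutes_in_image[OF permutes_funpow[OF g]] by blast

lemma inv_g: "inv' g (g x) = x" "g (inv' g x) = x"
  using permutes_inverses[OF g] by auto

lemma advance_correct:
  assumes C: "coded q xs b ty c U" and a: "a \<in> sites q ty" and adv: "advance m cyc s a = Some a'"
  shows "a' \<in> sites q ty" "push g s (spot b a) = spot b a'"
proof -
  obtain l k where a_eq: "a = (l, ty l, k)" "l < q" "if ty l then k < m else k = e"
    using a unfolding sites_def by auto
  have ty: "ty l \<longleftrightarrow> g (fst (b l)) \<noteq> fst (b l)" using C a_eq unfolding coded_def by auto
  have "a' \<in> sites q ty \<and> push g s (spot b a) = spot b a'"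
  proof (cases "ty l")
    case False
    then have "g (fst (b l)) = fst (b l)" "inv' g (fst (b l)) = fst (b l)"
      using ty inv_g by metis+
    then show ?thesis using False a a_eq adv pow_fixed by (auto simp: spot_def push_def)
  next
    case True
    then obtain k' where k': "turn m cyc s k = Some k'" "a' = (l, True, k')"
      using adv a_eq by (auto split: option.splits)
    let ?x = "fst (b l)"
    have period: "cyc \<Longrightarrow> (g ^^ m) ?x = ?x" using cyc by simp
    have m: "m = Suc (m - 1)" using e by simp
    have "k < m" using a_eq(3) True by simp
    have "k' < m \<and> (if s then g ((g ^^ k) ?x) else inv' g ((g ^^ k) ?x)) = (g ^^ k') ?x"
    proof (cases s)
      case True
      show ?thesis
      proof (cases "Suc k < m")
        case False
        then have "cyc" "k' = 0" using k'(1) \<open>s\<close> by (auto split: if_splits)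
        moreover have "m = Suc k" using False \<open>k < m\<close> by simp
        ultimately show ?thesis using \<open>s\<close> period by simp
      qed (use k'(1) \<open>s\<close> in auto)
    next
      case False
      show ?thesis
      proof (cases k)
        case 0
        then have *: "cyc" "k' = m - 1" using k'(1) False by (auto split: if_splits)
        have "(g ^^ Suc (m - 1)) ?x = ?x" using period[OF *(1)] m by simp
        then have "inv' g ?x = (g ^^ (m - 1)) ?x" using inv_g(1)[of "(g ^^ (m - 1)) ?x"] by simp
        then show ?thesis using False 0 e *(2) by simp
      next
        case (Suc j)
        then show ?thesis using k'(1) False \<open>k < m\<close> inv_g by simp
      qed
    qed
    then show ?thesis using k'(2) a_eq True by (auto simp: sites_def spot_def push_def)
  qed
  then show "a' \<in> sites q ty" "push g s (spot b a) = spot b a'" by auto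
qed

lemma partner_Some:
  "partner xs l k = Some a' \<Longrightarrow>
    \<exists>t. ((l, t, k), a') \<in> set xs \<or> (a', (l, t, k)) \<in> set xs"
  by (induction xs l k rule: partner.induct) (auto split: if_splits)

lemma partner_None:
  "partner xs l k = None \<Longrightarrow> (l, t, k) \<notin> fst ` set xs \<union> snd ` set xs"
  by (induction xs l k rule: partner.induct) (auto split: if_splits)

lemma coded_joined:
  assumes C: "coded q xs b ty c U" and a: "a \<in> sites q ty"
    and P: "partner xs (fst a) (snd (snd a)) = Some a'"
  shows "a' \<in> sites q ty" "joined c (spot b a) (spot b a')"
proof -
  obtain t where t: "((fst a, t, snd (snd a)), a') \<in> set xs \<or> (a', (fst a, t, snd (snd a))) \<in> set xs"
    using partner_Some[OF P] by auto
  have pair: "x \<in> sites q ty \<and> x' \<in> sites q ty \<and> joined c (spot b x) (spot b x')"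
    if "(x, x') \<in> set xs" for x x' using C that unfolding coded_def by auto
  have "(fst a, t, snd (snd a)) \<in> sites q ty" using t pair by blast
  then have eq: "(fst a, t, snd (snd a)) = a" using a unfolding sites_def by auto
  from t show "a' \<in> sites q ty" unfolding eq using pair by blast
  from t show "joined c (spot b a) (spot b a')"
    unfolding eq using pair joined_sym[of c "spot b a" "spot b a'"] by blast
qed

lemma coded_unjoined:
  assumes C: "coded q xs b ty c U" and a: "a \<in> sites q ty"
    and P: "partner xs (fst a) (snd (snd a)) = None"
  shows "spot b a \<notin> ends c"
proof
  assume "spot b a \<in> ends c"
  then have "a \<in> fst ` set xs \<union> snd ` set xs" using C a unfolding coded_def by auto
  then show False using partner_None[OF P, of "fst (snd a)"] by auto
qed

text \<open>
  The point of offset 0 on the cycle that is entered at \<open>v\<close> with offset \<open>e\<close>.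
\<close>
definition origin :: "nat \<Rightarrow> nat" where "origin v = (inv' g ^^ e) v"

lemma origin_pow: "(g ^^ e) (origin v) = v"
  unfolding origin_def by (induction e arbitrary: v) (auto simp: funpow_swap1 inv_g)

lemma origin_in: "v \<in> {1..n} \<Longrightarrow> origin v \<in> {1..n}"
  using permutes_in_image[OF permutes_funpow[OF permutes_inv[OF g]]] unfolding origin_def by blast

lemma origin_fixed_iff: "g (origin v) = origin v \<longleftrightarrow> g v = v"
proof
  assume "g (origin v) = origin v" then show "g v = v" using origin_pow[of v] pow_fixed by metis
next
  assume "g v = v"
  then have "inv' g v = v" using inv_g by metis
  then have "(inv' g ^^ k) v = v" for k by (induction k) auto
  then show "g (origin v) = origin v" using \<open>g v = v\<close> unfolding origin_def by simp
qed

text \<open>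
  The entry points on whose cycle no position in the window has been used. All but boundedly
  many points are clean (\<open>card_not_clean\<close>), which is the source of the error terms \<open>O(1/n)\<close>.
\<close>
definition clean :: "point set \<Rightarrow> bool \<Rightarrow> nat set" where
  "clean U s = {v \<in> {1..n}. \<forall>k<m. ((g ^^ k) (origin v), s) \<notin> U}"

definition enlarge :: "point set \<Rightarrow> nat \<Rightarrow> bool \<Rightarrow> point set" where
  "enlarge U v s = U \<union> (\<lambda>k. ((g ^^ k) (origin v), s)) ` {..<m}"

lemma card_enlarge: "finite U \<Longrightarrow> finite (enlarge U v s) \<and> card (enlarge U v s) \<le> card U + m"
  unfolding enlarge_def using card_Un_le[of U "(\<lambda>k. ((g ^^ k) (origin v), s)) ` {..<m}"]
    card_image_le[of "{..<m}" "\<lambda>k. ((g ^^ k) (origin v), s)"] by auto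

lemma card_not_clean:
  assumes "finite U"
  shows "card ({1..n} - clean U s) \<le> m * card U"
proof -
  have inj: "inj (\<lambda>v. (g ^^ k) (origin v))" for k
  proof -
    have "inj (g ^^ k)" "inj (inv' g ^^ e)"
      using permutes_inj[OF permutes_funpow[OF g]] permutes_inj[OF permutes_funpow[OF permutes_inv[OF g]]]
      by blast+
    from inj_compose[OF this] show ?thesis unfolding origin_def comp_def .
  qed
  have "{1..n} - clean U s \<subseteq> (\<Union>k<m. (\<lambda>v. (g ^^ k) (origin v)) -` (fst ` U))"
    unfolding clean_def by force
  moreover have fin: "finite ((\<lambda>v. (g ^^ k) (origin v)) -` (fst ` U))" for k
    using assms inj by (intro finite_vimageI) auto
  ultimately have "card ({1..n} - clean U s) \<le> card (\<Union>k<m. (\<lambda>v. (g ^^ k) (origin v)) -` (fst ` U))"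
    by (intro card_mono) auto
  also have "\<dots> \<le> (\<Sum>k<m. card ((\<lambda>v. (g ^^ k) (origin v)) -` (fst ` U)))"
    by (intro card_UN_le) auto
  also have "\<dots> \<le> (\<Sum>k<m. card U)"
  proof (intro sum_mono)
    fix k
    have "card ((\<lambda>v. (g ^^ k) (origin v)) -` (fst ` U)) \<le> card (fst ` U)"
      using card_vimage_inj_on_le[OF inj, of "fst ` U"] assms by simp
    also have "\<dots> \<le> card U" using assms by (rule card_image_le)
    finally show "card ((\<lambda>v. (g ^^ k) (origin v)) -` (fst ` U)) \<le> card U" .
  qed
  finally show ?thesis by simp
qed

text \<open>
  Revealing a clean value \<open>v\<close> for \<open>p\<close> at an unrevealed site opens a new cycle. All its sites
  lie outside \<open>U\<close>, so they do not coincide with older ones and no value is known there.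
\<close>
lemma coded_extend:
  assumes C: "coded q xs b ty c U" and a: "a \<in> sites q ty" and new: "spot b a \<notin> ends c"
    and v: "v \<in> clean U (\<not> snd (spot b a))"
  defines "u \<equiv> spot b a"
  defines "b' \<equiv> b(q := (origin v, \<not> snd u))" and "ty' \<equiv> ty(q := g v \<noteq> v)"
    and "c' \<equiv> insert (link u v) c"
  shows "coded (Suc q) ((a, (q, g v \<noteq> v, e)) # xs) b' ty' c' (enlarge U v (\<not> snd u))"
    "card c' = Suc (card c)" "(q, g v \<noteq> v, e) \<in> sites (Suc q) ty'"
    "\<And>a. a \<in> sites q ty \<Longrightarrow> a \<in> sites (Suc q) ty'" "\<And>a. a \<in> sites q ty \<Longrightarrow> spot b' a = spot b a"
proof -
  have pp: "partial_perm n c" "finite U" "ends c \<subseteq> U" using C unfolding coded_def by auto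
  have v_in: "v \<in> {1..n}" and far: "\<And>k. k < m \<Longrightarrow> ((g ^^ k) (origin v), \<not> snd u) \<notin> U"
    using v unfolding clean_def u_def by auto
  have vU: "(v, \<not> snd u) \<notin> U" using far[OF e] by (simp add: origin_pow)
  have u_in: "fst u \<in> {1..n}"
    using C a pow_in unfolding coded_def sites_def u_def spot_def by auto
  have c': "partial_perm n c' \<and> card c' = Suc (card c)"
  proof (cases "snd u")
    case True
    then have "fst u \<notin> snd ` c" "v \<notin> fst ` c"
      using new vU pp(3) unfolding u_def[symmetric] ends_def by (cases u, force)+
    then show ?thesis unfolding c'_def link_def
      using partial_perm_insert[OF pp(1) v_in u_in] True by auto
  next
    case False
    then have "fst u \<notin> fst ` c" "v \<notin> snd ` c"
      using new vU pp(3) unfolding u_def[symmetric] ends_def by (cases u, force)+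
    then show ?thesis unfolding c'_def link_def
      using partial_perm_insert[OF pp(1) u_in v_in] False by auto
  qed
  then show "card c' = Suc (card c)" by auto
  show mem: "(q, g v \<noteq> v, e) \<in> sites (Suc q) ty'" using e unfolding sites_def ty'_def by auto
  show old: "\<And>a. a \<in> sites q ty \<Longrightarrow> a \<in> sites (Suc q) ty'"
    unfolding sites_def ty'_def by (auto split: if_splits)
  show spot_old: "\<And>a. a \<in> sites q ty \<Longrightarrow> spot b' a = spot b a"
    unfolding sites_def spot_def b'_def by auto
  define N where "N = {(q, g v \<noteq> v, k) | k. if g v \<noteq> v then k < m else k = e}"
  have split: "sites (Suc q) ty' = sites q ty \<union> N"
    unfolding N_def sites_def ty'_def by (auto simp: less_Suc_eq split: if_splits)
  have new_spot: "spot b' (q, g v \<noteq> v, k) = ((g ^^ k) (origin v), \<not> snd u)" for k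
    unfolding spot_def b'_def by simp
  have N_lt: "\<And>a. a \<in> N \<Longrightarrow> \<exists>k<m. a = (q, g v \<noteq> v, k)" using e unfolding N_def by (auto split: if_splits)
  have N_notU: "spot b' a \<notin> U" if aN: "a \<in> N" for a
  proof -
    obtain k where "k < m" "a = (q, g v \<noteq> v, k)" using N_lt[OF aN] by blast
    then show ?thesis using far[of k] by (simp only: new_spot not_False_eq_True)
  qed
  have spotU: "spot b ` sites q ty \<subseteq> U" using C unfolding coded_def by auto
  have uU: "u \<in> U" using spotU a unfolding u_def by auto
  have inj: "inj_on (spot b') (sites (Suc q) ty')"
  proof -
    have "inj_on (spot b') (sites q ty)"
      using C inj_on_cong[of "sites q ty" "spot b'" "spot b"] spot_old unfolding coded_def by blast
    moreover have "inj_on (spot b') N"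
    proof (cases "g v = v")
      case True then show ?thesis unfolding N_def by (auto simp: inj_on_def)
    next
      case False
      then have "inj_on (\<lambda>k. (g ^^ k) (origin v)) {..<m}" using inj_cycle origin_fixed_iff by auto
      then show ?thesis unfolding inj_on_def N_def
        using False by (auto simp: spot_def b'_def)
    qed
    moreover have "spot b' ` sites q ty \<inter> spot b' ` N = {}"
    proof -
      have "spot b' ` sites q ty \<subseteq> U" using spotU spot_old by auto
      moreover have "U \<inter> spot b' ` N = {}"
      proof (rule Int_emptyI)
        fix x assume "x \<in> U" "x \<in> spot b' ` N"
        then show False using N_notU by (elim imageE) simp
      qed
      ultimately show ?thesis by (metis Int_mono bot.extremum_uniqueI subset_refl)
    qed
    ultimately show ?thesis unfolding split inj_on_Un using Diff_subset
      by (metis (no_types) Int_mono bot.extremum_uniqueI image_mono)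
  qed
  have base: "\<forall>l<Suc q. fst (b' l) \<in> {1..n} \<and> (ty' l \<longleftrightarrow> g (fst (b' l)) \<noteq> fst (b' l))"
    using C origin_in[OF v_in] origin_fixed_iff unfolding coded_def b'_def ty'_def by (auto simp: less_Suc_eq)
  have img: "spot b' ` sites (Suc q) ty' \<subseteq> enlarge U v (\<not> snd u)"
  proof -
    have "spot b' ` N \<subseteq> (\<lambda>k. ((g ^^ k) (origin v), \<not> snd u)) ` {..<m}"
    proof (rule image_subsetI)
      fix a assume "a \<in> N"
      then obtain k where "k < m" "a = (q, g v \<noteq> v, k)" using N_lt by blast
      then show "spot b' a \<in> (\<lambda>k. ((g ^^ k) (origin v), \<not> snd u)) ` {..<m}"
        by (simp only: new_spot) blast
    qed
    then show ?thesis using spotU spot_old unfolding split enlarge_def by auto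
  qed
  have ends': "ends c' = insert u (insert (v, \<not> snd u) (ends c))"
    unfolding c'_def by (rule ends_insert_link)
  have "(v, \<not> snd u) \<in> enlarge U v (\<not> snd u)" using e origin_pow[of v] unfolding enlarge_def by force
  then have endsU: "ends c' \<subseteq> enlarge U v (\<not> snd u)" using ends' uU pp(3) unfolding enlarge_def by auto
  have spot_v: "spot b' (q, g v \<noteq> v, e) = (v, \<not> snd u)" using new_spot origin_pow by simp
  have pairs: "\<forall>(x, x')\<in>set ((a, (q, g v \<noteq> v, e)) # xs). x \<in> sites (Suc q) ty' \<and> x' \<in> sites (Suc q) ty'
      \<and> joined c' (spot b' x) (spot b' x')"
  proof -
    have "joined c' (spot b' a) (spot b' (q, g v \<noteq> v, e))"
      using joined_link spot_v spot_old[OF a] unfolding c'_def u_def by simp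
    moreover have "\<forall>(x, x')\<in>set xs. x \<in> sites (Suc q) ty' \<and> x' \<in> sites (Suc q) ty' \<and>
        joined c' (spot b' x) (spot b' x')"
    proof
      fix z assume z: "z \<in> set xs"
      obtain x x' where xs: "z = (x, x')" by (cases z)
      have *: "x \<in> sites q ty" "x' \<in> sites q ty" "joined c (spot b x) (spot b x')"
        using C z xs unfolding coded_def by auto
      have "joined c' (spot b x) (spot b x')"
        by (rule joined_mono[OF *(3)]) (auto simp: c'_def)
      then show "case z of (x, x') \<Rightarrow> x \<in> sites (Suc q) ty' \<and> x' \<in> sites (Suc q) ty' \<and>
          joined c' (spot b' x) (spot b' x')"
        using old[OF *(1)] old[OF *(2)] spot_old[OF *(1)] spot_old[OF *(2)] xs by simp
    qed
    ultimately show ?thesis using mem old[OF a] by simp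
  qed
  have complete: "\<forall>x\<in>sites (Suc q) ty'. spot b' x \<in> ends c' \<longrightarrow>
      x \<in> fst ` set ((a, (q, g v \<noteq> v, e)) # xs) \<union> snd ` set ((a, (q, g v \<noteq> v, e)) # xs)"
  proof (intro ballI impI)
    fix x assume x: "x \<in> sites (Suc q) ty'" "spot b' x \<in> ends c'"
    then consider "spot b' x = spot b' a" | "spot b' x = spot b' (q, g v \<noteq> v, e)" | "spot b' x \<in> ends c"
      using ends' spot_v spot_old[OF a] unfolding u_def by auto
    then show "x \<in> fst ` set ((a, (q, g v \<noteq> v, e)) # xs) \<union> snd ` set ((a, (q, g v \<noteq> v, e)) # xs)"
    proof cases
      case 1 then have "x = a" using inj x old[OF a] unfolding inj_on_def by blast
      then show ?thesis by simp
    next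
      case 2 then have "x = (q, g v \<noteq> v, e)" using inj x mem unfolding inj_on_def by blast
      then show ?thesis by simp
    next
      case 3
      then have "spot b' x \<in> U" using pp(3) by (rule subsetD[rotated])
      then have "x \<notin> N" using N_notU[of x] by (cases "x \<in> N") simp_all
      then have xs: "x \<in> sites q ty" using x(1) by (simp add: split)
      then have "x \<in> fst ` set xs \<union> snd ` set xs" using C 3 spot_old[OF xs] unfolding coded_def by simp
      then show ?thesis by auto
    qed
  qed
  show "coded (Suc q) ((a, (q, g v \<noteq> v, e)) # xs) b' ty' c' (enlarge U v (\<not> snd u))"
    unfolding coded_def
    using c' card_enlarge[OF pp(2)] endsU base inj img pairs complete by (intro conjI) simp_all
qed

end

lemma return_weight_nonneg: "0 \<le> \<beta> \<Longrightarrow> 0 \<le> \<mu> \<Longrightarrow> 0 \<le> return_weight \<beta> \<mu> T"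
  by (induction T) auto

lemma partial_perm_card_less:
  assumes c: "partial_perm n c" and u: "fst u \<in> {1..n}" "u \<notin> ends c"
  shows "card c < n"
proof -
  define A where "A = (if snd u then snd ` c else fst ` c)"
  have "card A = card c" using c unfolding A_def partial_perm_def by (auto simp: card_image)
  moreover have "A \<subseteq> {1..n} - {fst u}"
    using c u unfolding A_def partial_perm_def ends_def by (cases u) auto
  then have "card A \<le> card ({1..n} - {fst u})" by (intro card_mono) auto
  moreover have "card ({1..n} - {fst u}) < n" using u(1) by (subst card_Diff_singleton) auto
  ultimately show ?thesis by linarith
qed

lemma agrees_insert_link:
  assumes p: "p permutes {1..n}"
  shows "agrees (insert (link u v) c) p \<longleftrightarrow> agrees c p \<and> cross p u = (v, \<not> snd u)"
  using permutes_inv_eq[OF p] unfolding agrees_def link_def cross_def by auto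

context rotation
begin

lemma spot_in:
  assumes "coded q xs b ty c U" "a \<in> sites q ty"
  shows "fst (spot b a) \<in> {1..n}"
  using assms pow_in unfolding coded_def sites_def spot_def by auto

lemma card_clean_ge:
  assumes U: "finite U" "card U \<le> B"
  shows "card {x \<in> {1..n}. (g x \<noteq> x) = r} \<le> real (card {v \<in> clean U s. (g v \<noteq> v) = r}) + m * B"
proof -
  let ?V = "{v \<in> clean U s. (g v \<noteq> v) = r}"
  have "{x \<in> {1..n}. (g x \<noteq> x) = r} \<subseteq> ?V \<union> ({1..n} - clean U s)" by auto
  moreover have "finite ?V" unfolding clean_def by auto
  ultimately have "card {x \<in> {1..n}. (g x \<noteq> x) = r} \<le> card (?V \<union> ({1..n} - clean U s))"
    by (intro card_mono) auto
  also have "\<dots> \<le> card ?V + card ({1..n} - clean U s)" by (rule card_Un_le)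
  also have "\<dots> \<le> card ?V + m * card U" using card_not_clean[OF U(1)] by simp
  also have "\<dots> \<le> card ?V + m * B" using U(2) by simp
  finally show ?thesis by (simp flip: of_nat_mult of_nat_add)
qed

lemma sum_ge_of_card:
  fixes \<gamma> x :: real
  assumes "n * \<gamma> \<le> card V" "0 \<le> x" "\<And>v. v \<in> V \<Longrightarrow> x \<le> F v"
  shows "n * \<gamma> * x \<le> (\<Sum>v\<in>V. F v)"
proof -
  have "n * \<gamma> * x \<le> card V * x" using assms(1,2) by (rule mult_right_mono)
  also have "\<dots> = (\<Sum>v\<in>V. x)" by simp
  also have "\<dots> \<le> (\<Sum>v\<in>V. F v)" using assms(3) by (rule sum_mono)
  finally show ?thesis .
qed

text \<open>
  A lower bound for the probability that a random permutation extends \<open>c\<close> and leads the walk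
  back home. At a \<open>Reveal\<close> node the event is split according to the value \<open>v\<close> at the new
  point. Each clean \<open>v\<close> contributes at least the uniform probability of the enlarged partial
  permutation times the weight of a subtree, and among the clean points at least \<open>n * \<beta>\<close> are
  fixed and at least \<open>n * \<mu>\<close> are moved. The bound \<open>B\<close> allows for all points that may ever have
  to be avoided.
\<close>
lemma explore_sound:
  fixes w :: "(nat \<Rightarrow> nat) \<Rightarrow> real" and B :: nat and \<beta> \<mu> \<epsilon> :: real
  assumes nu: "near_uniform n t \<epsilon> w" and eps: "\<epsilon> \<le> 1"
    and \<beta>: "0 \<le> \<beta>" "n * \<beta> + m * B \<le> card {x \<in> {1..n}. g x = x}"
    and \<mu>: "0 \<le> \<mu>" "n * \<mu> + m * B \<le> card (moved n g)"
  shows "coded q xs b ty c U \<Longrightarrow> a \<in> sites q ty \<Longrightarrow> home \<in> sites q ty \<Longrightarrow>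
    card c + f + d \<le> t \<Longrightarrow> card U + m * (f + d) \<le> B \<Longrightarrow>
    (1 - \<epsilon>) / falling n (card c) * return_weight \<beta> \<mu> (explore m cyc e home f d es q xs a)
      \<le> mass n w (\<lambda>p. agrees c p \<and> returns g p (spot b home) es (spot b a))"
proof (induction es arbitrary: q xs b ty c U a f d)
  case Nil
  have "\<And>p. 0 \<le> w p" using nu unfolding near_uniform_def by auto
  then show ?case using mass_nonneg by simp
next
  case (Cons z es)
  obtain s chk where z: "z = (s, chk)" by (cases z)
  have w: "\<And>p. 0 \<le> w p" using nu unfolding near_uniform_def by auto
  note C = Cons.prems(1) and a = Cons.prems(2) and home = Cons.prems(3)
  have pp: "partial_perm n c" "finite U" using C unfolding coded_def by auto
  show ?case
  proof (cases "advance m cyc s a")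
    case None
    then show ?thesis using mass_nonneg[OF w] z by simp
  next
    case (Some a')
    note adv = advance_correct[OF C a Some]
    show ?thesis
    proof (cases "partner xs (fst a') (snd (snd a'))")
      case (Some x)
      note J = coded_joined[OF C adv(1) Some]
      have ret: "returns g p (spot b home) ((s, chk) # es) (spot b a) \<longleftrightarrow>
          (chk \<and> spot b x = spot b home) \<or> returns g p (spot b home) es (spot b x)"
        if "p permutes {1..n}" "agrees c p" for p
        using joined_cross[OF J(2) that(2,1)] adv(2) by simp
      show ?thesis
      proof (cases "chk \<and> x = home")
        case True
        have "(1 - \<epsilon>) / falling n (card c) \<le> mass n w (agrees c)"
          using nu pp(1) Cons.prems(4) unfolding near_uniform_def by auto
        also have "\<dots> \<le> mass n w (\<lambda>p. agrees c p \<and> returns g p (spot b home) (z # es) (spot b a))"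
          using True ret z by (intro mass_mono w) auto
        finally show ?thesis using True \<open>advance m cyc s a = Some a'\<close> Some z by simp
      next
        case False
        have "(1 - \<epsilon>) / falling n (card c) * return_weight \<beta> \<mu> (explore m cyc e home f d es q xs x)
            \<le> mass n w (\<lambda>p. agrees c p \<and> returns g p (spot b home) es (spot b x))"
          using Cons.IH[OF C J(1) home Cons.prems(4,5)] .
        also have "\<dots> \<le> mass n w (\<lambda>p. agrees c p \<and> returns g p (spot b home) (z # es) (spot b a))"
          using ret z by (intro mass_mono w) auto
        moreover have "explore m cyc e home f d (z # es) q xs a = explore m cyc e home f d es q xs x"
          using False \<open>advance m cyc s a = Some a'\<close> Some z by auto
        ultimately show ?thesis by simp
      qed
    next
      case None
      let ?u = "spot b a'"
      let ?x = "\<lambda>r. (q, r, e)"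
      define Tf where "Tf = (case f of 0 \<Rightarrow> Lost | Suc f' \<Rightarrow>
        explore m cyc e home f' d es (Suc q) ((a', ?x False) # xs) (?x False))"
      define Tm where "Tm = (case d of 0 \<Rightarrow> Lost | Suc d' \<Rightarrow>
        explore m cyc e home f d' es (Suc q) ((a', ?x True) # xs) (?x True))"
      define K where "K = (1 - \<epsilon>) / falling n (Suc (card c))"
      define Q where "Q = (\<lambda>v p. agrees (insert (link ?u v) c) p \<and>
        returns g p (spot b home) es (v, \<not> snd ?u))"
      define V where "V = (\<lambda>r. {v \<in> clean U (\<not> snd ?u). (g v \<noteq> v) = r})"
      have tree: "explore m cyc e home f d (z # es) q xs a = Reveal Tf Tm"
        using \<open>advance m cyc s a = Some a'\<close> None z unfolding Tf_def Tm_def by simp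
      note new = coded_unjoined[OF C adv(1) None]
      have u: "fst ?u \<in> {1..n}" using spot_in[OF C adv(1)] .
      have less: "card c < n" using partial_perm_card_less[OF pp(1) u new] .
      then have fpos: "0 < falling n (card c)" "0 < falling n (Suc (card c))"
        by (auto intro: falling_pos)
      have K: "0 \<le> K" using eps fpos unfolding K_def by simp
      have Kn: "(1 - \<epsilon>) / falling n (card c) \<le> n * K"
      proof -
        have "(1 - \<epsilon>) / falling n (card c) = (real n - card c) * K"
          using less unfolding K_def falling_Suc by simp
        also have "\<dots> \<le> n * K" using K by (intro mult_right_mono) auto
        finally show ?thesis .
      qed
      have branch: "K * return_weight \<beta> \<mu> (if r then Tm else Tf) \<le> mass n w (Q v)" if v: "v \<in> V r" for v r
      proof -
        have vc: "v \<in> clean U (\<not> snd ?u)" and r: "(g v \<noteq> v) = r" using v unfolding V_def by auto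
        define b' where "b' = b(q := (origin v, \<not> snd ?u))"
        define ty' where "ty' = ty(q := g v \<noteq> v)"
        define c' where "c' = insert (link ?u v) c"
        note X = coded_extend[OF C adv(1) new vc, folded b'_def ty'_def c'_def, unfolded r]
        have sp: "spot b' (?x r) = (v, \<not> snd ?u)"
          using origin_pow[of v] unfolding b'_def spot_def by simp
        have home': "spot b' home = spot b home" "home \<in> sites (Suc q) ty'"
          using X(4,5) home by auto
        have U': "card (enlarge U v (\<not> snd ?u)) \<le> card U + m" using card_enlarge[OF pp(2)] by auto
        have IH: "K * return_weight \<beta> \<mu> (explore m cyc e home f' d' es (Suc q) ((a', ?x r) # xs) (?x r))
            \<le> mass n w (Q v)"
          if "Suc (f' + d') = f + d" for f' d'
        proof -
          have b1: "card c' + f' + d' \<le> t" using Cons.prems(4) that X(2) by simp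
          have "m * Suc (f' + d') = m * (f + d)" using that by simp
          then have b2: "card (enlarge U v (\<not> snd ?u)) + m * (f' + d') \<le> B"
            using Cons.prems(5) U' by simp
          show ?thesis
            using Cons.IH[OF X(1) X(3) home'(2) b1 b2] unfolding sp home'(1) X(2) unfolding K_def Q_def c'_def .
        qed
        have zero: "K * return_weight \<beta> \<mu> Lost \<le> mass n w (Q v)" using mass_nonneg[OF w] by simp
        show ?thesis
        proof (cases r)
          case True
          then show ?thesis using IH zero unfolding Tm_def by (cases d) auto
        next
          case False
          then show ?thesis using IH zero unfolding Tf_def by (cases f) auto
        qed
      qed
      have sumV: "n * \<gamma> * (K * return_weight \<beta> \<mu> (if r then Tm else Tf)) \<le> (\<Sum>v\<in>V r. mass n w (Q v))"
        if "n * \<gamma> + m * B \<le> card {x \<in> {1..n}. (g x \<noteq> x) = r}" for \<gamma> :: real and r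
      proof (rule sum_ge_of_card[OF _ _ branch])
        show "n * \<gamma> \<le> card (V r)"
          using card_clean_ge[OF pp(2), of B r "\<not> snd ?u"] that Cons.prems(5) unfolding V_def by simp
      qed (use K return_weight_nonneg[OF \<beta>(1) \<mu>(1)] in auto)
      have finV: "finite (V r)" for r unfolding V_def clean_def by auto
      have "(1 - \<epsilon>) / falling n (card c) * return_weight \<beta> \<mu> (Reveal Tf Tm)
          \<le> n * K * return_weight \<beta> \<mu> (Reveal Tf Tm)"
        using Kn return_weight_nonneg[OF \<beta>(1) \<mu>(1)] by (intro mult_right_mono)
      also have "\<dots> = n * \<beta> * (K * return_weight \<beta> \<mu> (if False then Tm else Tf))
          + n * \<mu> * (K * return_weight \<beta> \<mu> (if True then Tm else Tf))"
        by (simp add: algebra_simps)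
      also have "\<dots> \<le> (\<Sum>v\<in>V False. mass n w (Q v)) + (\<Sum>v\<in>V True. mass n w (Q v))"
        using \<beta>(2) \<mu>(2) by (intro add_mono sumV) auto
      also have "\<dots> = (\<Sum>v\<in>V False \<union> V True. mass n w (Q v))"
        by (rule sum.union_disjoint[OF finV finV, symmetric]) (auto simp: V_def)
      also have "\<dots> \<le> mass n w (\<lambda>p. agrees c p \<and> returns g p (spot b home) (z # es) (spot b a))"
      proof (rule mass_disjoint_sum[where f = "\<lambda>p. fst (cross p ?u)"])
        fix v p assume p: "p permutes {1..n}" "Q v p"
        then have "agrees c p" "cross p ?u = (v, \<not> snd ?u)"
          using agrees_insert_link[OF p(1)] unfolding Q_def by auto
        then show "(agrees c p \<and> returns g p (spot b home) (z # es) (spot b a)) \<and> fst (cross p ?u) = v"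
          using p(2) adv(2) z unfolding Q_def by auto
      qed (use finV w in auto)
      finally show ?thesis unfolding tree .
    qed
  qed
qed

lemma start_coded:
  assumes c: "partial_perm n c" and v: "v \<in> clean (ends c) False"
  shows "coded 1 [] (\<lambda>_. (origin v, False)) (\<lambda>_. g v \<noteq> v) c (enlarge (ends c) v False)"
    "(0, g v \<noteq> v, e) \<in> sites 1 (\<lambda>_. g v \<noteq> v)"
    "spot (\<lambda>_. (origin v, False)) (0, g v \<noteq> v, e) = (v, False)"
proof -
  let ?b = "\<lambda>_::nat. (origin v, False)" and ?ty = "\<lambda>_::nat. g v \<noteq> v"
  have v_in: "v \<in> {1..n}" and far: "\<And>k. k < m \<Longrightarrow> ((g ^^ k) (origin v), False) \<notin> ends c"
    using v unfolding clean_def by auto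
  have fin: "finite (ends c)" using partial_perm_finite[OF c] unfolding ends_def by auto
  have S: "\<exists>k<m. a = (0, g v \<noteq> v, k)" if "a \<in> sites 1 ?ty" for a
    using that e unfolding sites_def by (auto split: if_splits)
  have sp: "spot ?b (0, t, k) = ((g ^^ k) (origin v), False)" for t k unfolding spot_def by simp
  have "inj_on (spot ?b) (sites 1 ?ty)"
  proof (cases "g v = v")
    case True then show ?thesis unfolding inj_on_def sites_def by auto
  next
    case False
    then have "inj_on (\<lambda>k. (g ^^ k) (origin v)) {..<m}" using inj_cycle origin_fixed_iff by auto
    then show ?thesis using False unfolding inj_on_def sites_def spot_def by auto
  qed
  moreover have "spot ?b ` sites 1 ?ty \<subseteq> enlarge (ends c) v False"
  proof (rule image_subsetI)
    fix a assume "a \<in> sites 1 ?ty"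
    then obtain k where "k < m" "a = (0, g v \<noteq> v, k)" using S by blast
    then show "spot ?b a \<in> enlarge (ends c) v False" by (auto simp: sp enlarge_def)
  qed
  moreover have "\<forall>a\<in>sites 1 ?ty. spot ?b a \<notin> ends c"
  proof
    fix a assume "a \<in> sites 1 ?ty"
    then obtain k where "k < m" "a = (0, g v \<noteq> v, k)" using S by blast
    then show "spot ?b a \<notin> ends c" using far[of k] by (simp only: sp not_False_eq_True)
  qed
  moreover have "ends c \<subseteq> enlarge (ends c) v False" unfolding enlarge_def by auto
  ultimately show "coded 1 [] ?b ?ty c (enlarge (ends c) v False)"
    unfolding coded_def using c fin card_enlarge[OF fin] origin_in[OF v_in] origin_fixed_iff[of v] by simp
  show "(0, g v \<noteq> v, e) \<in> sites 1 ?ty" using e unfolding sites_def by auto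
  show "spot ?b (0, g v \<noteq> v, e) = (v, False)" using origin_pow unfolding spot_def by simp
qed

lemma card_ends: assumes "finite c" shows "finite (ends c)" "card (ends c) \<le> 2 * card c"
proof -
  show "finite (ends c)" using assms unfolding ends_def by auto
  have "card ((\<lambda>x. (x, False)) ` fst ` c) \<le> card c" "card ((\<lambda>y. (y, True)) ` snd ` c) \<le> card c"
    using assms by (metis card_image_le finite_imageI image_image)+
  then show "card (ends c) \<le> 2 * card c"
    unfolding ends_def using card_Un_le[of "(\<lambda>x. (x, False)) ` fst ` c" "(\<lambda>y. (y, True)) ` snd ` c"] by simp
qed

text \<open>
  Summed over all starting points, this bounds the expected number of points that return, on
  the event that \<open>p\<close> extends \<open>c\<close>.
\<close>
lemma outcome_tree_sound:
  fixes w :: "(nat \<Rightarrow> nat) \<Rightarrow> real" and B :: nat and \<beta> \<mu> \<epsilon> :: real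
  assumes nu: "near_uniform n t \<epsilon> w" and eps: "\<epsilon> \<le> 1"
    and \<beta>: "0 \<le> \<beta>" "n * \<beta> + m * B \<le> card {x \<in> {1..n}. g x = x}"
    and \<mu>: "0 \<le> \<mu>" "n * \<mu> + m * B \<le> card (moved n g)"
    and c: "partial_perm n c" "card c + f + d \<le> t" "2 * card c + m * Suc (f + d) \<le> B"
  shows "n * ((1 - \<epsilon>) / falling n (card c) * return_weight \<beta> \<mu> (outcome_tree m cyc e f d es))
    \<le> (\<Sum>v\<in>{1..n}. mass n w (\<lambda>p. agrees c p \<and> returns g p (v, False) es (v, False)))"
proof -
  define K where "K = (1 - \<epsilon>) / falling n (card c)"
  define T where "T = (\<lambda>r. explore m cyc e (0, r, e)
    (if r then f else f - 1) (if r then d - 1 else d) es 1 [] (0, r, e))"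
  define V where "V = (\<lambda>r. {v \<in> clean (ends c) False. (g v \<noteq> v) = r})"
  define Q where "Q = (\<lambda>v p. agrees c p \<and> returns g p (v, False) es (v, False))"
  have w: "\<And>p. 0 \<le> w p" using nu unfolding near_uniform_def by auto
  have K: "0 \<le> K" using eps falling_pos[OF partial_perm_card[OF c(1)]] unfolding K_def by simp
  have fin: "finite c" using partial_perm_finite[OF c(1)] .
  have finV: "finite (V r)" "V r \<subseteq> {1..n}" for r unfolding V_def clean_def by auto
  have branch: "K * return_weight \<beta> \<mu> (T r) \<le> mass n w (Q v)" if v: "v \<in> V r" for v r
  proof -
    have vc: "v \<in> clean (ends c) False" and r: "(g v \<noteq> v) = r" using v unfolding V_def by auto
    note S = start_coded[OF c(1) vc, unfolded r]
    have "card (enlarge (ends c) v False) \<le> 2 * card c + m"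
      using card_enlarge[OF card_ends(1)[OF fin]] card_ends(2)[OF fin] by (meson add_le_mono1 order_trans)
    moreover define k where "k = (if r then f else f - 1) + (if r then d - 1 else d)"
    then have "m * k \<le> m * (f + d)" by (intro mult_le_mono2) auto
    ultimately have "card (enlarge (ends c) v False) + m * k \<le> B" using c(3) by (simp add: algebra_simps)
    note bU = this[unfolded k_def]
    have bt: "card c + (if r then f else f - 1) + (if r then d - 1 else d) \<le> t" using c(2) by auto
    from explore_sound[OF nu eps \<beta> \<mu> S(1,2) S(2) bt bU]
    show ?thesis unfolding S(3) K_def T_def Q_def .
  qed
  have sumV: "n * \<gamma> * (K * return_weight \<beta> \<mu> (T r)) \<le> (\<Sum>v\<in>V r. mass n w (Q v))"
    if "n * \<gamma> + m * B \<le> card {x \<in> {1..n}. (g x \<noteq> x) = r}" for \<gamma> :: real and r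
  proof (rule sum_ge_of_card[OF _ _ branch])
    show "n * \<gamma> \<le> card (V r)"
      using card_clean_ge[OF card_ends(1)[OF fin], of B r False] that c(3) card_ends(2)[OF fin]
      unfolding V_def by simp
  qed (use K return_weight_nonneg[OF \<beta>(1) \<mu>(1)] in auto)
  have "n * (K * return_weight \<beta> \<mu> (outcome_tree m cyc e f d es)) = n * \<beta> * (K * return_weight \<beta> \<mu> (T False)) + n * \<mu> * (K * return_weight \<beta> \<mu> (T True))"
    unfolding outcome_tree_def T_def by (simp add: algebra_simps)
  also have "\<dots> \<le> (\<Sum>v\<in>V False. mass n w (Q v)) + (\<Sum>v\<in>V True. mass n w (Q v))"
    using \<beta>(2) \<mu>(2) by (intro add_mono sumV) auto
  also have "\<dots> = (\<Sum>v\<in>V False \<union> V True. mass n w (Q v))"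
    by (rule sum.union_disjoint[OF finV(1) finV(1), symmetric]) (auto simp: V_def)
  also have "\<dots> \<le> (\<Sum>v\<in>{1..n}. mass n w (Q v))"
    using finV w by (intro sum_mono2) (auto intro: mass_nonneg)
  finally show ?thesis unfolding K_def Q_def .
qed

end

section \<open>The probability of a short orbit\<close>

text \<open>
  A polynomial in \<open>\<beta>\<close> and \<open>\<mu>\<close> with natural coefficients, as a list of monomials: the triple
  \<open>(i, j, k)\<close> stands for \<open>k * \<beta> ^ i * \<mu> ^ j\<close>. The census of a tree collects the paths to
  leaves \<open>Back\<close> by the numbers of fixed and moved points on them; this makes the weight of a
  tree with very many leaves computable.
\<close>
fun bump :: "nat \<Rightarrow> nat \<Rightarrow> (nat \<times> nat \<times> nat) list \<Rightarrow> (nat \<times> nat \<times> nat) list" where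
  "bump i j [] = [(i, j, 1)]"
| "bump i j ((i', j', k) # xs) = (if i = i' \<and> j = j' then (i', j', Suc k) # xs else (i', j', k) # bump i j xs)"

fun census :: "tree \<Rightarrow> nat \<Rightarrow> nat \<Rightarrow> (nat \<times> nat \<times> nat) list \<Rightarrow> (nat \<times> nat \<times> nat) list" where
  "census Lost i j xs = xs"
| "census Back i j xs = bump i j xs"
| "census (Reveal f g) i j xs = census g i (Suc j) (census f (Suc i) j xs)"

definition tally :: "real \<Rightarrow> real \<Rightarrow> (nat \<times> nat \<times> nat) list \<Rightarrow> real" where
  "tally \<beta> \<mu> xs = (\<Sum>(i, j, k)\<leftarrow>xs. real k * \<beta> ^ i * \<mu> ^ j)"

lemma tally_bump: "tally \<beta> \<mu> (bump i j xs) = \<beta> ^ i * \<mu> ^ j + tally \<beta> \<mu> xs"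
  by (induction i j xs rule: bump.induct) (auto simp: tally_def algebra_simps)

lemma tally_census: "tally \<beta> \<mu> (census T i j xs) = \<beta> ^ i * \<mu> ^ j * return_weight \<beta> \<mu> T + tally \<beta> \<mu> xs"
  by (induction T arbitrary: i j xs) (auto simp: tally_bump algebra_simps)

lemma return_weight_census: "return_weight \<beta> \<mu> T = tally \<beta> \<mu> (census T 0 0 [])"
  by (simp add: tally_census) (simp add: tally_def)

text \<open>
  One lap is the word \<open>h\<inverse> g h g\<inverse> h\<inverse> g\<inverse> h g\<close>, read from right to left, where \<open>h\<close> is the
  conjugate of \<open>g\<close> by \<open>p\<close>. Odd steps apply \<open>g\<close>, even ones \<open>h\<close>, and only at the end of a lap
  does a return to the start count.
\<close>
definition lap :: "(bool \<times> bool) list" where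
  "lap = [(True, False), (True, False), (False, False), (False, False),
          (False, False), (True, False), (True, False), (False, True)]"

lemma tally_mono:
  assumes "0 \<le> \<beta>" "\<beta> \<le> \<beta>'" "0 \<le> \<mu>" "\<mu> \<le> \<mu>'"
  shows "tally \<beta> \<mu> xs \<le> tally \<beta>' \<mu>' xs"
  unfolding tally_def using assms
  by (induction xs) (auto intro!: add_mono mult_mono power_mono mult_nonneg_nonneg)

lemma power_minus_ge:
  fixes \<eta> x :: real
  assumes "0 \<le> \<eta>" "\<eta> \<le> x" "x \<le> 1"
  shows "x ^ i - i * \<eta> \<le> (x - \<eta>) ^ i"
proof (induction i)
  case (Suc i)
  have "x ^ Suc i - Suc i * \<eta> \<le> x * (x ^ i - i * \<eta>) - \<eta> * x ^ i + (\<eta> * x ^ i - \<eta>) + i * \<eta> * (x - 1)"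
    by (simp add: algebra_simps)
  also have "\<dots> \<le> x * (x ^ i - i * \<eta>) - \<eta> * x ^ i"
  proof -
    have "\<eta> * x ^ i \<le> \<eta> * 1" using assms by (intro mult_left_mono power_le_one) auto
    moreover have "i * \<eta> * (x - 1) \<le> 0" using assms by (intro mult_nonneg_nonpos) auto
    ultimately show ?thesis by simp
  qed
  also have "\<dots> \<le> x * (x - \<eta>) ^ i - \<eta> * (x - \<eta>) ^ i"
    using assms Suc by (intro diff_mono mult_left_mono power_mono) auto
  also have "\<dots> = (x - \<eta>) ^ Suc i" by (simp add: algebra_simps)
  finally show ?case .
qed simp

lemma monomial_minus_ge:
  fixes \<eta> x y :: real
  assumes "0 \<le> \<eta>" "\<eta> \<le> x" "x \<le> 1" "\<eta> \<le> y" "y \<le> 1"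
  shows "x ^ i * y ^ j - (i + j) * \<eta> \<le> (x - \<eta>) ^ i * (y - \<eta>) ^ j"
proof -
  have "(x - \<eta>) ^ i \<le> 1" "0 \<le> (x - \<eta>) ^ i" "y ^ j \<le> 1" "0 \<le> y ^ j"
    using assms by (auto intro: power_le_one)
  then have "(x ^ i - (x - \<eta>) ^ i) * y ^ j \<le> (i * \<eta>) * 1"
    using power_minus_ge[OF assms(1-3), of i] assms(1) by (intro mult_mono) auto
  moreover have "(x - \<eta>) ^ i * (y ^ j - (y - \<eta>) ^ j) \<le> 1 * (j * \<eta>)"
    using power_minus_ge[OF assms(1,4,5), of j] assms \<open>(x - \<eta>) ^ i \<le> 1\<close>
    by (intro mult_mono) (auto intro: power_mono)
  ultimately show ?thesis by (simp add: algebra_simps)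
qed

text \<open>
  The weights \<open>\<beta>\<close> and \<open>\<mu>\<close> fall short of \<open>1 - a\<close> and \<open>a\<close> by \<open>\<eta> = O(1/n)\<close>. The loss is at most
  \<open>\<eta>\<close> times the sum of the degrees of the paths.
\<close>
lemma tally_minus_ge:
  assumes "0 \<le> \<eta>" "\<eta> \<le> \<beta>" "\<beta> \<le> 1" "\<eta> \<le> \<mu>" "\<mu> \<le> 1"
  shows "tally \<beta> \<mu> xs - \<eta> * (\<Sum>(i, j, k)\<leftarrow>xs. real (k * (i + j))) \<le> tally (\<beta> - \<eta>) (\<mu> - \<eta>) xs"
proof (induction xs)
  case (Cons a xs)
  obtain i j k where a: "a = (i, j, k)" by (cases a)
  have "real k * (\<beta> ^ i * \<mu> ^ j - (i + j) * \<eta>) \<le> real k * ((\<beta> - \<eta>) ^ i * (\<mu> - \<eta>) ^ j)"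
    using monomial_minus_ge[OF assms] by (intro mult_left_mono) auto
  then show ?case using Cons unfolding a tally_def by (simp add: algebra_simps)
qed (simp add: tally_def)

text \<open>
  On an interval between \<open>l\<close> and \<open>r\<close> the polynomial at \<open>(1 - a, a)\<close> is at least its value at
  \<open>(1 - r, l)\<close>, by monotonicity in each variable, so one evaluation proves
  \<open>1 - a + 1 / 2000 \<le> tally (1 - a) a xs\<close> there. The points are given in decreasing order in
  units of \<open>1 / 10000\<close>, and the inequality is multiplied by \<open>2000 * 10000 ^ 14\<close> to become one
  between integers; 14 is the greatest degree that occurs.
\<close>
fun covers :: "(nat \<times> nat \<times> nat) list \<Rightarrow> int list \<Rightarrow> bool" where
  "covers xs (r # l # ps) \<longleftrightarrow> 0 \<le> l \<and> r \<le> 10000 \<and>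
     2000 * (10000 - l) * 10000 ^ 13 + 10000 ^ 14 \<le>
       2000 * (\<Sum>(i, j, k)\<leftarrow>xs. int k * (10000 - r) ^ i * l ^ j * 10000 ^ (14 - (i + j))) \<and>
     covers xs (l # ps)"
| "covers xs ps \<longleftrightarrow> True"

lemma tally_scaled:
  assumes "\<forall>(i, j, k)\<in>set xs. i + j \<le> 14"
  shows "tally (1 - real_of_int r / 10000) (real_of_int l / 10000) xs * 10000 ^ 14
    = (\<Sum>(i, j, k)\<leftarrow>xs. int k * (10000 - r) ^ i * l ^ j * 10000 ^ (14 - (i + j)))"
  using assms
proof (induction xs)
  case (Cons a xs)
  obtain i j k where a: "a = (i, j, k)" by (cases a)
  then have "(14::nat) = i + (j + (14 - (i + j)))" using Cons.prems by auto
  then have N: "(10000::real) ^ 14 = 10000 ^ i * (10000 ^ j * 10000 ^ (14 - (i + j)))"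
    by (metis power_add)
  have r: "(1 - real_of_int r / 10000) ^ i * 10000 ^ i = real_of_int ((10000 - r) ^ i)"
    by (simp add: left_diff_distrib flip: power_mult_distrib)
  have l: "(real_of_int l / 10000) ^ j * 10000 ^ j = real_of_int (l ^ j)"
    by (simp flip: power_mult_distrib)
  have "real k * (1 - real_of_int r / 10000) ^ i * (real_of_int l / 10000) ^ j * 10000 ^ 14
      = real k * ((1 - real_of_int r / 10000) ^ i * 10000 ^ i)
          * ((real_of_int l / 10000) ^ j * 10000 ^ j) * 10000 ^ (14 - (i + j))"
    unfolding N by (simp only: mult_ac)
  also have "\<dots> = real_of_int (int k * (10000 - r) ^ i * l ^ j * 10000 ^ (14 - (i + j)))"
    unfolding r l by simp
  finally have "real k * (1 - real_of_int r / 10000) ^ i * (real_of_int l / 10000) ^ j * 10000 ^ 14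
      = real_of_int (int k * (10000 - r) ^ i * l ^ j * 10000 ^ (14 - (i + j)))" .
  then show ?case using Cons unfolding a tally_def by (simp add: distrib_right)
qed (simp add: tally_def)

lemma covers_imp:
  assumes "covers xs ps" "\<forall>(i, j, k)\<in>set xs. i + j \<le> 14" "ps \<noteq> []"
    "last ps \<le> 10000 * a" "10000 * a \<le> hd ps" "last ps < hd ps"
  shows "1 - a + 1 / 2000 \<le> tally (1 - a) a xs"
  using assms
proof (induction xs ps rule: covers.induct)
  case (1 xs r l ps)
  show ?case
  proof (cases "l \<le> 10000 * a")
    case True
    have "real_of_int (2000 * (10000 - l) * 10000 ^ 13 + 10000 ^ 14)
        \<le> real_of_int (2000 * (\<Sum>(i, j, k)\<leftarrow>xs. int k * (10000 - r) ^ i * l ^ j * 10000 ^ (14 - (i + j))))"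
      using 1(2) by (subst of_int_le_iff) simp
    then have "(1 - l / 10000 + 1 / 2000) * (2000 * 10000 ^ 14)
        \<le> tally (1 - real_of_int r / 10000) (real_of_int l / 10000) xs * (2000 * 10000 ^ 14)"
      using tally_scaled[OF 1(3), of r l] by (simp add: algebra_simps)
    then have *: "1 - l / 10000 + 1 / 2000 \<le> tally (1 - real_of_int r / 10000) (real_of_int l / 10000) xs"
      by (rule mult_right_le_imp_le) simp
    have "1 - a + 1 / 2000 \<le> 1 - l / 10000 + 1 / 2000" using True by simp
    also note *
    also have "tally (1 - real_of_int r / 10000) (real_of_int l / 10000) xs \<le> tally (1 - a) a xs"
      using 1 True by (intro tally_mono) auto
    finally show ?thesis .
  next
    case False
    then show ?thesis using 1 by (auto split: if_splits)
  qed
qed auto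

text \<open>
  Almost as wide steps as \<open>covers\<close> permits. They are short near \<open>63/100\<close>, where the inequality
  is tight.
\<close>
definition grid :: "int list" where
  "grid = [6300, 6295, 6288, 6279, 6266, 6248, 6223, 6189, 6142, 6077,
     5988, 5866, 5701, 5479, 5188, 4823, 4375, 3845, 3249, 3000]"

abbreviation "table_2 \<equiv> [(2, 0, 1), (2, 1, 2), (2, 3, 4)]"
abbreviation "table_3 \<equiv> [(2, 0, 1), (2, 1, 1), (4, 2, 4), (5, 3, 3), (4, 7, 15), (2, 3, 2), (5, 6, 6), (4, 6, 6), (3, 1, 1)]"
abbreviation "table_5 \<equiv> [(2, 0, 1), (2, 1, 1), (4, 2, 4), (8, 5, 20), (7, 5, 26), (8, 6, 40), (6, 6, 16),
   (5, 3, 3), (7, 7, 20), (6, 7, 8), (2, 3, 2), (5, 6, 6), (4, 7, 3), (3, 1, 1)]"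

lemma grid_covers: "covers table_2 grid" "covers table_3 grid" "covers table_5 grid"
  by code_simp+

lemma grid_bound:
  assumes "xs \<in> {table_2, table_3, table_5}" "3 / 10 \<le> a" "a \<le> 63 / 100"
  shows "1 - a + 1 / 2000 \<le> tally (1 - a) a xs"
proof (rule covers_imp[where ps = grid])
  show "covers xs grid" using grid_covers assms(1) by auto
qed (use assms in \<open>auto simp: grid_def\<close>)

text \<open>
  The budgets and the number of laps only have to be large enough for \<open>grid_bound\<close>; a single
  lap does it for order 2, three laps for order 3. Without short cycles the window has seven
  positions and is entered in the middle. This gives the same polynomial as order 5.
\<close>
lemma census_2: "census (outcome_tree 2 True 0 3 4 lap) 0 0 [] = table_2"
  by code_simp

lemma census_3: "census (outcome_tree 3 True 0 5 7 (concat (replicate 3 lap))) 0 0 [] = table_3"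
  by code_simp

lemma census_5: "census (outcome_tree 5 True 0 8 7 (concat (replicate 5 lap))) 0 0 [] = table_5"
  by code_simp

lemma census_7: "census (outcome_tree 7 False 3 8 7 (concat (replicate 5 lap))) 0 0 [] = table_5"
  by code_simp

section \<open>Large support\<close>

lemma mem_ends: "u \<in> ends c \<longleftrightarrow> (if snd u then fst u \<in> snd ` c else fst u \<in> fst ` c)"
  unfolding ends_def by (cases u; cases "snd u") (simp_all add: image_iff)

lemma sum_mass_eq_card:
  assumes "finite V"
  shows "(\<Sum>v\<in>V. mass n w (\<lambda>p. P p \<and> R v p)) =
    (\<Sum>p | p permutes {1..n} \<and> P p. real (card {v \<in> V. R v p}) * w p)"
proof -
  let ?A = "{p. p permutes {1..n} \<and> P p}"
  have "(\<Sum>v\<in>V. mass n w (\<lambda>p. P p \<and> R v p)) = (\<Sum>v\<in>V. \<Sum>p\<in>?A. if R v p then w p else 0)"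
    unfolding mass_def by (subst sum.inter_filter[OF finite_perms, symmetric]) (simp add: conj_assoc)
  also have "\<dots> = (\<Sum>p\<in>?A. \<Sum>v\<in>V. if R v p then w p else 0)"
    by (rule sum.swap)
  also have "\<dots> = (\<Sum>p\<in>?A. real (card {v \<in> V. R v p}) * w p)"
    using assms by (intro sum.cong refl) (simp add: sum.If_cases Int_def)
  finally show ?thesis .
qed

text \<open>
  Only permutations of positive weight are of interest, as these are the short words.
\<close>
lemma averaging_above:
  fixes Y :: real
  assumes w: "\<And>p. 0 \<le> w p" and V: "finite V"
    and less: "Y * mass n w P < (\<Sum>v\<in>V. mass n w (\<lambda>p. P p \<and> R v p))"
  shows "\<exists>p. p permutes {1..n} \<and> 0 < w p \<and> P p \<and> Y < card {v \<in> V. R v p}"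
proof (rule ccontr)
  assume none: "\<not> ?thesis"
  have le: "real (card {v \<in> V. R v p}) * w p \<le> Y * w p" if "p permutes {1..n}" "P p" for p
  proof (cases "w p = 0")
    case False
    then have "0 < w p" using w[of p] by simp
    with none that have "\<not> Y < card {v \<in> V. R v p}" by blast
    then show ?thesis using w by (intro mult_right_mono) auto
  qed simp
  have "(\<Sum>v\<in>V. mass n w (\<lambda>p. P p \<and> R v p)) \<le> (\<Sum>p | p permutes {1..n} \<and> P p. Y * w p)"
    unfolding sum_mass_eq_card[OF V] using le by (intro sum_mono) auto
  also have "\<dots> = Y * mass n w P" unfolding mass_def by (simp add: sum_distrib_left)
  finally show False using less by simp
qed

lemma averaging_below:
  fixes Y :: real
  assumes w: "\<And>p. 0 \<le> w p" and V: "finite V"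
    and le: "(\<Sum>v\<in>V. mass n w (\<lambda>p. P p \<and> R v p)) \<le> Y * mass n w P" and pos: "0 < mass n w P"
  shows "\<exists>p. p permutes {1..n} \<and> 0 < w p \<and> P p \<and> card {v \<in> V. R v p} \<le> Y"
proof (rule ccontr)
  assume none: "\<not> ?thesis"
  let ?A = "{p. p permutes {1..n} \<and> P p}"
  have gt: "Y * w p \<le> real (card {v \<in> V. R v p}) * w p" "w p = 0 \<or> Y * w p < real (card {v \<in> V. R v p}) * w p"
    if "p permutes {1..n}" "P p" for p
  proof -
    have "w p = 0 \<or> 0 < w p" using w[of p] by auto
    then show "w p = 0 \<or> Y * w p < real (card {v \<in> V. R v p}) * w p" using none that by auto
    then show "Y * w p \<le> real (card {v \<in> V. R v p}) * w p" by auto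
  qed
  have "\<exists>p\<in>?A. w p \<noteq> 0"
  proof (rule ccontr)
    assume "\<not> (\<exists>p\<in>?A. w p \<noteq> 0)"
    then have "mass n w P = 0" unfolding mass_def by (intro sum.neutral) blast
    then show False using pos by simp
  qed
  then have "(\<Sum>p\<in>?A. Y * w p) < (\<Sum>p\<in>?A. real (card {v \<in> V. R v p}) * w p)"
    using gt by (intro sum_strict_mono_ex1 finite_perms) blast+
  moreover have "Y * mass n w P = (\<Sum>p\<in>?A. Y * w p)" unfolding mass_def by (simp add: sum_distrib_left)
  ultimately show False using le unfolding sum_mass_eq_card[OF V] by linarith
qed

definition conj_by :: "(nat \<Rightarrow> nat) \<Rightarrow> (nat \<Rightarrow> nat) \<Rightarrow> nat \<Rightarrow> nat" where
  "conj_by p g = inv' p \<circ> g \<circ> p"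

definition lap_word :: "(nat \<Rightarrow> nat) \<Rightarrow> (nat \<Rightarrow> nat) \<Rightarrow> nat \<Rightarrow> nat" where
  "lap_word g p = conj_by p (inv' g) \<circ> g \<circ> conj_by p g \<circ> inv' g \<circ> conj_by p (inv' g)
     \<circ> inv' g \<circ> conj_by p g \<circ> g"

definition walk :: "(nat \<Rightarrow> nat) \<Rightarrow> (nat \<Rightarrow> nat) \<Rightarrow> (bool \<times> bool) list \<Rightarrow> point \<Rightarrow> point" where
  "walk g p es = fold (\<lambda>(s, chk) u. cross p (push g s u)) es"

lemma walk_lap: "walk g p lap (x, False) = (lap_word g p x, False)"
  unfolding walk_def lap_def by (simp add: cross_def push_def lap_word_def conj_by_def)

lemma walk_laps: "walk g p (concat (replicate k lap)) (x, False) = ((lap_word g p ^^ k) x, False)"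
proof (induction k arbitrary: x)
  case (Suc k)
  then show ?case using walk_lap[of g p x] unfolding walk_def by (simp add: funpow_swap1)
qed (simp add: walk_def)

lemma returns_laps:
  "returns g p (y, False) (concat (replicate k lap)) (x, False) \<Longrightarrow>
    \<exists>i. 1 \<le> i \<and> i \<le> k \<and> (lap_word g p ^^ i) x = y"
proof (induction k arbitrary: x)
  case (Suc k)
  have "returns g p (y, False) (lap @ es) (x, False) \<longleftrightarrow>
      lap_word g p x = y \<or> returns g p (y, False) es (lap_word g p x, False)" for es
    unfolding lap_def by (simp add: cross_def push_def lap_word_def conj_by_def)
  then consider "lap_word g p x = y" | "returns g p (y, False) (concat (replicate k lap)) (lap_word g p x, False)"
    using Suc.prems by auto
  then show ?case
  proof cases
    case 1 then show ?thesis by (intro exI[of _ 1]) simp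
  next
    case 2
    then obtain i where "1 \<le> i" "i \<le> k" "(lap_word g p ^^ i) (lap_word g p x) = y"
      using Suc.IH by blast
    then show ?thesis by (intro exI[of _ "Suc i"]) (simp add: funpow_swap1)
  qed
qed simp

lemma funpow_fixed_dvd:
  assumes "(f ^^ i) x = x" "i dvd k"
  shows "(f ^^ k) x = x"
proof -
  obtain j where "k = i * j" using assms(2) by blast
  moreover have "((f ^^ i) ^^ j) x = x" using assms(1) by (induction j) auto
  ultimately show ?thesis by (simp add: funpow_mult)
qed

lemma returns_imp_fixed:
  assumes "returns g p (x, False) (concat (replicate k lap)) (x, False)" "k \<le> 5"
  shows "(lap_word g p ^^ 60) x = x"
proof -
  obtain i where i: "1 \<le> i" "i \<le> k" "(lap_word g p ^^ i) x = x" using returns_laps[OF assms(1)] by blast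
  then have "i \<in> {1, 2, 3, 4, 5}" using assms(2) by auto
  then have "i dvd 60" by auto
  then show ?thesis by (rule funpow_fixed_dvd[OF i(3)])
qed

text \<open>
  A walk can be kept from returning by prescribing one value of \<open>p\<close> per step: send the current
  point to one moved by \<open>g\<close> which, with its two neighbours on its cycle, has not been touched
  so far. Then the walk never meets a revealed point again, and it ends away from \<open>h\<close>.
\<close>
lemma forced_walk:
  assumes g: "g permutes {1..n}"
  shows "partial_perm n c \<Longrightarrow> finite U \<Longrightarrow> ends c \<subseteq> U \<Longrightarrow> fst u \<in> {1..n} \<Longrightarrow> g (fst u) \<noteq> fst u \<Longrightarrow>
    (\<forall>s. push g s u \<notin> ends c \<and> push g s u \<in> U) \<Longrightarrow> h \<in> U \<Longrightarrow> (es = [] \<Longrightarrow> u \<noteq> h) \<Longrightarrow>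
    3 * (card U + 3 * length es) < card (moved n g) \<Longrightarrow>
    \<exists>c'. partial_perm n c' \<and> c \<subseteq> c' \<and> card c' = card c + length es \<and>
      (\<forall>p. p permutes {1..n} \<and> agrees c' p \<longrightarrow> walk g p es u \<noteq> h)"
proof (induction es arbitrary: c U u)
  case Nil
  then show ?case by (intro exI[of _ c]) (auto simp: walk_def)
next
  case (Cons z es)
  obtain s chk where z: "z = (s, chk)" by (cases z)
  let ?y = "push g s u" and ?D = "moved n g" and ?A = "fst ` U"
  have inv_g: "inv' g (g x) = x" "g (inv' g x) = x" for x using permutes_inverses[OF g] by auto
  have A: "finite ?A" "card ?A \<le> card U" using Cons.prems(2) by (auto intro: card_image_le)
  have "card (?A \<union> g ` ?A \<union> inv' g ` ?A) \<le> card ?A + card (g ` ?A) + card (inv' g ` ?A)"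
    by (meson card_Un_le le_trans add_le_mono1)
  also have "\<dots> \<le> 3 * card U"
    using A card_image_le[OF A(1), of g] card_image_le[OF A(1), of "inv' g"] by linarith
  also have "\<dots> < card ?D" using Cons.prems(9) by simp
  finally have "\<not> ?D \<subseteq> ?A \<union> g ` ?A \<union> inv' g ` ?A"
    using A(1) by (meson card_mono finite_Un finite_imageI leD)
  then obtain v where v: "v \<in> {1..n}" "g v \<noteq> v" "v \<notin> ?A" "v \<notin> g ` ?A" "v \<notin> inv' g ` ?A" by blast
  have far: "v \<notin> ?A" "g v \<notin> ?A" "inv' g v \<notin> ?A"
    using v(3-5) imageI[of "g v" ?A "inv' g"] imageI[of "inv' g v" ?A g] inv_g by auto
  have inv_v: "inv' g v \<noteq> v" using v(2) inv_g by metis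
  let ?s = "\<not> snd u"
  let ?u = "(v, ?s)"
  let ?c = "insert (link ?y v) c"
  let ?U = "insert ?u (insert (g v, ?s) (insert (inv' g v, ?s) U))"
  have snd_y: "snd ?y = snd u" unfolding push_def by simp
  have y_in: "fst ?y \<in> {1..n}"
    using Cons.prems(4) permutes_in_image[OF g] permutes_in_image[OF permutes_inv[OF g]]
    unfolding push_def by auto
  have vU: "(v, t) \<notin> U" "(g v, t) \<notin> U" "(inv' g v, t) \<notin> U" for t using far by force+
  have y_new: "?y \<notin> ends c" "?y \<in> U" using Cons.prems(6) by auto
  have v_new: "(v, t) \<notin> ends c" for t using vU Cons.prems(3) by blast
  have cc: "partial_perm n ?c \<and> card ?c = Suc (card c)"
  proof (cases "snd u")
    case True
    then have "fst ?y \<notin> snd ` c" "v \<notin> fst ` c"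
      using y_new(1) v_new[of "\<not> snd u"] snd_y by (simp_all add: mem_ends)
    then show ?thesis
      using partial_perm_insert[OF Cons.prems(1) v(1) y_in] True snd_y unfolding link_def by simp
  next
    case False
    then have "fst ?y \<notin> fst ` c" "v \<notin> snd ` c"
      using y_new(1) v_new[of "\<not> snd u"] snd_y by (simp_all add: mem_ends)
    then show ?thesis
      using partial_perm_insert[OF Cons.prems(1) y_in v(1)] False snd_y unfolding link_def by simp
  qed
  have ends_c: "ends ?c = insert ?y (insert ?u (ends c))"
    using ends_insert_link[of ?y v c] snd_y by simp
  have push: "push g t ?u \<notin> ends ?c \<and> push g t ?u \<in> ?U" for t
  proof -
    have "push g t ?u \<notin> U" "push g t ?u \<noteq> ?u" using vU v(2) inv_v unfolding push_def by auto
    then show ?thesis using ends_c y_new(2) Cons.prems(3) unfolding push_def by auto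
  qed
  have "card ?U \<le> card U + 3"
    using Cons.prems(2) by (simp add: card_insert_if)
  then have "3 * (card ?U + 3 * length es) < card ?D" using Cons.prems(9) by simp
  moreover have "es = [] \<Longrightarrow> ?u \<noteq> h" using vU Cons.prems(7) by auto
  moreover have "ends ?c \<subseteq> ?U" using ends_c y_new(2) Cons.prems(3) by auto
  ultimately obtain c' where c': "partial_perm n c'" "?c \<subseteq> c'" "card c' = card ?c + length es"
    "\<And>p. p permutes {1..n} \<Longrightarrow> agrees c' p \<Longrightarrow> walk g p es ?u \<noteq> h"
    using Cons.IH[of ?c ?U ?u] cc Cons.prems(2,7) v push by auto
  have "walk g p (z # es) u \<noteq> h" if p: "p permutes {1..n}" "agrees c' p" for p
  proof -
    have "agrees ?c p" using p(2) c'(2) unfolding agrees_def by auto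
    then have "cross p ?y = ?u" using agrees_insert_link[OF p(1)] snd_y by auto
    then show ?thesis using c'(4)[OF p] z unfolding walk_def by simp
  qed
  then show ?case using c' cc by (intro exI[of _ c']) auto
qed

lemma forced_nontrivial:
  assumes g: "g permutes {1..n}" and big: "8 * 60 * 9 + 12 < card (moved n g)"
  shows "\<exists>c. partial_perm n c \<and> card c = 480 \<and>
    (\<forall>p. p permutes {1..n} \<and> agrees c p \<longrightarrow> lap_word g p ^^ 60 \<noteq> id)"
proof -
  let ?es = "concat (replicate 60 lap)"
  have len: "length ?es = 480" by (simp add: length_concat lap_def sum_list_replicate)
  obtain x where x: "x \<in> {1..n}" "g x \<noteq> x" using big by (metis (mono_tags, lifting) Collect_empty_eq card.empty less_nat_zero_code)
  define u where "u = (x, False)"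
  define U where "U = {u, push g True u, push g False u}"
  have U3: "card U \<le> 3" unfolding U_def by (simp add: card_insert_if)
  have "\<exists>c'. partial_perm n c' \<and> {} \<subseteq> c' \<and> card c' = card ({} :: (nat \<times> nat) set) + length ?es \<and>
      (\<forall>p. p permutes {1..n} \<and> agrees c' p \<longrightarrow> walk g p ?es u \<noteq> u)"
  proof (rule forced_walk[OF g])
    show "\<forall>s. push g s u \<notin> ends {} \<and> push g s u \<in> U"
    proof
      fix s show "push g s u \<notin> ends {} \<and> push g s u \<in> U"
        unfolding U_def by (cases s) (auto simp: ends_def)
    qed
    show "?es = [] \<Longrightarrow> u \<noteq> u" using len by (metis length_0_conv zero_neq_numeral)
  qed (use big x len U3 in \<open>auto simp: U_def u_def partial_perm_def ends_def\<close>)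
  then obtain c where c: "partial_perm n c" "card c = 480"
    "\<And>p. p permutes {1..n} \<Longrightarrow> agrees c p \<Longrightarrow> walk g p ?es u \<noteq> u"
    unfolding len by auto
  have "lap_word g p ^^ 60 \<noteq> id" if "p permutes {1..n}" "agrees c p" for p
    using c(3)[OF that] unfolding u_def walk_laps by (metis id_apply)
  then show ?thesis using c(1,2) by blast
qed

lemma card_fixed_plus_moved:
  "card {x \<in> {1..n}. f x = x} + card (moved n f) = n"
proof -
  have "card ({x \<in> {1..n}. f x = x} \<union> moved n f) = card {1..n}"
    by (rule arg_cong[of _ _ card]) auto
  then show ?thesis by (subst (asm) card_Un_disjoint) auto
qed

lemma table_degree: "xs \<in> {table_2, table_3, table_5} \<Longrightarrow> (\<Sum>(i, j, k)\<leftarrow>xs. real (k * (i + j))) \<le> 2000"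
  by auto

text \<open>
  Condition on the values that make the result nontrivial. The expected number of points with
  a short orbit under the lap word is then at least \<open>n\<close> times the weight of the tree, up to
  \<open>O(1/n)\<close>, and so exceeds the number of fixed points of \<open>g\<close> by a positive proportion of \<open>n\<close>.
\<close>
lemma lap_stage:
  assumes rot: "rotation n g m cyc e"
    and table: "census (outcome_tree m cyc e f d (concat (replicate k lap))) 0 0 [] = xs"
      "xs \<in> {table_2, table_3, table_5}"
    and small: "k \<le> 5" "f + d \<le> 15" "m \<le> 7"
    and nu: "near_uniform n 500 \<epsilon> w" and eps: "0 \<le> \<epsilon>" "\<epsilon> \<le> 1 / 10 ^ 5"
    and n: "10 ^ 12 \<le> n"
    and lower: "3 / 10 * n \<le> card (moved n g)"
    and upper: "card (moved n g) \<le> 63 / 100 * n"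
  shows "\<exists>p. p permutes {1..n} \<and> 0 < w p \<and> lap_word g p ^^ 60 \<noteq> id \<and>
    card (moved n (lap_word g p ^^ 60)) + n / 4000 \<le> card (moved n g)"
proof -
  interpret rotation n g m cyc e by (rule rot)
  let ?M = "card (moved n g)" and ?F = "card {x \<in> {1..n}. g x = x}"
  define a where "a = real ?M / n"
  have n0: "0 < real n" using n by simp
  have M: "real ?M = a * n" using n0 unfolding a_def by simp
  have F: "real ?F = (1 - a) * n" using card_fixed_plus_moved[of n g] M by (simp add: algebra_simps flip: of_nat_add)
  have a: "3 / 10 \<le> a" "a \<le> 63 / 100" using lower upper n0 unfolding a_def by (auto simp: field_simps)
  have w: "\<And>p. 0 \<le> w p" using nu unfolding near_uniform_def by auto
  have "real (8 * 60 * 9 + 12) < 3 / 10 * n" using n by simp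
  \<comment> \<open>The 60 laps of 8 letters take 480 values. With at most 15 values revealed later these are
    fewer than 500.\<close>
  then have "8 * 60 * 9 + 12 < ?M" using lower by linarith
  then obtain c where c: "partial_perm n c" "card c = 480"
    "\<And>p. p permutes {1..n} \<Longrightarrow> agrees c p \<Longrightarrow> lap_word g p ^^ 60 \<noteq> id"
    using forced_nontrivial[OF g] by blast
  \<comment> \<open>At most \<open>1072 = 2 * 480 + 7 * 16\<close> points are to be avoided: both ends of the prescribed
    values, and windows of at most 7 positions on at most 16 cycles. Each of them spoils at most 7
    entry points, and \<open>7504 = 7 * 1072\<close>.\<close>
  define \<eta> where "\<eta> = 7504 / real n"
  have \<eta>: "0 \<le> \<eta>" "\<eta> \<le> 1 / 10 ^ 8" using n n0 unfolding \<eta>_def by (auto simp: field_simps)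
  have mB: "n * \<eta> = real 7 * 1072" using n0 unfolding \<eta>_def by simp
  have m7: "real (m * 1072) \<le> real 7 * 1072" using small(3) by simp
  have fixed: "n * (1 - a - \<eta>) + m * 1072 \<le> ?F"
    using F mB m7 by (simp add: algebra_simps)
  have moved: "n * (a - \<eta>) + m * 1072 \<le> ?M"
    using M mB m7 by (simp add: algebra_simps)
  have size: "card c + f + d \<le> 500" "2 * card c + m * Suc (f + d) \<le> 1072"
  proof -
    have "m * Suc (f + d) \<le> 7 * 16" using small by (intro mult_le_mono) auto
    then show "card c + f + d \<le> 500" "2 * card c + m * Suc (f + d) \<le> 1072" using c(2) small by auto
  qed
  let ?es = "concat (replicate k lap)"
  let ?R = "\<lambda>v p. returns g p (v, False) ?es (v, False)"
  define wt where "wt = return_weight (1 - a - \<eta>) (a - \<eta>) (outcome_tree m cyc e f d ?es)"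
  have wt: "1 - a + 1 / 2500 \<le> wt"
  proof -
    have "1 - a + 1 / 2000 \<le> tally (1 - a) a xs" using grid_bound[OF table(2) a] .
    moreover have "tally (1 - a) a xs - \<eta> * (\<Sum>(i, j, k)\<leftarrow>xs. real (k * (i + j))) \<le> wt"
      using tally_minus_ge[of \<eta> "1 - a" a xs] a \<eta> unfolding wt_def return_weight_census table(1) by simp
    moreover have "\<eta> * (\<Sum>(i, j, k)\<leftarrow>xs. real (k * (i + j))) \<le> 1 / 10 ^ 8 * 2000"
      using \<eta> table_degree[OF table(2)] by (intro mult_mono) (auto intro!: sum_list_nonneg)
    ultimately show ?thesis by simp
  qed
  let ?P = "falling n (card c)"
  have P: "0 < ?P" using falling_pos partial_perm_card[OF c(1)] by blast
  define Y where "Y = n * (1 - a + 1 / 4000)"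
  have low: "n * ((1 - \<epsilon>) / ?P * wt) \<le> (\<Sum>v\<in>{1..n}. mass n w (\<lambda>p. agrees c p \<and> ?R v p))"
    unfolding wt_def using a \<eta> eps(2) by (intro outcome_tree_sound[OF nu _ _ fixed _ moved c(1) size]) auto
  have "Y * mass n w (agrees c) \<le> Y * ((1 + \<epsilon>) / ?P)"
    using nu c(1,2) a unfolding near_uniform_def Y_def by (intro mult_left_mono) auto
  also have "\<dots> < n * ((1 - \<epsilon>) / ?P * wt)"
  proof -
    have "(1 - a + 1 / 4000) * (1 + \<epsilon>) = 1 - a + 1 / 4000 + (1 - a + 1 / 4000) * \<epsilon>"
      by (simp add: algebra_simps)
    also have "(1 - a + 1 / 4000) * \<epsilon> \<le> 1 * (1 / 10 ^ 5)" using a eps by (intro mult_mono) auto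
    finally have 1: "(1 - a + 1 / 4000) * (1 + \<epsilon>) \<le> 1 - a + 1 / 4000 + 1 / 10 ^ 5" by simp
    have "(1 - \<epsilon>) * (1 - a + 1 / 2500) = 1 - a + 1 / 2500 - \<epsilon> * (1 - a + 1 / 2500)"
      by (simp only: left_diff_distrib mult_1_left)
    moreover have "\<epsilon> * (1 - a + 1 / 2500) \<le> 1 / 10 ^ 5 * 1" using a eps by (intro mult_mono) auto
    moreover have "(1 - \<epsilon>) * (1 - a + 1 / 2500) \<le> (1 - \<epsilon>) * wt"
      using wt eps by (intro mult_left_mono) auto
    ultimately have "(1 - a + 1 / 4000) * (1 + \<epsilon>) < (1 - \<epsilon>) * wt" using 1 by simp
    then have "n / ?P * ((1 - a + 1 / 4000) * (1 + \<epsilon>)) < n / ?P * ((1 - \<epsilon>) * wt)"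
      using n0 P by (intro mult_strict_left_mono) auto
    then show ?thesis unfolding Y_def
      by (simp only: times_divide_eq_left times_divide_eq_right mult_ac)
  qed
  also note low
  finally obtain p where p: "p permutes {1..n}" "0 < w p" "agrees c p" "Y < card {v \<in> {1..n}. ?R v p}"
    using averaging_above[where w = w and n = n and V = "{1..n}" and Y = Y and P = "agrees c" and R = ?R, OF w]
    by blast
  let ?w = "lap_word g p ^^ 60"
  have "card {v \<in> {1..n}. ?R v p} \<le> card {x \<in> {1..n}. ?w x = x}"
    using returns_imp_fixed[OF _ small(1)] by (intro card_mono) auto
  moreover note card_fixed_plus_moved[of n ?w]
  ultimately have "Y + card (moved n ?w) \<le> n" using p(4) by linarith
  then have "card (moved n ?w) + n / 4000 \<le> ?M"
    unfolding M Y_def by (simp add: algebra_simps)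
  then show ?thesis using p c(3) by blast
qed

lemma inj_on_orbit:
  fixes g :: "nat \<Rightarrow> nat"
  assumes g: "g permutes A" and free: "\<And>d. 0 < d \<Longrightarrow> d < q \<Longrightarrow> (g ^^ d) x \<noteq> x"
  shows "inj_on (\<lambda>k. (g ^^ k) x) {..<q}"
proof (rule linorder_inj_onI)
  fix i j assume ij: "i < j" "i \<in> {..<q}" "j \<in> {..<q}"
  show "(g ^^ i) x \<noteq> (g ^^ j) x"
  proof
    assume "(g ^^ i) x = (g ^^ j) x"
    also have "\<dots> = (g ^^ i) ((g ^^ (j - i)) x)"
      using ij by (simp flip: comp_apply[of "g ^^ i"] funpow_add)
    finally have "(g ^^ (j - i)) x = x"
      using permutes_inj[OF permutes_funpow[OF g]] by (metis injD)
    moreover have "0 < j - i" "j - i < q" using ij by auto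
    ultimately show False using free by blast
  qed
qed auto

text \<open>
  The least period of \<open>x\<close>: it divides every period, and it is the length of a cycle in
  \<open>{1..n}\<close>.
\<close>
lemma period_dvd:
  fixes g :: "nat \<Rightarrow> nat"
  assumes g: "g permutes {1..n}" and x: "(g ^^ k) x = x" "0 < k"
  shows "\<exists>r. 0 < r \<and> r \<le> max 1 n \<and> r dvd k \<and> (g ^^ r) x = x"
proof -
  define r where "r = (LEAST j. 0 < j \<and> (g ^^ j) x = x)"
  have r: "0 < r" "(g ^^ r) x = x"
    using LeastI[of "\<lambda>j. 0 < j \<and> (g ^^ j) x = x" k] x unfolding r_def by auto
  have least: "\<And>j. 0 < j \<Longrightarrow> (g ^^ j) x = x \<Longrightarrow> r \<le> j"
    unfolding r_def by (rule Least_le) auto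
  have "(g ^^ (k mod r)) x = x"
  proof -
    have "(g ^^ (k mod r + k div r * r)) x = (g ^^ (k mod r)) ((g ^^ (k div r * r)) x)"
      by (simp only: funpow_add comp_apply)
    also have "(g ^^ (k div r * r)) x = x" using funpow_fixed_dvd[OF r(2)] by simp
    finally show ?thesis using x by simp
  qed
  then have "r dvd k" using least[of "k mod r"] r(1) by (metis dvd_eq_mod_eq_0 mod_less_divisor neq0_conv leD)
  moreover have "r \<le> max 1 n"
  proof (cases "x \<in> {1..n}")
    case False
    then have "g x = x" using g by (simp add: permutes_not_in)
    then show ?thesis using least[of 1] by simp
  next
    case True
    have inj: "inj_on (\<lambda>j. (g ^^ j) x) {..<r}"
    proof (rule inj_on_orbit[OF g], rule notI)
      fix d assume "0 < d" "d < r" "(g ^^ d) x = x"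
      then show False using least[of d] by simp
    qed
    have "(\<lambda>j. (g ^^ j) x) ` {..<r} \<subseteq> {1..n}"
      using permutes_in_image[OF permutes_funpow[OF g]] True by blast
    then have "card {..<r} \<le> card {1..n}" using card_inj_on_le[OF inj, of "{1..n}"] by simp
    then show ?thesis by simp
  qed
  ultimately show ?thesis using r by blast
qed

text \<open>
  A number with no prime factors besides 2, 3 and 5 contains none of them to a power exceeding
  its binary logarithm.
\<close>
lemma smooth_dvd_power:
  fixes r e j :: nat
  assumes r: "0 < r" "r \<le> 2 ^ e" and dvd: "r dvd 30 ^ j"
  shows "r dvd 30 ^ e"
proof -
  have factor: "q ^ a dvd q ^ e" if "(q::nat) ^ a dvd r" "2 \<le> q" for q a
  proof -
    have "2 ^ a \<le> q ^ a" using that(2) by (rule power_mono) simp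
    also have "\<dots> \<le> 2 ^ e" using that(1) r by (meson dvd_imp_le le_trans)
    finally have "a \<le> e" by simp
    then show ?thesis by (rule le_imp_power_dvd)
  qed
  have pp: "prime (2::nat)" "prime (3::nat)" "prime (5::nat)" by simp_all
  have "(30::nat) ^ j = 2 ^ j * (3 ^ j * 5 ^ j)" by (simp flip: power_mult_distrib)
  then obtain u v where uv: "r = u * v" "u dvd 2 ^ j" "v dvd 3 ^ j * 5 ^ j"
    using dvd division_decomp[of r "2 ^ j" "3 ^ j * 5 ^ j"] by auto
  obtain s t where st: "v = s * t" "s dvd 3 ^ j" "t dvd 5 ^ j"
    using division_decomp[OF uv(3)] by auto
  obtain a b c where "u = 2 ^ a" "s = 3 ^ b" "t = 5 ^ c"
    using uv(2) st(2,3) pp by (meson divides_primepow_nat)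
  then have "u dvd 2 ^ e" "s dvd 3 ^ e" "t dvd 5 ^ e"
    using factor[of 2 a] factor[of 3 b] factor[of 5 c] uv(1) st(1) by auto
  then have "u * (s * t) dvd 2 ^ e * (3 ^ e * 5 ^ e)" by (intro mult_dvd_mono)
  then show ?thesis using uv(1) st(1) by (simp flip: power_mult_distrib)
qed

lemma rotation_prime_order:
  fixes g :: "nat \<Rightarrow> nat"
  assumes g: "g permutes {1..n}" and q: "prime q" "g ^^ q = id"
  shows "rotation n g q True 0"
proof
  show "0 < q" using q(1) by (rule prime_gt_0_nat)
next
  fix x assume x: "g x \<noteq> x"
  have period: "(g ^^ q) x = x" using q(2) by simp
  show "inj_on (\<lambda>k. (g ^^ k) x) {..<q}"
  proof (rule inj_on_orbit[OF g], rule notI)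
    fix d assume d: "0 < d" "d < q" and fixed: "(g ^^ d) x = x"
    have "\<not> q dvd d" using d by (auto dest: dvd_imp_le)
    then have "gcd d q = 1"
      using q(1) by (metis coprime_commute coprime_iff_gcd_eq_1 prime_imp_coprime)
    then obtain s t where st: "d * s = q * t + 1" using bezout_nat[of d q] d by auto
    have "(g ^^ (q * t)) x = x" using funpow_fixed_dvd[OF period] by simp
    then have "(g ^^ (q * t + 1)) x = g x" by simp
    moreover have "(g ^^ (d * s)) x = x" using funpow_fixed_dvd[OF fixed] by simp
    ultimately show False using st x by simp
  qed
qed (rule g, simp add: q)

text \<open>
  If a point had period \<open>d < 7\<close> under the power, then its cycle length under \<open>g\<close> would have no
  prime factors besides 2, 3 and 5 and be at most \<open>n\<close>. Such a number divides \<open>30 ^ E\<close>, so the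
  power would already fix the point.
\<close>
lemma rotation_no_short_cycle:
  fixes g :: "nat \<Rightarrow> nat"
  assumes g: "g permutes {1..n}" and n: "n \<le> 2 ^ E"
  shows "rotation n (g ^^ 30 ^ E) 7 False 3"
proof
  show gE: "g ^^ 30 ^ E permutes {1..n}" using permutes_funpow[OF g] .
next
  have gE: "g ^^ 30 ^ E permutes {1..n}" using permutes_funpow[OF g] .
  fix x assume x: "(g ^^ 30 ^ E) x \<noteq> x"
  show "inj_on (\<lambda>k. ((g ^^ 30 ^ E) ^^ k) x) {..<7}"
  proof (rule inj_on_orbit[OF gE], rule notI)
    fix d :: nat assume d: "0 < d" "d < 7" and "((g ^^ 30 ^ E) ^^ d) x = x"
    then have "(g ^^ (30 ^ E * d)) x = x" by (simp add: funpow_mult)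
    then obtain r where r: "0 < r" "r \<le> max 1 n" "r dvd 30 ^ E * d" "(g ^^ r) x = x"
      using period_dvd[OF g, of "30 ^ E * d" x] d by auto
    have "d \<in> {1, 2, 3, 4, 5, 6}" using d by auto
    then have "d dvd 900" by auto
    then have "r dvd 30 ^ E * 900" using r(3) by (meson dvd_trans mult_dvd_mono dvd_refl)
    then have "r dvd 30 ^ (E + 2)" by (simp add: power_add mult.commute)
    moreover have "max 1 n \<le> 2 ^ E" using n by simp
    then have "r \<le> 2 ^ E" using r(2) by linarith
    ultimately have "r dvd 30 ^ E" using smooth_dvd_power[OF r(1)] by blast
    then show False using funpow_fixed_dvd[OF r(4)] x by blast
  qed
qed simp_all

text \<open>
  If the power \<open>30 ^ E\<close> of \<open>g\<close> is trivial, then the last nontrivial power \<open>30 ^ i\<close> has an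
  order dividing 30, and a power of it has prime order. The exponents are bounded by \<open>30 ^ E\<close>,
  which is polynomial in \<open>n\<close> for the least possible \<open>E\<close>.
\<close>
lemma homogeneous_power:
  fixes g :: "nat \<Rightarrow> nat"
  assumes g: "g permutes {1..n}" "g \<noteq> id" and n: "n \<le> 2 ^ E"
  shows "\<exists>N\<le>30 ^ E. g ^^ N \<noteq> id \<and> (rotation n (g ^^ N) 7 False 3 \<or>
    (\<exists>q\<in>{2, 3, 5}. rotation n (g ^^ N) q True 0))"
proof (cases "g ^^ 30 ^ E = id")
  case False
  then show ?thesis using rotation_no_short_cycle[OF g(1) n] by blast
next
  case True
  define j where "j = (LEAST j. g ^^ 30 ^ j = id)"
  have j: "g ^^ 30 ^ j = id" "j \<le> E"
    using LeastI[of "\<lambda>j. g ^^ 30 ^ j = id" E] Least_le[of "\<lambda>j. g ^^ 30 ^ j = id" E] True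
    unfolding j_def by auto
  have "j \<noteq> 0" using j(1) g(2) by (intro notI) (simp add: funpow_0)
  then obtain i where i: "j = Suc i" using not0_implies_Suc by blast
  define h where "h = g ^^ 30 ^ i"
  have "h \<noteq> id" using not_less_Least[of i "\<lambda>j. g ^^ 30 ^ j = id"] i unfolding h_def j_def by auto
  have h30: "h ^^ 30 = id" using j(1) unfolding h_def i by (simp add: funpow_mult mult.commute)
  have hpow: "h ^^ k = g ^^ (30 ^ i * k)" for k unfolding h_def by (simp add: funpow_mult)
  have bound: "30 ^ i * k \<le> 30 ^ E" if "k \<le> 30" for k :: nat
  proof -
    have "30 ^ i * k \<le> 30 ^ Suc i" using that by simp
    also have "\<dots> \<le> (30::nat) ^ E" using j(2) i by (intro power_increasing) auto
    finally show ?thesis .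
  qed
  have perm: "h ^^ k permutes {1..n}" for k
    unfolding hpow using permutes_funpow[OF g(1)] .
  have pick: ?thesis if "h ^^ k \<noteq> id" "(h ^^ k) ^^ q = id" "q \<in> {2, 3, 5}" "k \<le> 30" for k q
  proof -
    have "prime q" using that(3) by auto
    then have "rotation n (h ^^ k) q True 0" using rotation_prime_order[OF perm] that(2) by blast
    then show ?thesis using that bound[OF that(4)] unfolding hpow by blast
  qed
  have mult: "(h ^^ a) ^^ b = h ^^ (a * b)" for a b by (simp add: funpow_mult)
  consider "h ^^ 15 \<noteq> id" | "h ^^ 15 = id" "h ^^ 5 \<noteq> id" | "h ^^ 5 = id" by blast
  then show ?thesis
  proof cases
    case 1 then show ?thesis by (rule pick[of 15 2]) (simp_all add: mult h30)
  next
    case 2 show ?thesis by (rule pick[of 5 3]) (simp_all add: mult 2)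
  next
    case 3 show ?thesis by (rule pick[of 1 5]) (use \<open>h \<noteq> id\<close> 3 in \<open>simp_all\<close>)
  qed
qed

lemma homogeneous_stage:
  assumes rot: "rotation n g 7 False 3 \<or> (\<exists>q\<in>{2, 3, 5}. rotation n g q True 0)"
    and nu: "near_uniform n 500 \<epsilon> w" and eps: "0 \<le> \<epsilon>" "\<epsilon> \<le> 1 / 10 ^ 5"
    and n: "10 ^ 12 \<le> n"
    and lower: "3 / 10 * n \<le> card (moved n g)"
    and upper: "card (moved n g) \<le> 63 / 100 * n"
  shows "\<exists>p. p permutes {1..n} \<and> 0 < w p \<and> lap_word g p ^^ 60 \<noteq> id \<and>
    card (moved n (lap_word g p ^^ 60)) + n / 4000 \<le> card (moved n g)"
proof -
  note stage = lap_stage[OF _ _ _ _ _ _ nu eps n lower upper]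
  consider "rotation n g 7 False 3" | "rotation n g 5 True 0" | "rotation n g 3 True 0" | "rotation n g 2 True 0"
    using rot by blast
  then show ?thesis
  proof cases
    case 1 show ?thesis by (rule stage[OF 1 census_7]) auto
  next
    case 2 show ?thesis by (rule stage[OF 2 census_5]) auto
  next
    case 3 show ?thesis by (rule stage[OF 3 census_3]) auto
  next
    case 4
    have "census (outcome_tree 2 True 0 3 4 (concat (replicate 1 lap))) 0 0 [] = table_2" using census_2 by simp
    from stage[OF 4 this] show ?thesis by auto
  qed
qed

section \<open>Small support\<close>

lemma near_uniformD:
  assumes "near_uniform n t \<epsilon> w" "partial_perm n c" "card c = r" "r \<le> t"
  shows "(1 - \<epsilon>) / falling n r \<le> mass n w (agrees c)" "mass n w (agrees c) \<le> (1 + \<epsilon>) / falling n r"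
  using assms unfolding near_uniform_def by auto

lemma composite_append: "composite (ss @ ts) = composite ss \<circ> composite ts"
  by (induction ss) (auto simp: o_assoc)

lemma word_of_id: "word_of S 0 id"
  unfolding word_of_def by (intro exI[of _ "[]"]) simp

lemma word_of_comp: "word_of S k p \<Longrightarrow> word_of S l q \<Longrightarrow> word_of S (k + l) (p \<circ> q)"
  unfolding word_of_def
proof (elim exE conjE)
  fix ss ts assume "set ss \<subseteq> S" "length ss \<le> k" "composite ss = p" "set ts \<subseteq> S" "length ts \<le> l" "composite ts = q"
  then show "\<exists>ss. set ss \<subseteq> S \<and> length ss \<le> k + l \<and> composite ss = p \<circ> q"
    by (intro exI[of _ "ss @ ts"]) (auto simp: composite_append)
qed

lemma word_of_funpow: "word_of S k p \<Longrightarrow> word_of S (m * k) (p ^^ m)"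
proof (induction m)
  case (Suc m)
  from word_of_comp[OF Suc.prems Suc.IH[OF Suc.prems]] show ?case by (simp only: funpow.simps mult_Suc)
qed (use word_of_id in simp)

lemma word_of_subset: "word_of S k p \<Longrightarrow> S \<subseteq> T \<Longrightarrow> word_of T k p"
  unfolding word_of_def by blast

definition two_sided :: "(nat \<Rightarrow> nat) set \<Rightarrow> (nat \<Rightarrow> nat) set" where
  "two_sided S = S \<union> inv' ` S"

lemma word_of_two_sided: "word_of S k p \<Longrightarrow> word_of (two_sided S) k p"
  by (rule word_of_subset) (auto simp: two_sided_def)

lemma word_of_inv:
  assumes S: "\<And>s. s \<in> S \<Longrightarrow> s permutes {1..n::nat}" and p: "word_of (two_sided S) k p"
  shows "word_of (two_sided S) k (inv' p)"
proof -
  have closed: "s permutes {1..n} \<and> inv' s \<in> two_sided S" if "s \<in> two_sided S" for s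
    using that S permutes_inv permutes_inv_inv unfolding two_sided_def by fastforce
  obtain ss where ss: "set ss \<subseteq> two_sided S" "length ss \<le> k" "composite ss = p"
    using p unfolding word_of_def by blast
  have "set ss \<subseteq> two_sided S \<Longrightarrow> composite ss permutes {1..n} \<and>
      (\<exists>ts. set ts \<subseteq> two_sided S \<and> length ts = length ss \<and> composite ts = inv' (composite ss))" for ss
  proof (induction ss)
    case Nil
    show ?case using permutes_id[of "{1..n}"]
      by (intro conjI exI[of _ "[]"]) (simp_all only: composite_simps inv_id list.set list.size empty_subsetI)
  next
    case (Cons s ss)
    then obtain ts where ts: "set ts \<subseteq> two_sided S" "length ts = length ss" "composite ts = inv' (composite ss)"
      and perm: "composite ss permutes {1..n}" "s permutes {1..n}" and inv: "inv' s \<in> two_sided S"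
      using closed by auto
    have "inv' (composite (s # ss)) = inv' (composite ss) \<circ> inv' s"
      using perm by (simp add: o_inv_distrib permutes_bij)
    then have "composite (ts @ [inv' s]) = inv' (composite (s # ss))"
      using ts(3) by (simp add: composite_append)
    moreover have "set (ts @ [inv' s]) \<subseteq> two_sided S" "length (ts @ [inv' s]) = length (s # ss)"
      using ts inv by auto
    ultimately have "\<exists>ts. set ts \<subseteq> two_sided S \<and> length ts = length (s # ss) \<and> composite ts = inv' (composite (s # ss))"
      by blast
    moreover have "composite (s # ss) permutes {1..n}" using permutes_compose[OF perm] by simp
    ultimately show ?case by blast
  qed
  then obtain ts where "set ts \<subseteq> two_sided S" "length ts = length ss" "composite ts = inv' (composite ss)"
    using ss(1) by blast
  then show ?thesis using ss(2,3) unfolding word_of_def by metis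
qed

lemma mass_le_sum:
  assumes A: "finite A" and w: "\<And>p. 0 \<le> w p"
    and cover: "\<And>p. p permutes {1..n} \<Longrightarrow> P p \<Longrightarrow> \<exists>u\<in>A. Q u p"
  shows "mass n w P \<le> (\<Sum>u\<in>A. mass n w (Q u))"
proof -
  let ?I = "\<lambda>B p. if p \<in> B then w p else 0"
  have "mass n w P = (\<Sum>p | p permutes {1..n} \<and> True. if P p then w p else 0)"
    unfolding mass_def by (subst sum.inter_filter[OF finite_perms, symmetric]) simp
  also have "\<dots> \<le> (\<Sum>p | p permutes {1..n} \<and> True. \<Sum>u\<in>A. if Q u p then w p else 0)"
  proof (intro sum_mono)
    fix p assume p: "p \<in> {p. p permutes {1..n} \<and> True}"
    show "(if P p then w p else 0) \<le> (\<Sum>u\<in>A. if Q u p then w p else 0)"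
    proof (cases "P p")
      case True
      then obtain u where u: "u \<in> A" "Q u p" using cover p by blast
      have "(if Q u p then w p else 0) \<le> (\<Sum>u\<in>A. if Q u p then w p else 0)"
        using u(1) A w by (intro member_le_sum) auto
      then show ?thesis using True u by simp
    qed (use w in \<open>auto intro: sum_nonneg\<close>)
  qed
  also have "\<dots> = (\<Sum>u\<in>A. \<Sum>p | p permutes {1..n} \<and> True. if Q u p then w p else 0)" by (rule sum.swap)
  also have "\<dots> = (\<Sum>u\<in>A. mass n w (Q u))"
    unfolding mass_def by (subst sum.inter_filter[OF finite_perms, symmetric]) simp
  finally show ?thesis .
qed

definition commutator :: "(nat \<Rightarrow> nat) \<Rightarrow> (nat \<Rightarrow> nat) \<Rightarrow> nat \<Rightarrow> nat" where
  "commutator g h = g \<circ> h \<circ> inv' g \<circ> inv' h"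

text \<open>
  The commutator can move a point only if the point itself, or its preimage under \<open>g\<close> or \<open>h\<close>,
  is moved by both.
\<close>
lemma commutator_support:
  assumes g: "g permutes {1..n::nat}" and h: "h permutes {1..n}"
  defines "I \<equiv> {x \<in> {1..n}. g x \<noteq> x \<and> h x \<noteq> x}"
  shows "moved n (commutator g h) \<subseteq> I \<union> g ` I \<union> h ` I"
proof
  fix y assume y: "y \<in> moved n (commutator g h)"
  note gi = permutes_inverses[OF g] and hi = permutes_inverses[OF h]
  show "y \<in> I \<union> g ` I \<union> h ` I"
  proof (rule ccontr)
    assume out: "y \<notin> I \<union> g ` I \<union> h ` I"
    have in_I: "inv' g y \<notin> I" "inv' h y \<notin> I"
      using out gi(1) hi(1) by (metis UnI1 UnI2 imageI)+
    have dom: "inv' g y \<in> {1..n}" "inv' h y \<in> {1..n}"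
      using y permutes_in_image[OF permutes_inv[OF g]] permutes_in_image[OF permutes_inv[OF h]] by auto
    consider "g y = y" "h y = y" | "g y \<noteq> y" "h y = y" | "g y = y" "h y \<noteq> y"
      using out y unfolding I_def by auto
    then have "commutator g h y = y"
    proof cases
      case 1
      then have "inv' g y = y" "inv' h y = y" using gi(2)[of y] hi(2)[of y] by auto
      then show ?thesis using 1 unfolding commutator_def by simp
    next
      case 2
      then have hy: "inv' h y = y" using hi(2)[of y] by auto
      have "g (inv' g y) \<noteq> inv' g y" using 2(1) gi(1)[of y] by metis
      then have "h (inv' g y) = inv' g y" using in_I(1) dom unfolding I_def by auto
      then show ?thesis using hy gi(1) unfolding commutator_def by simp
    next
      case 3
      have "h (inv' h y) \<noteq> inv' h y" using 3(2) hi(1)[of y] by metis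
      then have *: "g (inv' h y) = inv' h y" using in_I(2) dom unfolding I_def by auto
      then have "inv' g (inv' h y) = inv' h y" using gi(2)[of "inv' h y"] by simp
      then show ?thesis using 3 hi(1) unfolding commutator_def by simp
    qed
    then show False using y by simp
  qed
qed

lemma conj_by_permutes: "g permutes {1..n} \<Longrightarrow> p permutes {1..n} \<Longrightarrow> conj_by p g permutes {1..n}"
  unfolding conj_by_def by (intro permutes_compose permutes_inv)

lemma conj_by_fixed_iff: "p permutes {1..n} \<Longrightarrow> conj_by p g x = x \<longleftrightarrow> g (p x) = p x"
  unfolding conj_by_def by (metis comp_apply permutes_inverses)

text \<open>
  The conjugate moves \<open>v\<close> exactly if \<open>p v\<close> lies in the support of \<open>g\<close>, so the expected size of
  the intersection of the supports is about \<open>s\<^sup>2 / n\<close>. Two prescribed values of \<open>p\<close> keep the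
  commutator from being trivial: on the edge of \<open>g\<close> from \<open>x0\<close> to \<open>x1\<close> the conjugate moves \<open>x1\<close>
  but not \<open>x0\<close>. The point \<open>x1\<close> in the intersection accounts for the additional 3. If
  \<open>1.01 * s\<^sup>2 < n\<close>, then the rest of the intersection is empty for some \<open>p\<close>.
\<close>
lemma commutator_stage:
  assumes g: "g permutes {1..n}" "g \<noteq> id" and nu: "near_uniform n t (1 / 10 ^ 5) w" and t: "3 \<le> t"
    and n: "10 ^ 12 \<le> n" and small: "card (moved n g) \<le> 3 / 10 * n"
  defines "s \<equiv> real (card (moved n g))"
  shows "\<exists>p. p permutes {1..n} \<and> 0 < w p \<and> commutator g (conj_by p g) \<noteq> id \<and>
    card (moved n (commutator g (conj_by p g))) \<le> 3 + 3 * (101 / 100 * s\<^sup>2 / n) \<and>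
    (101 / 100 * s\<^sup>2 < n \<longrightarrow> card (moved n (commutator g (conj_by p g))) \<le> 3)"
proof -
  let ?D = "moved n g"
  have w: "\<And>p. 0 \<le> w p" using nu unfolding near_uniform_def by auto
  obtain x0 where x0: "g x0 \<noteq> x0" using g(2) by (metis ext id_apply)
  then have x0_in: "x0 \<in> {1..n}" using g(1) by (meson permutes_not_in)
  define x1 where "x1 = g x0"
  have x1: "x1 \<in> {1..n}" "g x1 \<noteq> x1" "x1 \<noteq> x0"
    using x0 x0_in permutes_in_image[OF g(1)] permutes_inj[OF g(1)] unfolding x1_def by (auto dest: injD)
  obtain a where a: "a \<in> ?D" using x0 x0_in by blast
  have "card ?D < n" using small n by simp
  then have "?D \<noteq> {1..n}" by auto
  then obtain b where b: "b \<in> {1..n}" "g b = b" by blast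
  define c where "c = {(x1, a), (x0, b)}"
  have c: "partial_perm n c" "card c = 2"
    using x1 x0_in a b unfolding c_def partial_perm_def by auto
  have "3 = Suc 2" "2 \<le> n" using n by simp_all
  then have f: "0 < falling n 2" "falling n 3 = falling n 2 * (real n - 2)"
    using falling_pos falling_Suc[of n 2] by (simp, simp only: of_nat_numeral)
  have low: "(1 - 1 / 10 ^ 5) / falling n 2 \<le> mass n w (agrees c)"
    using near_uniformD(1)[OF nu c] t by simp
  have "0 < (1 - 1 / 10 ^ 5) / falling n 2" using f(1) by simp
  then have pos: "0 < mass n w (agrees c)" using low by linarith
  let ?V = "?D - {x0, x1}"
  let ?R = "\<lambda>v p. p v \<in> ?D"
  have each: "mass n w (\<lambda>p. agrees c p \<and> ?R v p) \<le> s * ((1 + 1 / 10 ^ 5) / falling n 3)" if v: "v \<in> ?V" for v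
  proof -
    have "mass n w (\<lambda>p. agrees c p \<and> ?R v p) \<le> (\<Sum>u\<in>?D - {a}. mass n w (agrees (insert (v, u) c)))"
    proof (rule mass_le_sum[OF _ w])
      fix p assume p: "p permutes {1..n}" "agrees c p \<and> ?R v p"
      have "p v \<noteq> a"
      proof
        assume "p v = a"
        also have "a = p x1" using p(2) unfolding agrees_def c_def by simp
        finally have "v = x1" using permutes_inj[OF p(1)] by (auto dest: injD)
        then show False using v by simp
      qed
      then show "\<exists>u\<in>?D - {a}. agrees (insert (v, u) c) p"
        using p(2) unfolding agrees_def by (intro bexI[of _ "p v"]) auto
    qed auto
    also have "\<dots> \<le> (\<Sum>u\<in>?D - {a}. (1 + 1 / 10 ^ 5) / falling n 3)"
    proof (rule sum_mono)
      fix u assume u: "u \<in> ?D - {a}"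
      have "v \<notin> fst ` c" "u \<notin> snd ` c" using u v b unfolding c_def by auto
      then have "partial_perm n (insert (v, u) c)" "card (insert (v, u) c) = 3"
        using partial_perm_insert[OF c(1), of v u] u v c(2) by auto
      then show "mass n w (agrees (insert (v, u) c)) \<le> (1 + 1 / 10 ^ 5) / falling n 3"
        using near_uniformD(2)[OF nu] t by blast
    qed
    also have "\<dots> = card (?D - {a}) * ((1 + 1 / 10 ^ 5) / falling n 3)" by simp
    also have "\<dots> \<le> s * ((1 + 1 / 10 ^ 5) / falling n 3)"
      unfolding s_def using falling_pos[of 3 n] n
      by (intro mult_right_mono) (auto intro!: card_mono)
    finally show ?thesis .
  qed
  define Y where "Y = 101 / 100 * s\<^sup>2 / n"
  have s0: "0 \<le> s" unfolding s_def by simp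
  have "(\<Sum>v\<in>?V. mass n w (\<lambda>p. agrees c p \<and> ?R v p)) \<le> (\<Sum>v\<in>?V. s * ((1 + 1 / 10 ^ 5) / falling n 3))"
    using each by (rule sum_mono)
  also have "\<dots> = card ?V * (s * ((1 + 1 / 10 ^ 5) / falling n 3))" by simp
  also have "\<dots> \<le> s * (s * ((1 + 1 / 10 ^ 5) / falling n 3))"
    using s0 falling_pos[of 3 n] n by (intro mult_right_mono mult_nonneg_nonneg) (auto simp: s_def intro!: card_mono)
  also have "\<dots> = (1 + 1 / 10 ^ 5) / (real n - 2) * s\<^sup>2 / falling n 2"
    unfolding f(2) power2_eq_square
    by (simp only: times_divide_eq_left times_divide_eq_right divide_divide_eq_left mult_ac)
  also have "\<dots> \<le> ((1 - 1 / 10 ^ 5) * (101 / 100 / n)) * s\<^sup>2 / falling n 2"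
  proof -
    have "(1 + 1 / 10 ^ 5) / (real n - 2) \<le> (1 - 1 / 10 ^ 5) * (101 / 100 / n)"
      using n by (simp add: field_simps)
    then show ?thesis using f(1) by (intro divide_right_mono mult_right_mono) auto
  qed
  also have "\<dots> = Y * ((1 - 1 / 10 ^ 5) / falling n 2)" unfolding Y_def by (simp add: field_simps)
  also have "\<dots> \<le> Y * mass n w (agrees c)" using low unfolding Y_def by (intro mult_left_mono) auto
  finally obtain p where p: "p permutes {1..n}" "0 < w p" "agrees c p" "card {v \<in> ?V. ?R v p} \<le> Y"
    using averaging_below[where w = w and n = n and V = ?V and P = "agrees c" and R = ?R and Y = Y, OF w _ _ pos]
    by auto
  let ?h = "conj_by p g" and ?x = "commutator g (conj_by p g)"
  have pv: "p x1 = a" "p x0 = b" using p(3) unfolding agrees_def c_def by auto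
  have h: "?h permutes {1..n}" using conj_by_permutes[OF g(1) p(1)] .
  have h1: "?h x1 \<noteq> x1" "?h x0 = x0" using conj_by_fixed_iff[OF p(1)] pv a b by auto
  have "?x \<noteq> id"
  proof
    assume "?x = id"
    then have "?x (?h (g x0)) = ?h (g x0)" by simp
    then have "g (?h x0) = ?h (g x0)"
      unfolding commutator_def using permutes_inverses[OF g(1)] permutes_inverses[OF h] by simp
    then show False using h1 unfolding x1_def by simp
  qed
  define I where "I = {x \<in> {1..n}. g x \<noteq> x \<and> ?h x \<noteq> x}"
  have "I \<subseteq> insert x1 {v \<in> ?V. ?R v p}"
    using h1(2) permutes_in_image[OF p(1)] unfolding I_def by (auto simp: conj_by_fixed_iff[OF p(1)])
  then have "card I \<le> card (insert x1 {v \<in> ?V. ?R v p})" by (intro card_mono) auto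
  also have "\<dots> \<le> Suc (card {v \<in> ?V. ?R v p})" by (rule card_insert_le_m1) auto
  finally have I_le: "card I \<le> Suc (card {v \<in> ?V. ?R v p})" .
  then have I: "real (card I) \<le> 1 + Y" "card {v \<in> ?V. ?R v p} = 0 \<Longrightarrow> card I \<le> 1"
    using p(4) by linarith+
  have finI: "finite I" unfolding I_def by simp
  have "card (moved n ?x) \<le> card (I \<union> g ` I \<union> ?h ` I)"
    using commutator_support[OF g(1) h] finI unfolding I_def by (intro card_mono) auto
  also have "\<dots> \<le> card I + card (g ` I) + card (?h ` I)"
    by (meson card_Un_le le_trans add_le_mono1)
  also have "\<dots> \<le> 3 * card I"
    using card_image_le[OF finI, of g] card_image_le[OF finI, of ?h] by linarith
  finally have X: "card (moved n ?x) \<le> 3 * card I" .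
  then have "card (moved n ?x) \<le> 3 + 3 * Y" using I(1) by linarith
  moreover have "card (moved n ?x) \<le> 3" if "101 / 100 * s\<^sup>2 < n"
  proof -
    have "Y < 1" using that n unfolding Y_def by (simp add: field_simps)
    then have "card {v \<in> ?V. ?R v p} = 0" using p(4) by linarith
    then show ?thesis using I(2) X by linarith
  qed
  ultimately show ?thesis using p \<open>?x \<noteq> id\<close> unfolding Y_def by blast
qed

section \<open>Three-cycles and the descent\<close>

definition cyc3 :: "nat \<Rightarrow> nat \<Rightarrow> nat \<Rightarrow> nat \<Rightarrow> nat" where
  "cyc3 a b c = transpose a b \<circ> transpose b c"

lemma cyc3_permutes: "a \<in> A \<Longrightarrow> b \<in> A \<Longrightarrow> c \<in> A \<Longrightarrow> cyc3 a b c permutes A"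
  unfolding cyc3_def by (intro permutes_compose permutes_swap_id)

lemma cyc3_apply:
  assumes "distinct [a, b, c]"
  shows "cyc3 a b c a = b" "cyc3 a b c b = c" "cyc3 a b c c = a" "x \<notin> {a, b, c} \<Longrightarrow> cyc3 a b c x = x"
  using assms unfolding cyc3_def by (auto simp: transpose_def)

lemma evenperm_cyc3: "distinct [a, b, c] \<Longrightarrow> evenperm (cyc3 a b c)"
  unfolding cyc3_def by (subst evenperm_comp) (auto simp: permutation_swap_id evenperm_swap)

lemma cyc3_conj:
  assumes p: "p permutes {1..n}"
  shows "inv' p \<circ> cyc3 (p a) (p b) (p c) \<circ> p = cyc3 a b c"
proof -
  have t: "transpose (p a) (p b) (p x) = p (transpose a b x)" for a b x
    using permutes_inj[OF p] by (auto simp: transpose_def inj_eq)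
  show ?thesis unfolding cyc3_def using permutes_inverses[OF p] by (auto simp: fun_eq_iff t)
qed

text \<open>
  A transposition is odd, so three points have to be moved.
\<close>
lemma small_even_is_cyc3:
  assumes x: "x permutes {1..n::nat}" "evenperm x" "x \<noteq> id" and small: "card (moved n x) \<le> 3"
  shows "\<exists>a b c. {a, b, c} \<subseteq> {1..n} \<and> distinct [a, b, c] \<and> x = cyc3 a b c"
proof -
  let ?D = "moved n x"
  have inj: "x u = x v \<longleftrightarrow> u = v" for u v using permutes_inj[OF x(1)] by (rule inj_eq)
  have D: "y \<in> ?D \<longleftrightarrow> x y \<noteq> y" for y using permutes_not_in[OF x(1)] by blast
  obtain a where a: "x a \<noteq> a" using x(3) by (metis ext id_apply)
  define b where "b = x a"
  define c where "c = x b"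
  have b: "x b \<noteq> b" "b \<noteq> a" using a inj unfolding b_def by auto
  have c: "x c \<noteq> c" "c \<noteq> b" using b inj unfolding c_def by auto
  have finD: "finite ?D" by simp
  have abD: "{a, b} \<subseteq> ?D" using a b D by blast
  have "c \<noteq> a"
  proof
    assume "c = a"
    have "x y = transpose a b y" for y
    proof (cases "y \<in> {a, b}")
      case True then show ?thesis using \<open>c = a\<close> b_def c_def by auto
    next
      case False
      have "x y = y"
      proof (rule ccontr)
        assume y: "x y \<noteq> y"
        then have "x (x y) \<noteq> x y" using inj by simp
        moreover have "x y \<notin> {a, b}" using False inj b_def c_def \<open>c = a\<close> by (metis insertE insertI1 insertI2 singletonD)
        ultimately have "{a, b, y, x y} \<subseteq> ?D" "card {a, b, y, x y} = 4"
          using D abD y False b by auto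
        then show False using small card_mono[OF finD, of "{a, b, y, x y}"] by simp
      qed
      then show ?thesis using False by (simp add: transpose_def)
    qed
    then have "x = transpose a b" by (rule ext)
    then show False using x(2) b(2) by (simp add: evenperm_swap)
  qed
  then have dist: "distinct [a, b, c]" using b c by auto
  have abc: "{a, b, c} \<subseteq> ?D" using a b c D by blast
  have "card {a, b, c} = 3" using dist by simp
  then have "?D = {a, b, c}" using card_seteq[OF finD abc] small by simp
  then have out: "x y = y" if "y \<notin> {a, b, c}" for y using D that by blast
  have "x c \<in> ?D" using c(1) inj D by blast
  then have "x c = a" using \<open>?D = {a, b, c}\<close> c inj b_def c_def \<open>c \<noteq> a\<close> b by (metis insertE singletonD)
  have "x y = cyc3 a b c y" for y
  proof -
    consider "y = a" | "y = b" | "y = c" | "y \<notin> {a, b, c}" by blast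
    then show ?thesis
    proof cases
      case 1 then show ?thesis using cyc3_apply(1)[OF dist] b_def by simp
    next
      case 2 then show ?thesis using cyc3_apply(2)[OF dist] c_def by simp
    next
      case 3 then show ?thesis using cyc3_apply(3)[OF dist] \<open>x c = a\<close> by simp
    next
      case 4 then show ?thesis using cyc3_apply(4)[OF dist] out by simp
    qed
  qed
  then have "x = cyc3 a b c" by (rule ext)
  then show ?thesis using abc dist by blast
qed

text \<open>
  If \<open>x\<close> maps \<open>a\<close> to \<open>b\<close>, then a three-cycle taking \<open>b\<close> to \<open>a\<close> within the support makes \<open>a\<close> a
  fixed point of the product. A third point of the support exists since \<open>x\<close> is not a
  transposition.
\<close>
lemma even_word:
  assumes S: "\<And>s. s \<in> S \<Longrightarrow> s permutes {1..n::nat}"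
    and cyc: "\<And>a b c. {a, b, c} \<subseteq> {1..n} \<Longrightarrow> distinct [a, b, c] \<Longrightarrow> word_of (two_sided S) L (cyc3 a b c)"
  shows "x permutes {1..n} \<Longrightarrow> evenperm x \<Longrightarrow> word_of (two_sided S) (L * card (moved n x)) x"
proof (induction "card (moved n x)" arbitrary: x rule: less_induct)
  case less
  let ?D = "\<lambda>x. moved n x"
  have inj: "x u = x v \<longleftrightarrow> u = v" for u v using permutes_inj[OF less.prems(1)] by (rule inj_eq)
  have D: "y \<in> ?D x \<longleftrightarrow> x y \<noteq> y" for y using permutes_not_in[OF less.prems(1)] by blast
  show ?case
  proof (cases "x = id")
    case True then show ?thesis using word_of_mono[OF word_of_id] by simp
  next
    case False
    then obtain a where a: "x a \<noteq> a" by (metis ext id_apply)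
    define b where "b = x a"
    have b: "x b \<noteq> b" "b \<noteq> a" using a inj unfolding b_def by auto
    have "\<exists>c. c \<noteq> a \<and> c \<noteq> b \<and> x c \<noteq> c"
    proof (rule ccontr)
      assume none: "\<not> ?thesis"
      then have xb: "x b = a" using b inj unfolding b_def by metis
      have "x y = transpose a b y" for y using none xb b_def by (auto simp: transpose_def)
      then have "x = transpose a b" by (rule ext)
      then show False using less.prems(2) b(2) by (simp add: evenperm_swap)
    qed
    then obtain c where c: "c \<noteq> a" "c \<noteq> b" "x c \<noteq> c" by blast
    have dist: "distinct [b, a, c]" using b c by auto
    have in_n: "{b, a, c} \<subseteq> {1..n}" using a b c D by blast
    define y where "y = cyc3 b a c"
    have y: "y permutes {1..n}" "evenperm y" "word_of (two_sided S) L y"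
      using cyc3_permutes in_n evenperm_cyc3[OF dist] cyc[OF in_n dist] unfolding y_def by auto
    define z where "z = y \<circ> x"
    have z: "z permutes {1..n}" unfolding z_def using permutes_compose[OF less.prems(1) y(1)] .
    have "permutation x" "permutation y" using less.prems(1) y(1) permutation_permutes by blast+
    then have z_even: "evenperm z" unfolding z_def using evenperm_comp less.prems(2) y(2) by blast
    have "?D z \<subseteq> ?D x - {a}"
    proof
      fix v assume v: "v \<in> ?D z"
      have "v \<noteq> a" using v cyc3_apply(1)[OF dist] unfolding z_def y_def b_def by auto
      moreover have "x v \<noteq> v"
      proof
        assume "x v = v"
        then have "v \<notin> {b, a, c}" using a b c by auto
        then show False using v cyc3_apply(4)[OF dist] \<open>x v = v\<close> unfolding z_def y_def by auto
      qed
      ultimately show "v \<in> ?D x - {a}" using v by auto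
    qed
    moreover have "a \<in> ?D x" using D a by blast
    ultimately have le: "card (?D z) \<le> card (?D x) - 1" "0 < card (?D x)"
      using card_mono[of "?D x - {a}" "?D z"] by (auto simp: card_gt_0_iff)
    then have "card (?D z) < card (?D x)" by linarith
    from less.hyps[OF this z z_even] have "word_of (two_sided S) (L * card (?D z)) z" .
    from word_of_comp[OF word_of_inv[OF S y(3)] this]
    have "word_of (two_sided S) (L + L * card (?D z)) (inv' y \<circ> z)" by blast
    moreover have "inv' y \<circ> z = x" unfolding z_def using permutes_inv_o(2)[OF y(1)] by (simp add: o_assoc)
    moreover have "L + L * card (?D z) = L * Suc (card (?D z))" by simp
    ultimately have "word_of (two_sided S) (L * Suc (card (?D z))) x" by (simp only:)
    then show ?thesis by (rule word_of_mono) (use le in \<open>intro mult_le_mono2, linarith\<close>)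
  qed
qed

lemma evenperm_commutator:
  assumes "g permutes {1..n::nat}" "h permutes {1..n}"
  shows "evenperm (commutator g h)"
proof -
  have "permutation g" "permutation h" using assms permutation_permutes by blast+
  then show ?thesis unfolding commutator_def
    by (cases "evenperm g"; cases "evenperm h")
      (simp_all add: evenperm_comp evenperm_inv permutation_compose permutation_inverse)
qed

locale mixed =
  fixes n T :: nat and S :: "(nat \<Rightarrow> nat) set" and w :: "(nat \<Rightarrow> nat) \<Rightarrow> real"
  assumes S: "\<And>s. s \<in> S \<Longrightarrow> s permutes {1..n}"
    and nu: "near_uniform n 500 (1 / 10 ^ 5) w"
    and w_word: "\<And>p. w p \<noteq> 0 \<Longrightarrow> word_of S T p"
    and n: "10 ^ 12 \<le> n"
begin

abbreviation "word \<equiv> word_of (two_sided S)"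

lemma word_conj_by:
  assumes "word L g" "0 < w p" shows "word (L + 2 * T) (conj_by p g)"
proof -
  have p: "word T p" using w_word assms(2) by (intro word_of_two_sided) auto
  have "word (T + L + T) (inv' p \<circ> g \<circ> p)"
    by (intro word_of_comp word_of_inv[OF S p] assms(1) p)
  then show ?thesis unfolding conj_by_def by (simp add: mult_2 add.commute add.left_commute)
qed

lemma word_commutator:
  assumes "word L g" "0 < w p" shows "word (4 * L + 4 * T) (commutator g (conj_by p g))"
proof -
  note h = word_conj_by[OF assms]
  have "word (L + (L + 2 * T) + L + (L + 2 * T)) (commutator g (conj_by p g))"
    unfolding commutator_def
    by (intro word_of_comp assms(1) h word_of_inv[OF S assms(1)] word_of_inv[OF S h])
  then show ?thesis by (rule word_of_mono) simp
qed

lemma word_lap: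
  assumes "word L g" "0 < w p" shows "word (480 * (L + T)) (lap_word g p ^^ 60)"
proof -
  note gi = word_of_inv[OF S assms(1)]
  note h = word_conj_by[OF assms] and hi = word_conj_by[OF gi assms(2)]
  let ?c = "L + 2 * T"
  have "word (?c + L + ?c + L + ?c + L + ?c + L) (lap_word g p)"
    unfolding lap_word_def by (intro word_of_comp assms(1) gi h hi)
  from word_of_funpow[OF this, of 60] show ?thesis by (rule word_of_mono) simp
qed

lemma funpow_support: "moved n (g ^^ k) \<subseteq> moved n g" for g :: "nat \<Rightarrow> nat"
proof -
  have "g x = x \<Longrightarrow> (g ^^ k) x = x" for x by (induction k) auto
  then show ?thesis by auto
qed

text \<open>
  Every round takes a power of exponent at most \<open>30 ^ E\<close>, and then the 60th power of a lap
  word in it. Of its 480 letters half are conjugated, at a cost of \<open>2 * T\<close> each. If already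
  the power has small support, then the lap word is not needed.
\<close>
lemma descend_large:
  assumes E: "n \<le> 2 ^ E"
  shows "g permutes {1..n} \<Longrightarrow> g \<noteq> id \<Longrightarrow> word L g \<Longrightarrow> card (moved n g) \<le> 63 / 100 * real n \<Longrightarrow>
    card (moved n g) \<le> 3 / 10 * real n + j * (real n / 4000) \<Longrightarrow>
    \<exists>g'. g' permutes {1..n} \<and> g' \<noteq> id \<and> word ((481 * 30 ^ E) ^ j * (L + T)) g' \<and>
      card (moved n g') \<le> 3 / 10 * real n"
proof (induction j arbitrary: g L)
  case 0
  then have "word (L + T) g" using word_of_mono[of _ L g "L + T"] by simp
  then show ?case using 0 by (intro exI[of _ g]) simp
next
  case (Suc j)
  let ?D = "\<lambda>g. moved n g"
  have P: "1 \<le> (481 * 30 ^ E :: nat) ^ i" for i by simp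
  show ?case
  proof (cases "card (?D g) \<le> 3 / 10 * real n")
    case True
    have "1 * L \<le> (481 * 30 ^ E) ^ Suc j * (L + T)" using P by (intro mult_le_mono) auto
    then have "word ((481 * 30 ^ E) ^ Suc j * (L + T)) g" using word_of_mono[OF Suc.prems(3)] by simp
    then show ?thesis using Suc.prems True by blast
  next
    case False
    obtain N where N: "N \<le> 30 ^ E" "g ^^ N \<noteq> id"
      "rotation n (g ^^ N) 7 False 3 \<or> (\<exists>q\<in>{2, 3, 5}. rotation n (g ^^ N) q True 0)"
      using homogeneous_power[OF Suc.prems(1,2) E] by blast
    let ?g = "g ^^ N"
    have perm: "?g permutes {1..n}" using permutes_funpow[OF Suc.prems(1)] .
    have "word (N * L) ?g" using word_of_funpow[OF Suc.prems(3)] .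
    then have wg: "word (30 ^ E * L) ?g" by (rule word_of_mono) (use N(1) in simp)
    have le: "card (?D ?g) \<le> card (?D g)" using funpow_support by (intro card_mono) auto
    have bound: "480 * (30 ^ E * L + T) + T \<le> 481 * 30 ^ E * (L + T)"
    proof -
      have "480 * (30 ^ E * L) + 481 * T \<le> 481 * 30 ^ E * L + 481 * 30 ^ E * T"
        by (intro add_mono) simp_all
      then show ?thesis by (simp add: distrib_left)
    qed
    show ?thesis
    proof (cases "card (?D ?g) \<le> 3 / 10 * real n")
      case True
      have "30 ^ E * L \<le> 480 * (30 ^ E * L + T) + T" by simp
      also note bound
      also have "481 * 30 ^ E * (L + T) \<le> (481 * 30 ^ E) ^ j * (481 * 30 ^ E * (L + T))"
        using mult_le_mono1[OF P, of "481 * 30 ^ E * (L + T)" j] by (simp only: mult_1)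
      also have "\<dots> = (481 * 30 ^ E) ^ Suc j * (L + T)" by (simp only: power_Suc mult_ac)
      finally have "word ((481 * 30 ^ E) ^ Suc j * (L + T)) ?g" by (rule word_of_mono[OF wg])
      then show ?thesis using perm N(2) True by blast
    next
      case False
      then obtain p where p: "p permutes {1..n}" "0 < w p" "lap_word ?g p ^^ 60 \<noteq> id"
        "card (?D (lap_word ?g p ^^ 60)) + n / 4000 \<le> card (?D ?g)"
        using homogeneous_stage[OF N(3) nu _ _ n] le Suc.prems(4) by fastforce
      let ?x = "lap_word ?g p ^^ 60"
      have "lap_word ?g p permutes {1..n}"
        unfolding lap_word_def by (intro permutes_compose conj_by_permutes permutes_inv perm p(1))
      then have x: "?x permutes {1..n}" by (rule permutes_funpow)
      have "card (?D ?x) \<le> 63 / 100 * real n" "card (?D ?x) \<le> 3 / 10 * real n + j * (real n / 4000)"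
      proof -
        have "real (Suc j) * (real n / 4000) = real j * (real n / 4000) + real n / 4000"
          by (simp add: distrib_right)
        moreover have "real (card (?D ?g)) \<le> real (card (?D g))" using le by simp
        ultimately show "card (?D ?x) \<le> 63 / 100 * real n" "card (?D ?x) \<le> 3 / 10 * real n + j * (real n / 4000)"
          using p(4) Suc.prems(4,5) by linarith+
      qed
      from Suc.IH[OF x p(3) word_lap[OF wg p(2)] this]
      obtain g' where g': "g' permutes {1..n}" "g' \<noteq> id" "card (?D g') \<le> 3 / 10 * real n"
        "word ((481 * 30 ^ E) ^ j * (480 * (30 ^ E * L + T) + T)) g'" by blast
      have "(481 * 30 ^ E) ^ j * (480 * (30 ^ E * L + T) + T) \<le> (481 * 30 ^ E) ^ j * (481 * 30 ^ E * (L + T))"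
        using bound by (rule mult_le_mono2)
      also have "\<dots> = (481 * 30 ^ E) ^ Suc j * (L + T)" by (simp only: power_Suc mult_ac)
      finally have "word ((481 * 30 ^ E) ^ Suc j * (L + T)) g'" by (rule word_of_mono[OF g'(4)])
      then show ?thesis using g' by blast
    qed
  qed
qed

lemma commutator_step:
  assumes g: "g permutes {1..n}" "g \<noteq> id" and word: "word L g"
    and small: "card (moved n g) \<le> 3 / 10 * real n"
  defines "s \<equiv> real (card (moved n g))"
  shows "\<exists>x. x permutes {1..n} \<and> x \<noteq> id \<and> evenperm x \<and> word (4 * L + 4 * T) x \<and>
    card (moved n x) \<le> 3 + 3 * (101 / 100 * s\<^sup>2 / n) \<and>
    (101 / 100 * s\<^sup>2 < n \<longrightarrow> card (moved n x) \<le> 3)"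
proof -
  obtain p where p: "p permutes {1..n}" "0 < w p" "commutator g (conj_by p g) \<noteq> id"
    "card (moved n (commutator g (conj_by p g))) \<le> 3 + 3 * (101 / 100 * s\<^sup>2 / n)"
    "101 / 100 * s\<^sup>2 < n \<longrightarrow> card (moved n (commutator g (conj_by p g))) \<le> 3"
    using commutator_stage[OF g nu _ n small] unfolding s_def by auto
  have h: "conj_by p g permutes {1..n}" using conj_by_permutes[OF g(1) p(1)] .
  have "commutator g (conj_by p g) permutes {1..n}" unfolding commutator_def
    by (intro permutes_compose permutes_inv h g(1))
  then show ?thesis using p evenperm_commutator[OF g(1) h] word_commutator[OF word p(2)] by blast
qed

lemma small_support_cyc3:
  assumes g: "g permutes {1..n}" "g \<noteq> id" and word: "word L g"
    and small: "card (moved n g) \<le> 3 / 10 * real n"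
      "101 / 100 * (real (card (moved n g)))\<^sup>2 < n"
  shows "\<exists>a b c. {a, b, c} \<subseteq> {1..n} \<and> distinct [a, b, c] \<and> word (4 ^ Suc k * (L + 2 * T)) (cyc3 a b c)"
proof -
  obtain x where x: "x permutes {1..n}" "x \<noteq> id" "evenperm x" "word (4 * L + 4 * T) x"
    "card (moved n x) \<le> 3"
    using commutator_step[OF g word small(1)] small(2) by auto
  have "1 * (4 * L + 4 * T) \<le> 4 ^ k * (4 * (L + 2 * T))" by (intro mult_le_mono) auto
  also have "\<dots> = 4 ^ Suc k * (L + 2 * T)" by (simp only: power_Suc mult_ac)
  finally have "word (4 ^ Suc k * (L + 2 * T)) x" by (intro word_of_mono[OF x(4)]) simp
  then show ?thesis using small_even_is_cyc3[OF x(1,3,2,5)] by blast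
qed

text \<open>
  As long as \<open>1.01 * s\<^sup>2 \<ge> n\<close>, the bound \<open>3 + 3.03 * s\<^sup>2 / n\<close> is at most \<open>3 + 0.909 * s\<close>
  because of \<open>s \<le> 3/10 * n\<close>, and this is below \<open>19/20 * s\<close> for \<open>s \<ge> 100\<close>.
\<close>
lemma descend_small:
  "g permutes {1..n} \<Longrightarrow> g \<noteq> id \<Longrightarrow> word L g \<Longrightarrow> card (moved n g) \<le> 3 / 10 * real n \<Longrightarrow>
    (19 / 20) ^ k * real (card (moved n g)) \<le> 1 \<Longrightarrow>
    \<exists>a b c. {a, b, c} \<subseteq> {1..n} \<and> distinct [a, b, c] \<and> word (4 ^ Suc k * (L + 2 * T)) (cyc3 a b c)"
proof (induction k arbitrary: g L)
  case 0
  define s where "s = real (card (moved n g))"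
  have "s \<le> 1" "0 \<le> s" using "0.prems"(5) unfolding s_def by auto
  then have "s\<^sup>2 \<le> 1" by (intro power_le_one)
  then have "101 / 100 * s\<^sup>2 < n" using n by simp
  then show ?case using small_support_cyc3[OF "0.prems"(1-4)] unfolding s_def by blast
next
  case (Suc k)
  let ?D = "\<lambda>g. moved n g"
  define s where "s = real (card (?D g))"
  show ?case
  proof (cases "101 / 100 * s\<^sup>2 < n")
    case True
    then show ?thesis using small_support_cyc3[OF Suc.prems(1-4)] unfolding s_def by blast
  next
    case False
    obtain x where x: "x permutes {1..n}" "x \<noteq> id" "word (4 * L + 4 * T) x"
      "card (?D x) \<le> 3 + 3 * (101 / 100 * s\<^sup>2 / n)"
      using commutator_step[OF Suc.prems(1-4)] unfolding s_def by blast
    have n0: "0 < real n" using n by simp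
    have s0: "0 \<le> s" unfolding s_def by simp
    have "s * s \<le> s * (3 / 10 * n)" using Suc.prems(4) s0 unfolding s_def by (intro mult_left_mono) auto
    then have "101 / 100 * s\<^sup>2 / n \<le> 303 / 1000 * s"
      using n0 by (simp add: power2_eq_square field_simps)
    moreover have "100 \<le> s"
    proof (rule ccontr)
      assume "\<not> 100 \<le> s"
      then have "s\<^sup>2 \<le> 100\<^sup>2" using s0 by (intro power_mono) auto
      then show False using False n by simp
    qed
    ultimately have le: "real (card (?D x)) \<le> 19 / 20 * s" using x(4) by linarith
    then have "real (card (?D x)) \<le> 3 / 10 * real n" using Suc.prems(4) s0 unfolding s_def by linarith
    moreover have "(19 / 20) ^ k * real (card (?D x)) \<le> 1"
    proof -
      have "(19 / 20) ^ k * real (card (?D x)) \<le> (19 / 20) ^ k * (19 / 20 * s)"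
        using le by (intro mult_left_mono) auto
      also have "\<dots> \<le> 1" using Suc.prems(5) unfolding s_def by (simp add: mult.assoc mult.left_commute)
      finally show ?thesis .
    qed
    ultimately obtain a b c where abc: "{a, b, c} \<subseteq> {1..n}" "distinct [a, b, c]"
      "word (4 ^ Suc k * (4 * L + 4 * T + 2 * T)) (cyc3 a b c)"
      using Suc.IH[OF x(1-3)] by blast
    have "4 ^ Suc k * (4 * L + 4 * T + 2 * T) \<le> 4 ^ Suc k * (4 * (L + 2 * T))" by (intro mult_le_mono2) simp
    also have "\<dots> = 4 ^ Suc (Suc k) * (L + 2 * T)" by (simp only: power_Suc mult_ac)
    finally have "word (4 ^ Suc (Suc k) * (L + 2 * T)) (cyc3 a b c)" by (rule word_of_mono[OF abc(3)])
    then show ?thesis using abc by blast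
  qed
qed

end

section \<open>Diameter bounds\<close>

lemma permutation_of_tuples:
  "xs \<in> tuples n t \<Longrightarrow> ys \<in> tuples n t \<Longrightarrow> \<exists>p. p permutes {1..n} \<and> map p xs = ys"
proof (induction t arbitrary: xs ys)
  case 0
  then show ?case by (intro exI[of _ id] conjI permutes_id) (auto simp: tuples_def)
next
  case (Suc t)
  then obtain x xs' y ys' where xy: "xs = x # xs'" "ys = y # ys'"
    unfolding tuples_def by (auto simp: length_Suc_conv)
  have t: "xs' \<in> tuples n t" "ys' \<in> tuples n t" "x \<in> {1..n}" "y \<in> {1..n}" "x \<notin> set xs'" "y \<notin> set ys'"
    using Suc.prems unfolding xy tuples_def by auto
  obtain p where p: "p permutes {1..n}" "map p xs' = ys'" using Suc.IH[OF t(1,2)] by blast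
  have "p x \<notin> set ys'" using t(5) inj_image_mem_iff[OF permutes_inj[OF p(1)]] unfolding p(2)[symmetric] set_map by blast
  then have "map (transpose (p x) y) ys' = ys'"
    using t(6) by (intro map_idI) (auto simp: transpose_def)
  then have "map (transpose (p x) y \<circ> p) xs = ys" unfolding xy using p(2) by (simp flip: map_map)
  moreover have "transpose (p x) y \<circ> p permutes {1..n}"
    using permutes_in_image[OF p(1)] t(3,4) by (intro permutes_compose[OF p(1)] permutes_swap_id) auto
  ultimately show ?case by blast
qed

text \<open>
  An odd permutation can be corrected by transposing two points outside of the tuple. This is
  why the alternating group is no obstacle to mixing on few points.
\<close>
lemma even_permutation_of_tuples:
  assumes "xs \<in> tuples n t" "ys \<in> tuples n t" "t + 2 \<le> n"
  shows "\<exists>p. p permutes {1..n} \<and> evenperm p \<and> map p xs = ys"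
proof -
  obtain p where p: "p permutes {1..n}" "map p xs = ys" using permutation_of_tuples[OF assms(1,2)] by blast
  show ?thesis
  proof (cases "evenperm p")
    case False
    have ys: "set ys \<subseteq> {1..n}" "card (set ys) = t" using assms(2) unfolding tuples_def by (auto simp: distinct_card)
    then have "2 \<le> card ({1..n} - set ys)" using assms(3) by (simp add: card_Diff_subset)
    then obtain A where "A \<subseteq> {1..n} - set ys" "card A = 2" by (rule obtain_subset_with_card_n)
    then obtain u v where uv: "u \<noteq> v" "u \<in> {1..n} - set ys" "v \<in> {1..n} - set ys"
      unfolding card_2_iff by blast
    let ?q = "transpose u v \<circ> p"
    have "?q permutes {1..n}" using uv by (intro permutes_compose[OF p(1)] permutes_swap_id) auto
    moreover have "permutation p" using p(1) permutation_permutes by blast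
    then have "evenperm ?q" using False uv(1) by (simp add: evenperm_comp permutation_swap_id evenperm_swap)
    moreover have "map (transpose u v) ys = ys" using uv by (intro map_idI) (auto simp: transpose_def)
    then have "map ?q xs = ys" using p(2) by (simp flip: map_map)
    ultimately show ?thesis by blast
  qed (use p in blast)
qed

lemma card_tuples_le: "card (tuples n t) \<le> n ^ t"
proof -
  have "card (tuples n t) \<le> card {xs. set xs \<subseteq> {1..n} \<and> length xs = t}"
    unfolding tuples_def by (intro card_mono finite_lists_length_eq) auto
  then show ?thesis by (simp add: card_lists_length_eq)
qed

lemma tuples_nonempty: assumes "t \<le> n" shows "tuples n t \<noteq> {}"
proof -
  have "[1..<Suc t] \<in> tuples n t" using assms unfolding tuples_def by auto
  then show ?thesis by blast
qed

definition mixing_length :: "nat \<Rightarrow> nat" where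
  "mixing_length n = 608 * (n ^ 500) ^ 7"

locale generated =
  fixes n :: nat and G :: "(nat \<Rightarrow> nat) monoid" and S :: "(nat \<Rightarrow> nat) set"
  assumes G: "G = sym_group n \<or> G = alt_group n"
    and S: "S \<subseteq> carrier G" and gen: "generate G S = carrier G"
begin

lemma is_group: "group G" using G sym_group_is_group alt_group_is_group by blast

lemma carrier_permutes: "p \<in> carrier G \<Longrightarrow> p permutes {1..n}"
  using G by (auto simp: sym_group_carrier alt_group_carrier)

lemma even_in_carrier: "p permutes {1..n} \<Longrightarrow> evenperm p \<Longrightarrow> p \<in> carrier G"
  using G by (auto simp: sym_group_carrier alt_group_carrier)

lemma mult_G: "mult G = (\<circ>)" and one_G: "one G = id"
  using G by (auto simp: sym_group_mult alt_group_mult sym_group_one alt_group_one)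

lemma inv_G: "p \<in> carrier G \<Longrightarrow> m_inv G p = inv' p"
  using G alt_group_inv_equality sym_group_inv_equality by blast

lemma finite_carrier: "finite (carrier G)"
  by (rule finite_subset[OF _ finite_permutations[of "{1..n}"]]) (use carrier_permutes in auto)

lemma S_permutes: "s \<in> S \<Longrightarrow> s permutes {1..n}" using S carrier_permutes by blast

lemma composite_surj:
  assumes "p \<in> carrier G" shows "\<exists>ss. set ss \<subseteq> S \<and> composite ss = p"
proof -
  have "word_lengths G S p \<noteq> {}"
    using group.generate_word[OF is_group finite_carrier S] gen assms by blast
  then show ?thesis unfolding word_lengths_def composite_def mult_G one_G by blast
qed

lemma transitive_tuples:
  assumes "t + 2 \<le> n" "S \<noteq> {}" shows "transitive_on_tuples n t S"
proof
  show "\<And>s. s \<in> S \<Longrightarrow> s permutes {1..n}" by (rule S_permutes)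
  show "tuples n t \<noteq> {}" using tuples_nonempty assms(1) by simp
  show "S \<noteq> {}" by (rule assms(2))
  fix xs ys assume "xs \<in> tuples n t" "ys \<in> tuples n t"
  then obtain p where "p permutes {1..n}" "evenperm p" "map p xs = ys"
    using even_permutation_of_tuples assms(1) by blast
  then show "\<exists>ss. set ss \<subseteq> S \<and> map (composite ss) xs = ys"
    using composite_surj[OF even_in_carrier] by metis
qed

lemma odd_generator:
  assumes "p \<in> carrier G" "\<not> evenperm p" shows "\<exists>s\<in>S. \<not> evenperm s"
proof (rule ccontr)
  assume none: "\<not> ?thesis"
  obtain ss where ss: "set ss \<subseteq> S" "composite ss = p" using composite_surj[OF assms(1)] by blast
  have "set ss \<subseteq> S \<Longrightarrow> permutation (composite ss) \<and> evenperm (composite ss)" for ss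
  proof (induction ss)
    case (Cons s ss)
    then have "permutation s" "evenperm s" using none S_permutes permutation_permutes by auto
    moreover have "permutation (composite ss)" "evenperm (composite ss)" using Cons by auto
    ultimately show ?case unfolding composite_simps using evenperm_comp permutation_compose by blast
  qed (simp_all only: composite_simps evenperm_id permutation_id)
  then show False using ss assms(2) by blast
qed

text \<open>
  From \<open>63/100\<close> to \<open>3/10\<close> the proportion of moved points falls by \<open>33/100 = 1320 / 4000\<close>,
  hence the exponent 1320. The \<open>14 * E\<close> steps at small support suffice since
  \<open>(19/20) ^ 14 \<le> 1/2\<close> and the support has at most \<open>2 ^ E\<close> points.
\<close>
lemma all_words:
  assumes n: "10 ^ 12 \<le> n" and E: "n \<le> 2 ^ E"
    and g: "g \<in> S" "g \<noteq> id" "card (moved n g) \<le> 63 / 100 * real n"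
    and p: "p \<in> carrier G"
  shows "word_of (two_sided S)
    (n * (4 ^ Suc (14 * E) * ((481 * 30 ^ E) ^ 1320 * (1 + mixing_length n) + 2 * mixing_length n) + 2 * (n ^ 3)\<^sup>2) + 1) p"
proof -
  have ne: "S \<noteq> {}" using g(1) by blast
  interpret t500: transitive_on_tuples n 500 S using n by (intro transitive_tuples ne) simp
  interpret t3: transitive_on_tuples n 3 S using n by (intro transitive_tuples ne) simp
  obtain w where w: "near_uniform n 500 (1 / 10 ^ 5) w"
    "\<And>p. w p \<noteq> 0 \<Longrightarrow> word_of S (608 * card (tuples n 500) ^ 7) p"
    using t500.mixing n by auto
  interpret mixed n "mixing_length n" S w
  proof
    show "word_of S (mixing_length n) p" if "w p \<noteq> 0" for p
      using w(2)[OF that] unfolding mixing_length_def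
      by (rule word_of_mono) (intro mult_le_mono2 power_mono card_tuples_le, simp)
  qed (use S_permutes w(1) n in auto)
  have "word 1 g" unfolding word_of_def two_sided_def using g(1) by (intro exI[of _ "[g]"]) auto
  moreover have "card (moved n g) \<le> 3 / 10 * real n + real 1320 * (real n / 4000)" using g(3) by simp
  ultimately obtain g1 where g1: "g1 permutes {1..n}" "g1 \<noteq> id" "word ((481 * 30 ^ E) ^ 1320 * (1 + mixing_length n)) g1"
    "card (moved n g1) \<le> 3 / 10 * real n"
    using descend_large[OF E S_permutes[OF g(1)] g(2) _ g(3), of 1 1320] by blast
  have "(19 / 20) ^ (14 * E) * real (card (moved n g1)) \<le> 1"
  proof -
    have "card (moved n g1) \<le> card {1..n}" by (intro card_mono) auto
    then have "card (moved n g1) \<le> 2 ^ E" using E by simp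
    then have "real (card (moved n g1)) \<le> real (2 ^ E)" by (simp only: of_nat_le_iff)
    then have "real (card (moved n g1)) \<le> 2 ^ E" by simp
    moreover have "(19 / 20 :: real) ^ (14 * E) \<le> (1 / 2) ^ E"
      unfolding power_mult by (intro power_mono) (simp_all add: power_divide)
    ultimately have "(19 / 20) ^ (14 * E) * real (card (moved n g1)) \<le> (1 / 2) ^ E * 2 ^ E"
      by (intro mult_mono) auto
    then show ?thesis by (simp flip: power_mult_distrib)
  qed
  from descend_small[OF g1 this] obtain a b c where abc: "{a, b, c} \<subseteq> {1..n}" "distinct [a, b, c]"
    "word (4 ^ Suc (14 * E) * ((481 * 30 ^ E) ^ 1320 * (1 + mixing_length n) + 2 * mixing_length n)) (cyc3 a b c)" by blast
  define L where "L = 4 ^ Suc (14 * E) * ((481 * 30 ^ E) ^ 1320 * (1 + mixing_length n) + 2 * mixing_length n)"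
  have cyc: "word (L + 2 * (n ^ 3)\<^sup>2) (cyc3 a' b' c')" if "{a', b', c'} \<subseteq> {1..n}" "distinct [a', b', c']" for a' b' c'
  proof -
    have tup: "[a', b', c'] \<in> tuples n 3" "[a, b, c] \<in> tuples n 3" using that abc(1,2) unfolding tuples_def by auto
    obtain q where q: "word_of S ((card (tuples n 3))\<^sup>2) q" "map q [a', b', c'] = [a, b, c]"
      using t3.short_word[OF tup] by (elim exE conjE)
    have "word_of S ((n ^ 3)\<^sup>2) q" using q(1) by (rule word_of_mono) (intro power_mono card_tuples_le, simp)
    then have wq: "word ((n ^ 3)\<^sup>2) q" by (rule word_of_two_sided)
    have "q permutes {1..n}"
    proof -
      obtain ss where "set ss \<subseteq> S" "composite ss = q" using q(1) unfolding word_of_def by blast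
      moreover have "set ss \<subseteq> S \<Longrightarrow> composite ss permutes {1..n}" for ss
      proof (induction ss)
        case (Cons s ss)
        then have "composite ss permutes {1..n}" "s permutes {1..n}" using S_permutes by auto
        then show ?case unfolding composite_simps by (rule permutes_compose)
      qed (simp only: composite_simps permutes_id)
      ultimately show ?thesis by blast
    qed
    then have "inv' q \<circ> cyc3 (q a') (q b') (q c') \<circ> q = cyc3 a' b' c'" by (rule cyc3_conj)
    moreover have "q a' = a" "q b' = b" "q c' = c" using q(2) by simp_all
    ultimately have "inv' q \<circ> cyc3 a b c \<circ> q = cyc3 a' b' c'" by (simp only:)
    moreover have "word ((n ^ 3)\<^sup>2 + L + (n ^ 3)\<^sup>2) (inv' q \<circ> cyc3 a b c \<circ> q)"
      by (intro word_of_comp word_of_inv[OF S_permutes wq] wq abc(3)[folded L_def])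
    moreover have "(n ^ 3)\<^sup>2 + L + (n ^ 3)\<^sup>2 = L + 2 * (n ^ 3)\<^sup>2" by simp
    ultimately show ?thesis by (simp only:)
  qed
  have even: "word (n * (L + 2 * (n ^ 3)\<^sup>2)) q" if "q permutes {1..n}" "evenperm q" for q
  proof -
    have "card (moved n q) \<le> card {1..n}" by (intro card_mono) auto
    then have "(L + 2 * (n ^ 3)\<^sup>2) * card (moved n q) \<le> n * (L + 2 * (n ^ 3)\<^sup>2)"
      by (simp add: mult.commute)
    moreover have "word ((L + 2 * (n ^ 3)\<^sup>2) * card (moved n q)) q"
      by (rule even_word[OF _ _ that]) (fact S_permutes, fact cyc)
    ultimately show ?thesis by (rule word_of_mono[rotated])
  qed
  have "word (n * (L + 2 * (n ^ 3)\<^sup>2) + 1) p"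
  proof (cases "evenperm p")
    case True
    then show ?thesis using word_of_mono[OF even[OF carrier_permutes[OF p]]] by simp
  next
    case False
    then obtain s where s: "s \<in> S" "\<not> evenperm s" using odd_generator p by blast
    have sp: "s permutes {1..n}" "p permutes {1..n}" using S_permutes s(1) carrier_permutes p by auto
    then have perm: "permutation s" "permutation p" using permutation_permutes by blast+
    have "inv' s \<circ> p permutes {1..n}" using permutes_compose[OF sp(2) permutes_inv[OF sp(1)]] .
    moreover have "evenperm (inv' s \<circ> p)"
      using False s(2) perm by (simp add: evenperm_comp evenperm_inv permutation_inverse)
    ultimately have "word (n * (L + 2 * (n ^ 3)\<^sup>2)) (inv' s \<circ> p)" by (rule even)
    moreover have "word 1 s" unfolding word_of_def two_sided_def using s(1) by (intro exI[of _ "[s]"]) auto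
    ultimately have "word (1 + n * (L + 2 * (n ^ 3)\<^sup>2)) (s \<circ> (inv' s \<circ> p))" by (rule word_of_comp[rotated])
    moreover have "s \<circ> (inv' s \<circ> p) = p" using permutes_inv_o(1)[OF sp(1)] by (simp add: o_assoc)
    ultimately show ?thesis by (simp add: add.commute)
  qed
  then show ?thesis unfolding L_def .
qed

text \<open>
  The order of the group is at most \<open>n ^ n \<le> 2 ^ (n * n)\<close>.
\<close>
lemma diameter_le:
  assumes D: "0 < D" and words: "\<And>p. p \<in> carrier G \<Longrightarrow> word_of (two_sided S) D p"
  shows "digraph_diameter (cayley_digraph G S) \<le> ereal (real (4 * D * (n * n)))"
proof -
  interpret group G by (rule is_group)
  have "card (carrier G) \<le> card {p. p permutes {1..n}}"
    using carrier_permutes finite_permutations[of "{1..n}"] by (intro card_mono) auto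
  also have "\<dots> = fact n" by (simp add: card_permutations)
  also have "\<dots> \<le> n ^ n" using fact_le_power[of n, where 'a = nat] by simp
  also have "\<dots> \<le> (2 ^ n) ^ n" by (intro power_mono) (auto simp: less_imp_le)
  finally have order: "order G \<le> 2 ^ (n * n)" unfolding order_def by (simp add: power_mult)
  have words': "\<exists>ss. set ss \<subseteq> S \<union> m_inv G ` S \<and> length ss \<le> D \<and> foldr (\<otimes>\<^bsub>G\<^esub>) ss \<one>\<^bsub>G\<^esub> = p"
    if "p \<in> carrier G" for p
  proof -
    have "m_inv G ` S = inv' ` S" using inv_G S by (intro image_cong) auto
    then show ?thesis using words[OF that] unfolding word_of_def two_sided_def composite_def mult_G one_G by auto
  qed
  have "wf_digraph.\<mu> (cayley_digraph G S) (\<lambda>_. 1) u v \<le> ereal (real (4 * D * (n * n)))"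
    if uv: "u \<in> carrier G" "v \<in> carrier G" for u v
  proof -
    have vu: "v \<otimes>\<^bsub>G\<^esub> m_inv G u \<in> carrier G" using uv by simp
    have "\<exists>m\<le>4 * D * (n * n). m \<in> word_lengths G S (v \<otimes>\<^bsub>G\<^esub> m_inv G u)"
      by (rule directed_word_length[OF finite_carrier S D _ order vu]) (rule words')
    then obtain m where m: "m \<le> 4 * D * (n * n)" "m \<in> word_lengths G S (v \<otimes>\<^bsub>G\<^esub> m_inv G u)"
      by blast
    have "wf_digraph.\<mu> (cayley_digraph G S) (\<lambda>_. 1) u v \<le> ereal (real m)"
      unfolding cayley_distance[OF S uv] by (rule INF_lower[OF m(2)])
    also have "\<dots> \<le> ereal (real (4 * D * (n * n)))" using m(1) by (simp only: ereal_less_eq of_nat_le_iff)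
    finally show ?thesis .
  qed
  then show ?thesis unfolding digraph_diameter_def by (intro SUP_least) (simp add: cayley_digraph_simps)
qed

end

text \<open>
  The bound starts at 2 so that constant factors can be absorbed into the exponent.
\<close>
definition poly_bounded :: "(nat \<Rightarrow> nat) \<Rightarrow> bool" where
  "poly_bounded f \<longleftrightarrow> (\<exists>d. \<forall>n\<ge>2. f n \<le> n ^ d)"

lemma poly_bounded_const: "poly_bounded (\<lambda>n. c)"
proof -
  have "c \<le> n ^ c" if "2 \<le> n" for n :: nat
  proof -
    have "c \<le> 2 ^ c" by (simp add: less_imp_le)
    also have "\<dots> \<le> n ^ c" using that by (rule power_mono) simp
    finally show ?thesis .
  qed
  then show ?thesis unfolding poly_bounded_def by blast
qed

lemma poly_bounded_id: "poly_bounded (\<lambda>n. n)"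
  unfolding poly_bounded_def by (intro exI[of _ 1]) simp

lemma poly_bounded_mult: "poly_bounded f \<Longrightarrow> poly_bounded g \<Longrightarrow> poly_bounded (\<lambda>n. f n * g n)"
  unfolding poly_bounded_def
proof (elim exE)
  fix d e assume "\<forall>n\<ge>2. f n \<le> n ^ d" "\<forall>n\<ge>2. g n \<le> n ^ e"
  then show "\<exists>d. \<forall>n\<ge>2. f n * g n \<le> n ^ d"
    by (intro exI[of _ "d + e"]) (auto simp: power_add intro: mult_le_mono)
qed

lemma poly_bounded_power: "poly_bounded f \<Longrightarrow> poly_bounded (\<lambda>n. f n ^ k)"
  by (induction k) (auto intro: poly_bounded_mult simp: poly_bounded_const[of 1, simplified])

lemma poly_bounded_add:
  assumes "poly_bounded f" "poly_bounded g" shows "poly_bounded (\<lambda>n. f n + g n)"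
proof -
  obtain d e where de: "\<And>n. 2 \<le> n \<Longrightarrow> f n \<le> n ^ d" "\<And>n. 2 \<le> n \<Longrightarrow> g n \<le> n ^ e"
    using assms unfolding poly_bounded_def by blast
  have "f n + g n \<le> n ^ Suc (max d e)" if n: "2 \<le> n" for n
  proof -
    have "n ^ d \<le> n ^ max d e" "n ^ e \<le> n ^ max d e" using n by (auto intro: power_increasing)
    then have "f n + g n \<le> 2 * n ^ max d e" using de[OF n] by linarith
    also have "\<dots> \<le> n ^ Suc (max d e)" using n by simp
    finally show ?thesis .
  qed
  then show ?thesis unfolding poly_bounded_def by blast
qed

text \<open>
  The bound of \<open>all_words\<close>, with \<open>30 ^ E \<le> (2 * n) ^ 5\<close> and \<open>4 ^ (14 * E) \<le> (2 * n) ^ 28\<close> for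
  the least \<open>E\<close> with \<open>n \<le> 2 ^ E\<close>.
\<close>
definition length_bound :: "nat \<Rightarrow> nat" where
  "length_bound n = n * (4 * (4 * (2 * n) ^ 28) *
     ((481 * (2 * n) ^ 5) ^ 1320 * (1 + mixing_length n) + 2 * mixing_length n) + 2 * (n ^ 3)\<^sup>2) + 1"

lemma poly_bounded_length_bound: "poly_bounded (\<lambda>n. 4 * length_bound n * (n * n))"
  unfolding length_bound_def mixing_length_def
  by (intro poly_bounded_mult poly_bounded_add poly_bounded_power poly_bounded_const poly_bounded_id)

lemma (in generated) large_degree:
  assumes n: "10 ^ 12 \<le> n" and g: "g \<in> S" "g \<noteq> id" "card (moved n g) \<le> 63 / 100 * real n"
  shows "digraph_diameter (cayley_digraph G S) \<le> ereal (real (4 * length_bound n * (n * n)))"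
proof (rule diameter_le)
  show "0 < length_bound n" unfolding length_bound_def
    by (intro add_nonneg_pos zero_le zero_less_one)
  fix p assume p: "p \<in> carrier G"
  define E where "E = (LEAST E. n \<le> 2 ^ E)"
  have E: "n \<le> 2 ^ E" unfolding E_def by (rule LeastI[of _ n]) (simp add: less_imp_le)
  have "2 ^ E \<le> 2 * n"
  proof (cases E)
    case 0 then show ?thesis using n by simp
  next
    case (Suc k)
    then have "\<not> n \<le> 2 ^ k" unfolding E_def by (intro not_less_Least) simp
    then show ?thesis using Suc by simp
  qed
  note E2 = this
  have "(30::nat) ^ E \<le> 32 ^ E" by (rule power_mono) auto
  also have "(32::nat) ^ E = (2 ^ E) ^ 5" by (simp add: power_mult[symmetric] mult.commute[of E] power_mult)
  also have "\<dots> \<le> (2 * n) ^ 5" using E2 by (rule power_mono) simp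
  finally have b30: "30 ^ E \<le> (2 * n) ^ 5" .
  have "(4::nat) ^ (14 * E) = (2 ^ E) ^ 28"
  proof -
    have "(4::nat) ^ (14 * E) = (2 ^ 2) ^ (14 * E)" by simp
    also have "\<dots> = 2 ^ (2 * (14 * E))" by (simp only: power_mult)
    also have "2 * (14 * E) = E * 28" by simp
    finally show ?thesis by (simp only: power_mult)
  qed
  also have "\<dots> \<le> (2 * n) ^ 28" using E2 by (rule power_mono) simp
  finally have b4: "4 ^ Suc (14 * E) \<le> 4 * (4 * (2 * n) ^ 28)" by simp
  show "word_of (two_sided S) (length_bound n) p"
    unfolding length_bound_def
    by (rule word_of_mono[OF all_words[OF n E g p]])
      (intro add_mono mult_le_mono order_refl power_mono b30 b4 zero_le)
qed

text \<open>
  There are only finitely many groups and generating sets of bounded degree, and each has a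
  finite diameter.
\<close>
lemma small_degree:
  "\<exists>K::real. \<forall>n<n0. \<forall>G S. generated n G S \<longrightarrow> digraph_diameter (cayley_digraph G S) \<le> ereal K"
proof -
  define h where "h = (\<lambda>(G :: (nat \<Rightarrow> nat) monoid, S). real (Max ((\<lambda>g. LEAST m. m \<in> word_lengths G S g) ` carrier G)))"
  define Q where "Q = (\<Union>n<n0. {sym_group n, alt_group n} \<times> Pow {p. p permutes {1..n}})"
  have "finite Q" unfolding Q_def using finite_permutations by auto
  have "digraph_diameter (cayley_digraph G S) \<le> ereal (Max (insert 0 (h ` Q)))"
    if "n < n0" and gen: "generated n G S" for n G S
  proof -
    interpret generated n G S by (rule gen)
    have "(G, S) \<in> Q" unfolding Q_def using \<open>n < n0\<close> G S_permutes by blast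
    then have "h (G, S) \<le> Max (insert 0 (h ` Q))" using \<open>finite Q\<close> by (intro Max_ge) auto
    moreover have "digraph_diameter (cayley_digraph G S) = ereal (h (G, S))"
      unfolding h_def prod.case
      by (rule group.cayley_diameter_eq_Max_word_length[OF is_group finite_carrier S gen])
    ultimately show ?thesis by simp
  qed
  then show ?thesis by blast
qed

theorem corollary1p4:
  shows "\<exists>d>0. \<exists>K::real. \<forall>(n::nat) G S.
    (G = sym_group n \<or> G = alt_group n) \<and>
    S \<subseteq> carrier G \<and> generate G S = carrier G \<and>
    (\<exists>g\<in>S. g \<noteq> \<one>\<^bsub>G\<^esub> \<and> real (card (supp n g)) \<le> 0.63 * real n) \<longrightarrow>
    digraph_diameter (cayley_digraph G S) \<le> ereal (K * real n powr d)"
proof -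
  obtain d where d: "\<And>n. 2 \<le> n \<Longrightarrow> 4 * length_bound n * (n * n) \<le> n ^ d"
    using poly_bounded_length_bound unfolding poly_bounded_def by blast
  obtain K where K: "\<And>n G S. n < 10 ^ 12 \<Longrightarrow> generated n G S \<Longrightarrow>
      digraph_diameter (cayley_digraph G S) \<le> ereal K"
    using small_degree[of "10 ^ 12"] by blast
  have "digraph_diameter (cayley_digraph G S) \<le> ereal (max 1 K * real n powr real (Suc d))"
    if gd: "generated n G S" and g: "g \<in> S" "g \<noteq> \<one>\<^bsub>G\<^esub>" "real (card (supp n g)) \<le> 0.63 * real n"
    for n G S g
  proof -
    interpret generated n G S by (rule gd)
    have g_id: "g \<noteq> id" using g(2) one_G by simp
    have n1: "1 \<le> n"
    proof (rule ccontr)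
      assume "\<not> 1 \<le> n"
      then have "g permutes {}" using S_permutes[OF g(1)] by simp
      then show False using g_id by simp
    qed
    then have pow: "1 \<le> real n powr real (Suc d)" "real n powr real (Suc d) = real n ^ Suc d"
      by (simp_all add: powr_realpow one_le_power del: of_nat_Suc power_Suc)
    show ?thesis
    \<comment> \<open>From \<open>10 ^ 12\<close> on, the terms of order \<open>1/n\<close> are negligible in all estimates.\<close>
    proof (cases "n < 10 ^ 12")
      case True
      have "K \<le> max 1 K * 1" by simp
      also have "\<dots> \<le> max 1 K * real n powr real (Suc d)" using pow(1) by (intro mult_left_mono) auto
      finally show ?thesis using K[OF True gd] by (meson ereal_less_eq(3) order_trans)
    next
      case False
      then have big: "10 ^ 12 \<le> n" by simp
      have "card {x \<in> {1..n}. g x \<noteq> x} \<le> 63 / 100 * real n" using g(3) unfolding supp_def by simp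
      note large_degree[OF big g(1) g_id this]
      also have "real (4 * length_bound n * (n * n)) \<le> real (n ^ d)"
        unfolding of_nat_le_iff by (rule d) (use big in simp)
      also have "real (n ^ d) \<le> 1 * real n ^ Suc d" using n1 by simp
      also have "\<dots> \<le> max 1 K * real n powr real (Suc d)"
        unfolding pow(2) by (intro mult_right_mono) auto
      finally show ?thesis by simp
    qed
  qed
  then show ?thesis
    by (intro exI[of _ "real (Suc d)"] exI[of _ "max 1 K"] conjI allI impI)
      (auto simp: generated_def simp del: of_nat_Suc)
qed

end
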